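(* Let $L$ be a rootless (positive-definite) even lattice of rank $m$ and let $g\in O(L)$ be a fixed-point free isometry of odd prime order $p$. Let $\hat g\in O(\hat L)$ be a lift of $g$. Suppose there exist $\tau\in\mathrm{Aut}(V_L^{\hat g})$, $1\le j\le p-1$, $0\le r\le p-1$ and $\lambda+L\in\mathcal{D}(L)\setminus\{L\}$ with $(1-g)\lambda\in L$ such that $V_L(j)\circ\tau\cong V_{\lambda+L}(r)$ as $V_L^{\hat g}$-modules. Then $L\cong L_B(C)$ for some self-orthogonal code $C$ of length $m/(p-1)$ over $\mathbb{Z}_p$. Moreover, $g$ corresponds to $g_{\Delta,e}$ with respect to some $e\in C^\perp$ of Hamming weight $m/(p-1)$ and some base $\Delta$ of the root system $N(2)$, where $N=\mathrm{Span}_{\mathbb{Z}}\{\lambda,L\}$. In particular, $C^\perp$ contains a codeword of Hamming weight $m/(p-1)$.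
   Context: $\mathcal{D}(L)=L^*/L$ is the discriminant group; rootless means no norm-$2$ vectors; $N(2)$ is the set of norm-$2$ vectors of $N$; $g$ is fixed-point free if only $0$ is fixed. $V_L$ is the lattice vertex operator algebra over $\mathbb{C}$ of $L$ and $V_{\lambda+L}$ its irreducible module for $\lambda+L\in\mathcal{D}(L)$. $\hat L$ is the central extension of $L$ by $\{\pm1\}$ with commutator map $(-1)^{(\cdot|\cdot)}$ and elements $\pm e^\alpha$; $O(\hat L)\subset\mathrm{Aut}(V_L)$ is the group of automorphisms $\varphi$ of $\hat L$ inducing an isometry $\bar\varphi$ of $L$ via $\varphi(e^\alpha)\in\{\pm e^{\bar\varphi(\alpha)}\}$; a lift of $g$ is $\hat g\in O(\hat L)$ with $\bar{\hat g}=g$ (it has order $p$). $V_L^{\hat g}$ is the fixed-point subVOA. If $(1-g)\lambda\in L$, then $V_{\lambda+L}\circ\hat g\cong V_{\lambda+L}$; fix a linear automorphism $\hat g_{\lambda+L}$ of $V_{\lambda+L}$ of order $p$ with $\hat g_{\lambda+L}Y(a,z)=Y(\hat ga,z)\hat g_{\lambda+L}$ for $a\in V_L$ (with $\hat g_L=\hat g$), and put $V_{\lambda+L}(i)=\{v:\hat g_{\lambda+L}v=e^{2\pi\sqrt{-1}i/p}v\}$, an irreducible $V_L^{\hat g}$-module. For $\tau\in\mathrm{Aut}(V)$ and a $V$-module $(M,Y_M)$, $M\circ\tau$ is $M$ with $Y_{M\circ\tau}(a,z)=Y_M(\tau a,z)$. Constructions A, B. A code of length $t$ over $\mathbb{Z}_p=\mathbb{Z}/p\mathbb{Z}$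 is a subgroup $C\subset\mathbb{Z}_p^t$; $C^\perp$ is its dual for $\langle x|y\rangle=\sum x_iy_i$; self-orthogonal means $C\subset C^\perp$; Hamming weight is the number of nonzero coordinates. The root lattice of type $A_{p-1}$ is $A=\{(a_i)\in\mathbb{Z}^p:\sum a_i=0\}$ with base $v_i-v_{i+1}$ ($v_i$ the standard basis), Weyl vector $\rho=\frac12(p-1,p-3,\dots,-p+1)$, fundamental weights $\lambda_j=\frac1p((p-j)\sum_{i\le j}v_i-j\sum_{i>j}v_i)$; $A^*/A\cong\mathbb{Z}_p$ via $\lambda_j+A\leftrightarrow j$. For $R=R_1\perp\dots\perp R_t$ ($R_i$ copies of $A$), base $\Delta=\bigcup\Delta_i$, canonical $\nu:R^*\to R^*/R\cong\mathbb{Z}_p^t$, $\chi_\Delta=\frac1p(\rho_{\Delta_1},\dots,\rho_{\Delta_t})$: $L_A(C)=\nu^{-1}(C)$, $L_B(C)=\{\alpha\in L_A(C):(\alpha|\chi_\Delta)\in\mathbb{Z}\}$. $g_{\Delta_i}$ is the isometry $(x_1,\dots,x_p)\mapsto(x_p,x_1,\dots,x_{p-1})$ of $R_i$ and $g_{\Delta,e}=(g_{\Delta_1}^{e_1},\dots,g_{\Delta_t}^{e_t})$ for $e\in\mathbb{Z}_p^t$. "Correspond" means via an isometry $N\cong L_A(C)$ carrying $L$ to $L_B(C)$. *)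

theory Defs
  imports
    "HOL-Analysis.Analysis"
    "HOL-Library.Poly_Mapping"
    "HOL-Library.Groups_Big_Fun"
    "HOL-Library.Function_Algebras"
    "HOL-Algebra.Product_Groups"
    "HOL-Algebra.Elementary_Groups"
begin

section \<open>Lattices\<close>

text \<open>
  A positive-definite lattice of rank \<open>m\<close> is realised as the \<open>\<int>\<close>-span of an \<open>\<real>\<close>-basis of the
  euclidean space \<open>'a = \<real> \<otimes> L\<close>; hence \<open>m = DIM('a)\<close>, and isometries of the lattice are the orthogonal
  transformations of \<open>'a\<close> preserving it.
\<close>

definition int_span :: "'a::real_vector set \<Rightarrow> 'a set" where
  "int_span S = {\<Sum>x\<in>T. of_int (c x) *\<^sub>R x | T (c :: 'a \<Rightarrow> int). finite T \<and> T \<subseteq> S}"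

definition full_lattice :: "'a::euclidean_space set \<Rightarrow> bool" where
  "full_lattice L \<longleftrightarrow> (\<exists>B. independent B \<and> span B = UNIV \<and> L = int_span B)"

definition even_lattice :: "'a::euclidean_space set \<Rightarrow> bool" where
  "even_lattice L \<longleftrightarrow> full_lattice L \<and> (\<forall>x\<in>L. \<exists>k::int. x \<bullet> x = 2 * of_int k)"

definition norm2_vectors :: "'a::real_inner set \<Rightarrow> 'a set" where
  "norm2_vectors L = {x \<in> L. x \<bullet> x = 2}"

definition rootless :: "'a::real_inner set \<Rightarrow> bool" where
  "rootless L \<longleftrightarrow> norm2_vectors L = {}"

definition dual_lattice :: "'a::euclidean_space set \<Rightarrow> 'a set" where
  "dual_lattice L = {x. \<forall>y\<in>L. x \<bullet> y \<in> \<int>}"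

definition lattice_isometries :: "'a::euclidean_space set \<Rightarrow> ('a \<Rightarrow> 'a) set" where
  "lattice_isometries L = {g. orthogonal_transformation g \<and> g ` L = L}"

definition fixed_point_free_on :: "'a::zero set \<Rightarrow> ('a \<Rightarrow> 'a) \<Rightarrow> bool" where
  "fixed_point_free_on L g \<longleftrightarrow> (\<forall>x\<in>L. g x = x \<longrightarrow> x = 0)"

definition has_order_on :: "'b set \<Rightarrow> ('b \<Rightarrow> 'b) \<Rightarrow> nat \<Rightarrow> bool" where
  "has_order_on S f n \<longleftrightarrow> n > 0 \<and> (\<forall>x\<in>S. (f ^^ n) x = x) \<and>
     (\<forall>k. 0 < k \<and> k < n \<longrightarrow> (\<exists>x\<in>S. (f ^^ k) x \<noteq> x))"

definition lattice_isom ::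
  "'b::ab_group_add set \<Rightarrow> ('b \<Rightarrow> 'b \<Rightarrow> real) \<Rightarrow> 'c::ab_group_add set \<Rightarrow> ('c \<Rightarrow> 'c \<Rightarrow> real) \<Rightarrow> ('b \<Rightarrow> 'c) \<Rightarrow> bool"
where
  "lattice_isom L ip L' ip' \<phi> \<longleftrightarrow> bij_betw \<phi> L L' \<and>
     (\<forall>x\<in>L. \<forall>y\<in>L. \<phi> (x + y) = \<phi> x + \<phi> y) \<and> (\<forall>x\<in>L. \<forall>y\<in>L. ip' (\<phi> x) (\<phi> y) = ip x y)"

definition root_base :: "'a::euclidean_space set \<Rightarrow> 'a set \<Rightarrow> bool" where
  "root_base \<Phi> \<Delta> \<longleftrightarrow> \<Delta> \<subseteq> \<Phi> \<and> independent \<Delta> \<and>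
     (\<forall>\<alpha>\<in>\<Phi>. \<exists>c :: 'a \<Rightarrow> nat. \<alpha> = (\<Sum>\<delta>\<in>\<Delta>. of_nat (c \<delta>) *\<^sub>R \<delta>) \<or> \<alpha> = - (\<Sum>\<delta>\<in>\<Delta>. of_nat (c \<delta>) *\<^sub>R \<delta>))"

section \<open>Vertex operator algebras and modules\<close>

text \<open>
  Complex vector spaces are subspaces of spaces \<open>'i \<Rightarrow>\<^sub>0 complex\<close> of finitely supported functions.
\<close>

definition scale :: "complex \<Rightarrow> ('i \<Rightarrow>\<^sub>0 complex) \<Rightarrow> ('i \<Rightarrow>\<^sub>0 complex)" where
  "scale c v = Poly_Mapping.map ((*) c) v"

definition lin_ext :: "('i \<Rightarrow> ('k \<Rightarrow>\<^sub>0 complex)) \<Rightarrow> ('i \<Rightarrow>\<^sub>0 complex) \<Rightarrow> ('k \<Rightarrow>\<^sub>0 complex)" where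
  "lin_ext f v = (\<Sum>i\<in>Poly_Mapping.keys v. scale (Poly_Mapping.lookup v i) (f i))"

definition linear_on_space :: "('i \<Rightarrow>\<^sub>0 complex) set \<Rightarrow> (('i \<Rightarrow>\<^sub>0 complex) \<Rightarrow> ('k \<Rightarrow>\<^sub>0 complex)) \<Rightarrow> bool" where
  "linear_on_space V f \<longleftrightarrow> (\<forall>u\<in>V. \<forall>v\<in>V. f (u + v) = f u + f v) \<and> (\<forall>c. \<forall>v\<in>V. f (scale c v) = scale c (f v))"

text \<open>
  A vertex operator \<open>Y(a,z) = \<Sum>\<^sub>n a\<^sub>(\<^sub>n\<^sub>) z\<^sup>-\<^sup>n\<^sup>-\<^sup>1\<close> is given by its modes: \<open>Y a n v\<close> is \<open>a\<^sub>(\<^sub>n\<^sub>) v\<close>.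
\<close>

record 'i voa =
  space :: "('i \<Rightarrow>\<^sub>0 complex) set"
  Y :: "('i \<Rightarrow>\<^sub>0 complex) \<Rightarrow> int \<Rightarrow> ('i \<Rightarrow>\<^sub>0 complex) \<Rightarrow> ('i \<Rightarrow>\<^sub>0 complex)"
  vac :: "'i \<Rightarrow>\<^sub>0 complex"
  conf :: "'i \<Rightarrow>\<^sub>0 complex"

record ('i, 'k) voa_module =
  mspace :: "('k \<Rightarrow>\<^sub>0 complex) set"
  mY :: "('i \<Rightarrow>\<^sub>0 complex) \<Rightarrow> int \<Rightarrow> ('k \<Rightarrow>\<^sub>0 complex) \<Rightarrow> ('k \<Rightarrow>\<^sub>0 complex)"

definition voa_Aut :: "'i voa \<Rightarrow> (('i \<Rightarrow>\<^sub>0 complex) \<Rightarrow> ('i \<Rightarrow>\<^sub>0 complex)) set" where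
  "voa_Aut V = {\<tau>. bij_betw \<tau> (space V) (space V) \<and> linear_on_space (space V) \<tau> \<and>
     (\<forall>a\<in>space V. \<forall>b\<in>space V. \<forall>n. \<tau> (Y V a n b) = Y V (\<tau> a) n (\<tau> b)) \<and>
     \<tau> (vac V) = vac V \<and> \<tau> (conf V) = conf V}"

definition fixed_subVOA :: "'i voa \<Rightarrow> (('i \<Rightarrow>\<^sub>0 complex) \<Rightarrow> ('i \<Rightarrow>\<^sub>0 complex)) \<Rightarrow> 'i voa" where
  "fixed_subVOA V f = V\<lparr>space := {v \<in> space V. f v = v}\<rparr>"

definition module_twist ::
  "('i, 'k) voa_module \<Rightarrow> (('i \<Rightarrow>\<^sub>0 complex) \<Rightarrow> ('i \<Rightarrow>\<^sub>0 complex)) \<Rightarrow> ('i, 'k) voa_module" where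
  "module_twist M \<tau> = M\<lparr>mY := (\<lambda>a n v. mY M (\<tau> a) n v)\<rparr>"

definition module_isomorphic :: "'i voa \<Rightarrow> ('i, 'k) voa_module \<Rightarrow> ('i, 'l) voa_module \<Rightarrow> bool" where
  "module_isomorphic V M M' \<longleftrightarrow> (\<exists>f. bij_betw f (mspace M) (mspace M') \<and> linear_on_space (mspace M) f \<and>
     (\<forall>a\<in>space V. \<forall>n. \<forall>v\<in>mspace M. f (mY M a n v) = mY M' a n (f v)))"

definition eigen_module ::
  "('i, 'k) voa_module \<Rightarrow> nat \<Rightarrow> (('k \<Rightarrow>\<^sub>0 complex) \<Rightarrow> ('k \<Rightarrow>\<^sub>0 complex)) \<Rightarrow> nat \<Rightarrow> ('i, 'k) voa_module" where
  "eigen_module M p f j = M\<lparr>mspace := {v \<in> mspace M. f v = scale (exp (2 * pi * \<i> * of_nat j / of_nat p)) v}\<rparr>"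

section \<open>The lattice VOA and its modules\<close>

subsection \<open>Central extension\<close>

text \<open>
  With respect to a section \<open>\<alpha> \<mapsto> e\<^sup>\<alpha>\<close> with \<open>e\<^sup>0 = 1\<close>, the extension of \<open>L\<close> by \<open>{\<plusminus>1}\<close> is given by the
  normalised 2-cocycle with \<open>e\<^sup>\<alpha> e\<^sup>\<beta> = \<epsilon>(\<alpha>,\<beta>) e\<^sup>\<alpha>\<^sup>+\<^sup>\<beta>\<close>; the pair \<open>(s, \<alpha>)\<close> stands for \<open>s e\<^sup>\<alpha>\<close>.
\<close>

definition lattice_cocycle :: "'a::euclidean_space set \<Rightarrow> ('a \<Rightarrow> 'a \<Rightarrow> int) \<Rightarrow> bool" where
  "lattice_cocycle L \<epsilon> \<longleftrightarrow>
     (\<forall>\<alpha>\<in>L. \<forall>\<beta>\<in>L. \<epsilon> \<alpha> \<beta> \<in> {1, -1}) \<and>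
     (\<forall>\<alpha>\<in>L. \<epsilon> 0 \<alpha> = 1 \<and> \<epsilon> \<alpha> 0 = 1) \<and>
     (\<forall>\<alpha>\<in>L. \<forall>\<beta>\<in>L. \<forall>\<gamma>\<in>L. \<epsilon> \<alpha> \<beta> * \<epsilon> (\<alpha> + \<beta>) \<gamma> = \<epsilon> \<beta> \<gamma> * \<epsilon> \<alpha> (\<beta> + \<gamma>)) \<and>
     (\<forall>\<alpha>\<in>L. \<forall>\<beta>\<in>L. \<epsilon> \<alpha> \<beta> * \<epsilon> \<beta> \<alpha> = (if even \<lfloor>\<alpha> \<bullet> \<beta>\<rfloor> then 1 else -1))"

definition L_hat :: "'a::euclidean_space set \<Rightarrow> ('a \<Rightarrow> 'a \<Rightarrow> int) \<Rightarrow> (int \<times> 'a) monoid" where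
  "L_hat L \<epsilon> = \<lparr>carrier = {1, -1} \<times> L,
     monoid.mult = (\<lambda>(s, \<alpha>) (u, \<beta>). (s * u * \<epsilon> \<alpha> \<beta>, \<alpha> + \<beta>)), one = (1, 0)\<rparr>"

definition lifts ::
  "'a::euclidean_space set \<Rightarrow> ('a \<Rightarrow> 'a \<Rightarrow> int) \<Rightarrow> ('a \<Rightarrow> 'a) \<Rightarrow> (int \<times> 'a \<Rightarrow> int \<times> 'a) set" where
  "lifts L \<epsilon> g = {\<phi> \<in> iso (L_hat L \<epsilon>) (L_hat L \<epsilon>). \<forall>\<alpha>\<in>L. \<phi> (1, \<alpha>) \<in> {(1, g \<alpha>), (-1, g \<alpha>)}}"

subsection \<open>Fock space\<close>

text \<open>
  The index \<open>(M, \<mu>)\<close> stands for the vector \<open>b\<^sub>1(-n\<^sub>1) \<cdots> b\<^sub>k(-n\<^sub>k) \<otimes> e\<^sup>\<mu>\<close>, where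
  \<open>M = {#(b\<^sub>1, n\<^sub>1), \<dots>, (b\<^sub>k, n\<^sub>k)#}\<close> with \<open>b\<^sub>i\<close> in the orthonormal basis \<open>Basis\<close> of \<open>\<real> \<otimes> L\<close> and \<open>n\<^sub>i \<ge> 1\<close>.
  The ring multiplication of \<open>_ \<Rightarrow>\<^sub>0 _\<close> is that of the polynomial algebra \<open>M(1)\<close> tensored with the
  \<^emph>\<open>untwisted\<close> group algebra; it is used only for multiplication by elements of \<open>M(1)\<close> and, in
  \<open>lift_action\<close>, for forming \<open>x \<otimes> e\<^sup>\<alpha>\<close>.
\<close>

type_synonym 'a fock_index = "('a \<times> nat) multiset \<times> 'a"
type_synonym 'a fock = "'a fock_index \<Rightarrow>\<^sub>0 complex"

definition fock_space :: "'a::euclidean_space set \<Rightarrow> 'a \<Rightarrow> 'a fock set" where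
  "fock_space L lam = {v. \<forall>(M, \<mu>)\<in>Poly_Mapping.keys v. set_mset M \<subseteq> Basis \<times> {1..} \<and> \<mu> - lam \<in> L}"

text \<open>The element \<open>h(-n)\<close> of the polynomial algebra.\<close>

definition creation :: "'a::euclidean_space \<Rightarrow> nat \<Rightarrow> 'a fock" where
  "creation h n = (\<Sum>b\<in>Basis. Poly_Mapping.single ({#(b, n)#}, 0) (of_real (h \<bullet> b)))"

text \<open>
  The Heisenberg operators \<open>h(n)\<close>; for \<open>n > 0\<close>, \<open>h(n)\<close> is the derivation with
  \<open>[h(n), b(-n)] = n (h|b)\<close>.
\<close>

definition heis :: "'a::euclidean_space \<Rightarrow> int \<Rightarrow> 'a fock \<Rightarrow> 'a fock" where
  "heis h n v =
    (if n < 0 then creation h (nat (- n)) * v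
     else if n = 0 then lin_ext (\<lambda>(M, \<mu>). Poly_Mapping.single (M, \<mu>) (of_real (h \<bullet> \<mu>))) v
     else lin_ext (\<lambda>(M, \<mu>). \<Sum>b\<in>Basis. Poly_Mapping.single (M - {#(b, nat n)#}, \<mu>)
            (of_int n * of_real (h \<bullet> b) * of_nat (count M (b, nat n)))) v)"

subsection \<open>Vertex operators\<close>

text \<open>Coefficient of \<open>z\<^sup>k\<close> in \<open>(\<Sum>\<^sub>i\<^sub>\<ge>\<^sub>1 A\<^sub>i z\<^sup>i)\<^sup>j\<close>, respectively in \<open>exp (\<Sum>\<^sub>i\<^sub>\<ge>\<^sub>1 A\<^sub>i z\<^sup>i)\<close>.\<close>

primrec op_power :: "(nat \<Rightarrow> 'v \<Rightarrow> 'v::comm_monoid_add) \<Rightarrow> nat \<Rightarrow> nat \<Rightarrow> 'v \<Rightarrow> 'v" where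
  "op_power A 0 k v = (if k = 0 then v else 0)"
| "op_power A (Suc j) k v = (\<Sum>i=1..k. A i (op_power A j (k - i) v))"

definition op_exp :: "(nat \<Rightarrow> 'a fock \<Rightarrow> 'a fock) \<Rightarrow> nat \<Rightarrow> 'a fock \<Rightarrow> 'a fock" where
  "op_exp A k v = (\<Sum>j\<le>k. scale (1 / fact j) (op_power A j k v))"

text \<open>
  \<open>exp (\<Sum>\<^sub>i\<^sub>\<ge>\<^sub>1 \<alpha>(-i) z\<^sup>i / i)\<close>, coefficient of \<open>z\<^sup>k\<close>, and \<open>exp (- \<Sum>\<^sub>i\<^sub>\<ge>\<^sub>1 \<alpha>(i) z\<^sup>-\<^sup>i / i)\<close>, coefficient of \<open>z\<^sup>-\<^sup>l\<close>.
\<close>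

definition E_minus :: "'a::euclidean_space \<Rightarrow> nat \<Rightarrow> 'a fock \<Rightarrow> 'a fock" where
  "E_minus \<alpha> k v = op_exp (\<lambda>i u. scale (1 / of_nat i) (heis \<alpha> (- int i) u)) k v"

definition E_plus :: "'a::euclidean_space \<Rightarrow> nat \<Rightarrow> 'a fock \<Rightarrow> 'a fock" where
  "E_plus \<alpha> l v = op_exp (\<lambda>i u. scale (- 1 / of_nat i) (heis \<alpha> (int i) u)) l v"

text \<open>
  The modes of \<open>Y(e\<^sup>\<alpha>,z) = exp (\<Sum>\<^sub>i\<^sub>\<ge>\<^sub>1 \<alpha>(-i) z\<^sup>i / i) exp (- \<Sum>\<^sub>i\<^sub>\<ge>\<^sub>1 \<alpha>(i) z\<^sup>-\<^sup>i / i) e\<^sup>\<alpha> z\<^sup>\<alpha>\<^sup>(\<^sup>0\<^sup>)\<close> on \<open>V\<^bsub>lam+L\<^esub>\<close>, where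
  \<open>e\<^sup>\<alpha> e\<^sup>\<mu> = \<epsilon>(\<alpha>, \<mu> - lam) e\<^sup>\<mu>\<^sup>+\<^sup>\<alpha>\<close>.  The coefficient of \<open>z\<^sup>-\<^sup>n\<^sup>-\<^sup>1\<close> collects the terms \<open>z\<^sup>k z\<^sup>-\<^sup>l z\<^sup>(\<^sup>\<alpha>\<^sup>|\<^sup>\<mu>\<^sup>)\<close>
  with \<open>k - l + (\<alpha>|\<mu>) = - n - 1\<close>; here \<open>(\<alpha>|\<mu>)\<close> is an integer, as \<open>\<mu>\<close> lies in the dual lattice.
\<close>

definition exp_modes :: "('a::euclidean_space \<Rightarrow> 'a \<Rightarrow> int) \<Rightarrow> 'a \<Rightarrow> 'a \<Rightarrow> int \<Rightarrow> 'a fock \<Rightarrow> 'a fock" where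
  "exp_modes \<epsilon> lam \<alpha> n v = lin_ext (\<lambda>(M, \<mu>). Sum_any (\<lambda>l::nat.
     let k = int l - n - 1 - \<lfloor>\<alpha> \<bullet> \<mu>\<rfloor> in
     if k < 0 then 0
     else E_minus \<alpha> (nat k) (E_plus \<alpha> l (Poly_Mapping.single (M, \<alpha> + \<mu>) (of_int (\<epsilon> \<alpha> (\<mu> - lam))))))) v"

text \<open>
  If \<open>F\<close> are the modes of \<open>Y(a,z)\<close>, then the modes of \<open>Y(b(-k)a,z)\<close> are those of the normally ordered
  product of \<open>1/(k-1)! (d/dz)\<^sup>k\<^sup>-\<^sup>1 b(z)\<close> and \<open>Y(a,z)\<close>, where \<open>b(z) = \<Sum>\<^sub>m b(m) z\<^sup>-\<^sup>m\<^sup>-\<^sup>1\<close>, and the \<open>b(m)\<close> with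
  \<open>m < 0\<close> stand to the left of \<open>Y(a,z)\<close>, the others to the right.
  On any vector only finitely many \<open>m\<close> contribute.
\<close>

definition heis_step ::
  "'a::euclidean_space \<times> nat \<Rightarrow> (int \<Rightarrow> 'a fock \<Rightarrow> 'a fock) \<Rightarrow> (int \<Rightarrow> 'a fock \<Rightarrow> 'a fock)" where
  "heis_step = (\<lambda>(b, k) F n v. Sum_any (\<lambda>m::int. scale ((of_int (- m - 1) :: complex) gchoose (k - 1))
     (if m < 0 then heis b m (F (n - m - int k) v) else F (n - m - int k) (heis b m v))))"

text \<open>
  \<open>vertex_op \<epsilon> lam a n\<close> is the mode \<open>a\<^sub>(\<^sub>n\<^sub>)\<close> of \<open>a \<in> V\<^sub>L\<close> on \<open>V\<^bsub>lam+L\<^esub>\<close>.  The steps for different factors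
  \<open>b(-k)\<close> commute, so the order in which the multiset is processed is irrelevant.
\<close>

definition vertex_op ::
  "('a::euclidean_space \<Rightarrow> 'a \<Rightarrow> int) \<Rightarrow> 'a \<Rightarrow> 'a fock \<Rightarrow> int \<Rightarrow> 'a fock \<Rightarrow> 'a fock" where
  "vertex_op \<epsilon> lam a n v = lin_ext (\<lambda>(M, \<alpha>). fold_mset heis_step (exp_modes \<epsilon> lam \<alpha>) M n v) a"

definition lattice_VOA :: "'a::euclidean_space set \<Rightarrow> ('a \<Rightarrow> 'a \<Rightarrow> int) \<Rightarrow> 'a fock_index voa" where
  "lattice_VOA L \<epsilon> = \<lparr>space = fock_space L 0, Y = vertex_op \<epsilon> 0,
     vac = Poly_Mapping.single ({#}, 0) 1,
     conf = (\<Sum>b\<in>Basis. Poly_Mapping.single ({#(b, 1), (b, 1)#}, 0) (1 / 2))\<rparr>"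

definition lattice_module ::
  "'a::euclidean_space set \<Rightarrow> ('a \<Rightarrow> 'a \<Rightarrow> int) \<Rightarrow> 'a \<Rightarrow> ('a fock_index, 'a fock_index) voa_module" where
  "lattice_module L \<epsilon> lam = \<lparr>mspace = fock_space L lam, mY = vertex_op \<epsilon> lam\<rparr>"

text \<open>
  The action of a lift \<open>\<phi>\<close> of \<open>g\<close> on \<open>V\<^sub>L\<close>:
  \<open>b\<^sub>1(-n\<^sub>1) \<cdots> b\<^sub>k(-n\<^sub>k) \<otimes> e\<^sup>\<alpha> \<mapsto> (g b\<^sub>1)(-n\<^sub>1) \<cdots> (g b\<^sub>k)(-n\<^sub>k) \<otimes> \<phi>(e\<^sup>\<alpha>)\<close>.
\<close>

definition lift_action ::
  "('a::euclidean_space \<Rightarrow> 'a) \<Rightarrow> (int \<times> 'a \<Rightarrow> int \<times> 'a) \<Rightarrow> 'a fock \<Rightarrow> 'a fock" where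
  "lift_action g \<phi> v = lin_ext (\<lambda>(M, \<alpha>). (\<Prod>(b, n)\<in>#M. creation (g b) n) *
     Poly_Mapping.single ({#}, snd (\<phi> (1, \<alpha>))) (of_int (fst (\<phi> (1, \<alpha>))))) v"

definition module_lift ::
  "'a::euclidean_space set \<Rightarrow> ('a \<Rightarrow> 'a \<Rightarrow> int) \<Rightarrow> nat \<Rightarrow> ('a fock \<Rightarrow> 'a fock) \<Rightarrow> 'a \<Rightarrow> ('a fock \<Rightarrow> 'a fock) \<Rightarrow> bool" where
  "module_lift L \<epsilon> p f lam G \<longleftrightarrow>
     bij_betw G (fock_space L lam) (fock_space L lam) \<and> linear_on_space (fock_space L lam) G \<and>
     has_order_on (fock_space L lam) G p \<and>
     (\<forall>a\<in>fock_space L 0. \<forall>n. \<forall>v\<in>fock_space L lam.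
        G (vertex_op \<epsilon> lam a n v) = vertex_op \<epsilon> lam (f a) n (G v))"

section \<open>Codes and Constructions A and B\<close>

definition Zp_power :: "nat \<Rightarrow> nat \<Rightarrow> (nat \<Rightarrow> int) monoid" where
  "Zp_power p t = product_group {..<t} (\<lambda>_. integer_mod_group p)"

definition is_code :: "nat \<Rightarrow> nat \<Rightarrow> (nat \<Rightarrow> int) set \<Rightarrow> bool" where
  "is_code p t C \<longleftrightarrow> subgroup C (Zp_power p t)"

definition dual_code :: "nat \<Rightarrow> nat \<Rightarrow> (nat \<Rightarrow> int) set \<Rightarrow> (nat \<Rightarrow> int) set" where
  "dual_code p t C = {x \<in> carrier (Zp_power p t). \<forall>y\<in>C. (\<Sum>i<t. x i * y i) mod int p = 0}"

definition self_orthogonal :: "nat \<Rightarrow> nat \<Rightarrow> (nat \<Rightarrow> int) set \<Rightarrow> bool" where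
  "self_orthogonal p t C \<longleftrightarrow> C \<subseteq> dual_code p t C"

definition hamming_weight :: "nat \<Rightarrow> (nat \<Rightarrow> int) \<Rightarrow> nat" where
  "hamming_weight t x = card {i \<in> {..<t}. x i \<noteq> 0}"

text \<open>
  Coordinates are numbered from 0: a vector of \<open>\<real>\<^sup>p\<close> is a function vanishing outside \<open>{..<p}\<close>, and
  a vector of \<open>(\<real>\<^sup>p)\<^sup>t\<close> is a function \<open>x\<close> with blocks \<open>x 0, \<dots>, x (t - 1)\<close> that vanishes elsewhere.
\<close>

definition A_space :: "nat \<Rightarrow> (nat \<Rightarrow> real) set" where
  "A_space p = {a. (\<forall>j\<ge>p. a j = 0) \<and> (\<Sum>j<p. a j) = 0}"

definition A_lattice :: "nat \<Rightarrow> (nat \<Rightarrow> real) set" where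
  "A_lattice p = {a \<in> A_space p. \<forall>j. a j \<in> \<int>}"

definition std_basis :: "nat \<Rightarrow> nat \<Rightarrow> real" where
  "std_basis i = (\<lambda>j. if j = i then 1 else 0)"

definition weyl_vector :: "nat \<Rightarrow> nat \<Rightarrow> real" where
  "weyl_vector p = (\<lambda>j. if j < p then (real p - 1 - 2 * real j) / 2 else 0)"

text \<open>For \<open>k = 0\<close> this is the zero vector.\<close>

definition fund_weight :: "nat \<Rightarrow> nat \<Rightarrow> nat \<Rightarrow> real" where
  "fund_weight p k = (\<lambda>j. if j < k then (real p - real k) / real p else if j < p then - real k / real p else 0)"

definition block_inner :: "nat \<Rightarrow> nat \<Rightarrow> (nat \<Rightarrow> nat \<Rightarrow> real) \<Rightarrow> (nat \<Rightarrow> nat \<Rightarrow> real) \<Rightarrow> real" where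
  "block_inner p t x y = (\<Sum>i<t. \<Sum>j<p. x i j * y i j)"

definition R_lattice :: "nat \<Rightarrow> nat \<Rightarrow> (nat \<Rightarrow> nat \<Rightarrow> real) set" where
  "R_lattice p t = {x. (\<forall>i<t. x i \<in> A_lattice p) \<and> (\<forall>i\<ge>t. x i = 0)}"

definition R_dual :: "nat \<Rightarrow> nat \<Rightarrow> (nat \<Rightarrow> nat \<Rightarrow> real) set" where
  "R_dual p t = {x. (\<forall>i<t. x i \<in> A_space p) \<and> (\<forall>i\<ge>t. x i = 0) \<and>
     (\<forall>y\<in>R_lattice p t. block_inner p t x y \<in> \<int>)}"

text \<open>The map \<open>R\<^sup>* \<rightarrow> R\<^sup>*/R \<cong> \<int>\<^sub>p\<^sup>t\<close>, the \<open>k\<close>-th fundamental weight corresponding to \<open>k\<close>.\<close>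

definition R_quot :: "nat \<Rightarrow> nat \<Rightarrow> (nat \<Rightarrow> nat \<Rightarrow> real) \<Rightarrow> (nat \<Rightarrow> int)" where
  "R_quot p t x = (\<lambda>i\<in>{..<t}. THE k. k \<in> {0..<int p} \<and> x i - fund_weight p (nat k) \<in> A_lattice p)"

definition R_base :: "nat \<Rightarrow> nat \<Rightarrow> (nat \<Rightarrow> nat \<Rightarrow> real) set" where
  "R_base p t = {(\<lambda>i'. if i' = i then std_basis j - std_basis (Suc j) else 0) | i j. i < t \<and> Suc j < p}"

definition chi :: "nat \<Rightarrow> nat \<Rightarrow> (nat \<Rightarrow> nat \<Rightarrow> real)" where
  "chi p t = (\<lambda>i j. if i < t then weyl_vector p j / real p else 0)"

definition L_A :: "nat \<Rightarrow> nat \<Rightarrow> (nat \<Rightarrow> int) set \<Rightarrow> (nat \<Rightarrow> nat \<Rightarrow> real) set" where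
  "L_A p t C = {x \<in> R_dual p t. R_quot p t x \<in> C}"

definition L_B :: "nat \<Rightarrow> nat \<Rightarrow> (nat \<Rightarrow> int) set \<Rightarrow> (nat \<Rightarrow> nat \<Rightarrow> real) set" where
  "L_B p t C = {x \<in> L_A p t C. block_inner p t x (chi p t) \<in> \<int>}"

definition cyc_shift :: "nat \<Rightarrow> (nat \<Rightarrow> real) \<Rightarrow> (nat \<Rightarrow> real)" where
  "cyc_shift p a = (\<lambda>j. if j < p then a ((j + p - 1) mod p) else 0)"

definition g_Delta :: "nat \<Rightarrow> nat \<Rightarrow> (nat \<Rightarrow> int) \<Rightarrow> (nat \<Rightarrow> nat \<Rightarrow> real) \<Rightarrow> (nat \<Rightarrow> nat \<Rightarrow> real)" where
  "g_Delta p t e x = (\<lambda>i. if i < t then (cyc_shift p ^^ nat (e i)) (x i) else 0)"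

end

theory Submission
  imports Defs "HOL-Computational_Algebra.Polynomial_Factorial" "HOL-Number_Theory.Cong"
begin

text \<open>
  An automorphism of a VOA preserves the conformal vector, so an isomorphism
  \<open>V\<^sub>L(j) \<circ> \<tau> \<cong> V\<^sub>\<lambda>\<^sub>+\<^sub>L(r)\<close> identifies the weight-one spaces. On the left this is an eigenspace of \<open>g\<close> on
  \<open>\<complex> \<otimes> L\<close>; on the right, since \<open>\<lambda> \<notin> L\<close>, it is spanned by the \<open>e\<^sup>\<mu>\<close> with \<open>\<mu> \<in> X = {\<mu> \<in> \<lambda> + L. (\<mu>|\<mu>) = 2}\<close>, and
  an eigenvector is determined by its coefficients at representatives of the \<open>g\<close>-orbits on \<open>X\<close>.
  A nonzero vector \<open>y\<close> yields a nonzero eigenvector \<open>\<Sum>\<^sub>i \<zeta>\<^sup>-\<^sup>i\<^sup>j g\<^sup>i y\<close>, by irreducibility of the cyclotomic polynomial,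
  and mutually orthogonal orbits yield independent ones. Hence there are at most as many vectors with
  mutually orthogonal orbits as there are \<open>g\<close>-orbits on \<open>X\<close>.

  As \<open>L\<close> is rootless, distinct elements of \<open>X\<close> have inner product \<open>0\<close> or \<open>-1\<close>. Each orbit sums up to zero, so
  distinct orbits are orthogonal and each orbit is an extended Dynkin diagram of type \<open>A\<^sub>p\<^sub>-\<^sub>1\<close>.
  By the bound above no nonzero vector is orthogonal to \<open>X\<close>, so the orbits span a full sublattice
  \<open>A\<^sub>p\<^sub>-\<^sub>1\<^sup>t\<close> of \<open>N\<close>. Omitting one root of each orbit gives a base; the choice of
  the omitted roots shifts the functional \<open>(\<cdot>|\<chi>)\<close> on \<open>L\<close> modulo \<open>\<int>\<close> by an arbitrary linear functional of the code, and one
  choice makes it vanish, whence \<open>L = L\<^sub>B(C)\<close>.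
\<close>

section \<open>Integer relations between p-th roots of unity\<close>

text \<open>The counting bound ends in an integer relation between roots of unity, so it only tests
  vectors with integral inner products along their orbits. Hence it is applied twice, to lattice
  vectors: to a nonzero vector of \<open>L\<close>, which shows that \<open>X\<close> is not empty
  and thereby that \<open>N\<close> is integral, and then to a vector of \<open>N\<close> orthogonal
  to \<open>X\<close>. The shift of the base works for the following reason. All members of
  \<open>X\<close> are congruent to \<open>lam\<close> modulo \<open>L\<close>, and
  \<open>lam\<close> has order \<open>p\<close> in N/L. An element of \<open>L\<close> with zero
  code word is an integer combination of the chosen roots, and its coefficients sum to a multiple of
  \<open>p\<close>. Each of these roots pairs with chi to 1/p modulo the integers. So the pairing is
  integral on such elements, and modulo the integers it factors through the code on
  \<open>L\<close>. The same value 1/p shows that, once \<open>L\<close> pairs integrally with chi,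
  no other vector of \<open>N\<close> does. Neighbours in the diagram of an orbit differ by a power
  \<open>g ^^ k\<close>, so \<open>g\<close> itself moves by the inverse of \<open>k\<close> modulo
  \<open>p\<close> places. This is the origin of the coordinates of \<open>e\<close>.\<close>

lemma eisenstein_aux:
  fixes a b :: "int poly" and p :: int
  assumes p: "prime p" and lead: "lead_coeff (a * b) = 1"
    and dvd: "\<And>i. i < degree (a * b) \<Longrightarrow> p dvd coeff (a * b) i"
    and a0: "p dvd coeff a 0" and b0: "\<not> p dvd coeff b 0"
  shows "is_unit b"
proof -
  have ab: "lead_coeff a * lead_coeff b = 1" using lead by (simp add: lead_coeff_mult)
  then have nz: "a \<noteq> 0" "b \<noteq> 0" by auto
  have "is_unit (lead_coeff a)" "is_unit (lead_coeff b)"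
    using ab by (metis dvd_triv_left, metis dvd_triv_right)
  then have na: "\<not> p dvd coeff a (degree a)"
    using p by (meson dvd_trans not_prime_unit)
  \<comment> \<open>The first coefficient of \<open>a\<close> not divisible by \<open>p\<close>. In
    coefficient \<open>i\<close> of the product every term but one contains an earlier coefficient
    of \<open>a\<close>, so this coefficient is not divisible by \<open>p\<close> and must be the
    leading one.\<close>
  define i where "i = (LEAST i. \<not> p dvd coeff a i)"
  have i: "\<not> p dvd coeff a i" unfolding i_def by (rule LeastI[of _ "degree a"]) (rule na)
  have below: "p dvd coeff a l" if "l < i" for l
    using not_less_Least[of l "\<lambda>i. \<not> p dvd coeff a i"] that unfolding i_def by blast
  have ile: "i \<le> degree a" unfolding i_def by (rule Least_le) (rule na)
  have "coeff (a * b) i = (\<Sum>l<i. coeff a l * coeff b (i - l)) + coeff a i * coeff b 0"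
    by (simp add: coeff_mult flip: lessThan_Suc_atMost)
  moreover have "p dvd (\<Sum>l<i. coeff a l * coeff b (i - l))"
    using below by (auto intro!: dvd_sum)
  ultimately have "\<not> p dvd coeff (a * b) i"
    using p i b0 by (simp add: dvd_add_right_iff prime_dvd_mult_iff)
  then have "degree (a * b) \<le> i" using dvd by (meson not_le)
  then have "degree b = 0" using ile nz by (simp add: degree_mult_eq)
  then obtain c where "b = [:c:]" by (rule degree_eq_zeroE)
  then show ?thesis using \<open>is_unit (lead_coeff b)\<close> by (simp add: is_unit_const_poly_iff)
qed

lemma eisenstein:
  fixes f :: "int poly" and p :: int
  assumes p: "prime p" and lead: "lead_coeff f = 1" and deg: "degree f > 0"
    and dvd: "\<And>i. i < degree f \<Longrightarrow> p dvd coeff f i" and f0: "\<not> p\<^sup>2 dvd coeff f 0"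
  shows "irreducible f"
proof (rule irreducibleI)
  show "f \<noteq> 0" using deg by auto
  show "\<not> is_unit f" using deg by (auto simp: is_unit_poly_iff)
  fix a b assume ab: "f = a * b"
  have 0: "coeff f 0 = coeff a 0 * coeff b 0" by (simp add: ab coeff_mult)
  then have "p dvd coeff a 0 \<or> p dvd coeff b 0"
    using dvd[of 0] deg p by (simp add: prime_dvd_mult_iff)
  moreover have "\<not> (p dvd coeff a 0 \<and> p dvd coeff b 0)"
    using f0 0 by (metis mult_dvd_mono power2_eq_square)
  ultimately show "is_unit a \<or> is_unit b"
    using eisenstein_aux[of p a b] eisenstein_aux[of p b a] lead dvd p by (auto simp: ab mult.commute)
qed

abbreviation ipoly :: "int poly \<Rightarrow> complex \<Rightarrow> complex" where
  "ipoly q z \<equiv> poly (map_poly of_int q) z"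

lemma ipoly_pCons: "ipoly (pCons a q) z = of_int a + z * ipoly q z"
  by (simp add: map_poly_pCons)

lemma ipoly_add: "ipoly (q + q') z = ipoly q z + ipoly q' z"
  by (induction q q' rule: poly_induct2) (simp_all add: ipoly_pCons algebra_simps)

lemma ipoly_smult: "ipoly (smult c q) z = of_int c * ipoly q z"
  by (induction q) (simp_all add: ipoly_pCons algebra_simps)

lemma ipoly_mult: "ipoly (q * q') z = ipoly q z * ipoly q' z"
  by (induction q) (simp_all add: ipoly_pCons ipoly_add ipoly_smult algebra_simps)

lemma ipoly_sum: "ipoly (sum f A) z = (\<Sum>i\<in>A. ipoly (f i) z)"
  by (induction A rule: infinite_finite_induct) (simp_all add: ipoly_add)

lemma ipoly_pcompose: "ipoly (pcompose q q') z = ipoly q (ipoly q' z)"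
  by (induction q) (simp_all add: pcompose_pCons ipoly_pCons ipoly_add ipoly_mult)

text \<open>Euclidean descent, with pseudo-division to stay within integer coefficients: the
  remainder of \<open>f\<close> by \<open>h\<close> vanishes at \<open>z\<close> as well. Once it is
  zero, \<open>f\<close>, being prime, divides \<open>h\<close> or the quotient.\<close>

lemma irreducible_root_degree_le:
  fixes f h :: "int poly"
  assumes f: "irreducible f" "ipoly f z = 0" and h: "h \<noteq> 0" "ipoly h z = 0"
  shows "degree f \<le> degree h"
  using h
proof (induction "degree h" arbitrary: h rule: less_induct)
  case less
  define q r where "q = fst (pseudo_divmod f h)" and "r = snd (pseudo_divmod f h)"
  have pd: "smult (lead_coeff h ^ (Suc (degree f) - degree h)) f = h * q + r"
    "r = 0 \<or> degree r < degree h"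
    using pseudo_divmod[of h f q r] less.prems by (auto simp: q_def r_def)
  have "ipoly r z = 0"
    using arg_cong[OF pd(1), of "\<lambda>q. ipoly q z"] f(2) less.prems
    by (simp add: ipoly_smult ipoly_add ipoly_mult)
  show ?case
  proof (cases "r = 0")
    case False
    then show ?thesis using less.hyps[of r] pd(2) \<open>ipoly r z = 0\<close> by auto
  next
    case True
    have "f dvd h * q" using pd(1) True by (metis add.right_neutral dvd_smult dvd_refl)
    moreover have "prime_elem f" using f(1) by (rule irreducible_imp_prime_elem)
    ultimately have "f dvd h \<or> f dvd q" by (simp add: prime_elem_dvd_mult_iff)
    then show ?thesis
    proof
      assume "f dvd h" then show ?thesis using less.prems by (simp add: dvd_imp_degree_le)
    next
      \<comment> \<open>Counting degrees leaves \<open>h\<close> constant, and a nonzero constant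
        has no root.\<close>
      assume "f dvd q"
      have fz: "f \<noteq> 0" using f(1) by auto
      have "smult (lead_coeff h ^ (Suc (degree f) - degree h)) f \<noteq> 0"
        using fz less.prems by simp
      with pd(1) True have q: "q \<noteq> 0" by auto
      have "degree (smult (lead_coeff h ^ (Suc (degree f) - degree h)) f) = degree f"
        using less.prems by simp
      then have "degree f = degree h + degree q"
        using pd(1) True q less.prems by (simp add: degree_mult_eq)
      moreover have "degree f \<le> degree q" using \<open>f dvd q\<close> q by (simp add: dvd_imp_degree_le)
      ultimately have "degree h = 0" by simp
      then obtain c where "h = [:c:]" by (rule degree_eq_zeroE)
      with less.prems show ?thesis by (simp add: map_poly_pCons)
    qed
  qed
qed

lemma root_of_unity_int_relation:
  fixes z :: complex and n :: "nat \<Rightarrow> int"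
  assumes p: "prime p" and z: "z ^ p = 1" "z \<noteq> 1" and rel: "(\<Sum>i<p. of_int (n i) * z ^ i) = 0"
    and i: "i < p"
  shows "n i = n 0"
proof -
  have p2: "p \<ge> 2" using p by (rule prime_ge_2_nat)
  \<comment> \<open>The polynomial ((x + 1)^p - 1) / x, that is, the cyclotomic polynomial
    translated by 1. The translation is what makes Eisenstein's criterion applicable: the lower
    coefficients are divisible by \<open>p\<close>, and the constant one equals
    \<open>p\<close>.\<close>
  define f :: "int poly" where "f = (\<Sum>i<p. monom (int (p choose Suc i)) i)"
  have cf: "coeff f i = (if i < p then int (p choose Suc i) else 0)" for i
    by (simp add: f_def coeff_sum sum.delta')
  have deg: "degree f = p - 1"
  proof (rule antisym)
    show "degree f \<le> p - 1" by (rule degree_le) (auto simp: cf)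
    show "p - 1 \<le> degree f" using p2 by (intro le_degree) (simp add: cf)
  qed
  have "irreducible f"
  proof (rule eisenstein[of "int p"])
    show "prime (int p)" using p by simp
    show "lead_coeff f = 1" using p2 by (simp add: deg cf)
    show "degree f > 0" using p2 by (simp add: deg)
    show "int p dvd coeff f i" if "i < degree f" for i
      using that p2 p dvd_choose_prime[of "Suc i" p] by (simp add: deg cf)
    have "\<not> p ^ 2 dvd p" using p2 by (metis dvd_imp_le power2_nat_le_imp_le power2_eq_square nat_dvd_1_iff_1 dvd_mult_cancel1 p prime_gt_0_nat not_prime_1)
    then show "\<not> (int p)\<^sup>2 dvd coeff f 0" using p2 by (simp add: cf flip: of_nat_power)
  qed
  moreover have "ipoly f (z - 1) = 0"
  proof -
    have "(z - 1) * ipoly f (z - 1) = (\<Sum>i<p. of_nat (p choose Suc i) * (z - 1) ^ Suc i)"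
      by (simp add: f_def ipoly_sum map_poly_monom poly_monom sum_distrib_left mult_ac)
    also have "\<dots> = (\<Sum>i\<le>p. of_nat (p choose i) * (z - 1) ^ i) - 1"
      by (simp add: sum.atMost_shift)
    also have "(\<Sum>i\<le>p. of_nat (p choose i) * (z - 1) ^ i) = ((z - 1) + 1) ^ p"
      by (subst binomial_ring) simp
    finally show ?thesis using z by simp
  qed
  ultimately have min: "h = 0" if "ipoly h (z - 1) = 0" "degree h < p - 1" for h
    using irreducible_root_degree_le[of f "z - 1" h] that deg by force
  have "z * (\<Sum>i<p. z ^ i) = (\<Sum>i<p. z ^ i)"
    using sum_gp_strict[of z p] z by auto
  then have geo: "(\<Sum>i<p. z ^ i) = 0" using z by simp
  \<comment> \<open>Subtracting \<open>n (p - 1)\<close> times the geometric sum cancels the top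
    term, which brings the degree below that of \<open>f\<close>.\<close>
  define q where "q = (\<Sum>i<p-1. monom (n i - n (p - 1)) i)"
  have cq: "coeff q i = (if i < p - 1 then n i - n (p - 1) else 0)" for i
    by (simp add: q_def coeff_sum sum.delta')
  define h where "h = pcompose q [:1, 1:]"
  have dq: "degree q \<le> p - 2" by (rule degree_le) (auto simp: cq)
  have "ipoly h (z - 1) = ipoly q z"
    by (simp add: h_def ipoly_pcompose ipoly_pCons)
  also have "\<dots> = (\<Sum>i<p-1. of_int (n i - n (p - 1)) * z ^ i)"
    by (simp add: q_def ipoly_sum map_poly_monom poly_monom)
  also have "\<dots> = (\<Sum>i<p. of_int (n i - n (p - 1)) * z ^ i)"
    using p2 by (cases p) auto
  also have "\<dots> = 0" 
    using rel geo by (simp add: left_diff_distrib sum_subtractf flip: sum_distrib_left)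
  finally have "h = 0" using dq p2 by (intro min) (simp_all add: h_def degree_pcompose)
  then have "q = 0" by (simp add: h_def pcompose_eq_0_iff)
  then have "n i = n (p - 1)" if "i < p" for i
    using cq[of i] that by (cases "i = p - 1") (auto split: if_splits)
  then show ?thesis using i p2 by (metis prime_gt_0_nat p)
qed

section \<open>Heisenberg modes on the Fock space\<close>

abbreviation lk where "lk \<equiv> Poly_Mapping.lookup"
abbreviation sg where "sg \<equiv> Poly_Mapping.single"

lemma lookup_scale [simp]: "lk (scale c v) k = c * lk v k"
  by (simp add: scale_def Poly_Mapping.map.rep_eq when_def)

lemma scale_simps [simp]:
  "scale c 0 = 0" "scale 0 v = 0" "scale 1 v = v" "scale c (scale d v) = scale (c * d) v"
  "scale c (sg k a) = sg k (c * a)"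
  by (auto intro!: poly_mapping_eqI simp: lookup_single when_def)

lemma scale_add: "scale c (u + v) = scale c u + scale c v"
  and scale_add_left: "scale (c + d) v = scale c v + scale d v"
  by (auto intro!: poly_mapping_eqI simp: lookup_add algebra_simps)

lemma scale_sum: "scale c (sum f A) = (\<Sum>i\<in>A. scale c (f i))"
  by (auto intro!: poly_mapping_eqI simp: lookup_sum sum_distrib_left)

lemma scale_mult_left: "scale c u * v = scale c (u * v)"
  by (simp add: scale_def mult_map_scale_conv_mult mult.assoc)

lemma scale_mult_right: "u * scale c v = scale c (u * v)" for u v :: "'i::comm_monoid_add \<Rightarrow>\<^sub>0 complex"
  using scale_mult_left [of c v u] by (simp add: mult.commute)

lemma keys_scale: "Poly_Mapping.keys (scale c v) \<subseteq> Poly_Mapping.keys v"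
  by (auto simp: in_keys_iff)

lemma lin_ext_alt:
  assumes "finite A" "Poly_Mapping.keys v \<subseteq> A"
  shows "lin_ext f v = (\<Sum>i\<in>A. scale (lk v i) (f i))"
  unfolding lin_ext_def using assms
  by (intro sum.mono_neutral_left) (auto simp: in_keys_iff)

lemma lin_ext_add: "lin_ext f (u + v) = lin_ext f u + lin_ext f v"
proof -
  let ?A = "Poly_Mapping.keys u \<union> Poly_Mapping.keys v"
  have "Poly_Mapping.keys (u + v) \<subseteq> ?A" by (rule Poly_Mapping.keys_add)
  then show ?thesis
    by (simp add: lin_ext_alt [of ?A] lookup_add scale_add_left sum.distrib)
qed

lemma lin_ext_scale: "lin_ext f (scale c v) = scale c (lin_ext f v)"
  using keys_scale[of c v]
  by (simp add: lin_ext_alt [of "Poly_Mapping.keys v"] scale_sum)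

lemma lin_ext_0 [simp]: "lin_ext f 0 = 0"
  by (simp add: lin_ext_def)

lemma lin_ext_single [simp]: "lin_ext f (sg k c) = scale c (f k)"
  by (simp add: lin_ext_def)

lemma lin_ext_sum: "lin_ext f (sum h A) = (\<Sum>i\<in>A. lin_ext f (h i))"
  by (induction A rule: infinite_finite_induct) (auto simp: lin_ext_add)

lemma poly_mapping_expand: "v = (\<Sum>k\<in>Poly_Mapping.keys v. sg k (lk v k))"
  by (rule poly_mapping_eqI)
     (auto simp: lookup_sum lookup_single when_def sum.delta' in_keys_iff)

lemma creation_Basis: "b \<in> Basis \<Longrightarrow> creation b n = sg ({#(b, n)#}, 0) 1"
  unfolding creation_def
  by (subst sum.remove[of _ b]) (auto simp: inner_Basis intro!: sum.neutral split: if_splits)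

lemma creation_add: "creation (x + y) n = creation x n + creation y n"
  by (simp add: creation_def inner_add_left single_add sum.distrib)

lemma creation_scaleR: "creation (c *\<^sub>R x) n = scale (of_real c) (creation x n)"
  by (simp add: creation_def scale_sum)

lemma creation_0 [simp]: "creation 0 n = 0"
  by (simp add: creation_def)

lemma heis_add: "heis h n (u + v) = heis h n u + heis h n v"
  by (simp add: heis_def distrib_left lin_ext_add)

lemma heis_zero_right [simp]: "heis h n 0 = 0"
  by (simp add: heis_def)

lemma heis_sum: "heis h n (sum f A) = (\<Sum>i\<in>A. heis h n (f i))"
  by (induction A rule: infinite_finite_induct) (auto simp: heis_add)

lemma heis_zero_left [simp]: "heis 0 n v = 0"
  by (simp add: heis_def lin_ext_def case_prod_beta)

lemma heis_0_single: "heis h 0 (sg (M, \<mu>) c) = sg (M, \<mu>) (of_real (h \<bullet> \<mu>) * c)"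
  by (simp add: heis_def mult.commute)

lemma heis_pos_single:
  assumes "b \<in> Basis" "m > 0"
  shows "heis b (int m) (sg (M, \<mu>) c) = sg (M - {#(b, m)#}, \<mu>) (of_nat m * of_nat (count M (b, m)) * c)"
proof -
  have "(\<Sum>b'\<in>Basis. sg (M - {#(b', m)#}, \<mu>) (of_nat m * complex_of_real (b \<bullet> b') * of_nat (count M (b', m)))) =
     sg (M - {#(b, m)#}, \<mu>) (of_nat m * of_nat (count M (b, m)))"
    using assms(1)
    by (subst sum.remove[of _ b]) (auto simp: inner_Basis intro!: sum.neutral split: if_splits)
  then show ?thesis using assms by (simp add: heis_def mult.commute)
qed

lemma heis_neg_single:
  assumes "b \<in> Basis" "m > 0"
  shows "heis b (- int m) (sg (M, \<mu>) c) = sg (add_mset (b, m) M, \<mu>) c"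
  using assms by (simp add: heis_def creation_Basis mult_single)

text \<open>On a basis vector, \<open>heis b (int m)\<close> removes one factor b(-m), with
  coefficient \<open>m\<close> times its multiplicity, and \<open>heis b (- int m)\<close> puts it
  back. The composite is therefore diagonal.\<close>

lemma lookup_heis_neg_pos:
  assumes "b \<in> Basis" "m > 0"
  shows "lk (heis b (- int m) (heis b (int m) v)) (M, \<mu>) = of_nat (m * count M (b, m)) * lk v (M, \<mu>)"
proof -
  have *: "heis b (- int m) (heis b (int m) (sg (M', \<mu>') c)) = sg (M', \<mu>') (of_nat (m * count M' (b, m)) * c)"
    for M' \<mu>' c
    using assms
    by (cases "(b, m) \<in># M'") (auto simp: heis_pos_single heis_neg_single not_in_iff)
  have "heis b (- int m) (heis b (int m) v) =
    (\<Sum>k\<in>Poly_Mapping.keys v. heis b (- int m) (heis b (int m) (sg k (lk v k))))"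
    by (subst poly_mapping_expand[of v]) (simp add: heis_sum)
  also have "\<dots> = (\<Sum>k\<in>Poly_Mapping.keys v. sg k (of_nat (m * count (fst k) (b, m)) * lk v k))"
    by (intro sum.cong refl) (auto simp: * simp flip: of_nat_mult)
  finally show ?thesis
    by (auto simp: lookup_sum lookup_single when_def sum.delta' in_keys_iff)
qed

lemma lookup_heis_0:
  "lk (heis h 0 v) (M, \<mu>) = of_real (h \<bullet> \<mu>) * lk v (M, \<mu>)"
proof -
  have "heis h 0 v = (\<Sum>k\<in>Poly_Mapping.keys v. heis h 0 (sg k (lk v k)))"
    by (subst poly_mapping_expand[of v]) (simp add: heis_sum)
  also have "\<dots> = (\<Sum>k\<in>Poly_Mapping.keys v. sg k (of_real (h \<bullet> snd k) * lk v k))"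
    by (intro sum.cong refl) (auto simp: heis_0_single)
  finally show ?thesis
    by (auto simp: lookup_sum lookup_single when_def sum.delta' in_keys_iff)
qed

lemma op_power_zero: "op_power (\<lambda>i u. 0) j k v = (if j = 0 \<and> k = 0 then v else 0)"
  by (cases j) auto

lemma op_exp_zero: "op_exp (\<lambda>i u. 0) k v = (if k = 0 then v else 0)"
  by (auto simp: op_exp_def op_power_zero intro!: sum.neutral)

lemma E_0: "E_minus 0 k v = (if k = 0 then v else 0)" "E_plus 0 k v = (if k = 0 then v else 0)"
  by (simp_all add: E_minus_def E_plus_def op_exp_zero)

text \<open>Both exponentials are trivial for the zero vector, and so is the exponent (0|mu). The
  series collapses to its constant term, which is mode -1: the vacuum acts as the identity.\<close>

lemma exp_modes_0:
  assumes "lattice_cocycle L \<epsilon>" "v \<in> fock_space L lam"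
  shows "exp_modes \<epsilon> lam 0 n v = (if n = -1 then v else 0)"
proof -
  have *: "(case k of (M, \<mu>) \<Rightarrow> Sum_any (\<lambda>l::nat.
     let k = int l - n - 1 - \<lfloor>0 \<bullet> \<mu>\<rfloor> in
     if k < 0 then 0
     else E_minus 0 (nat k) (E_plus 0 l (sg (M, 0 + \<mu>) (of_int (\<epsilon> 0 (\<mu> - lam))))))) =
     (if n = -1 then sg k 1 else 0)" if "k \<in> Poly_Mapping.keys v" for k
  proof -
    obtain M \<mu> where k: "k = (M, \<mu>)" by fastforce
    have "\<mu> - lam \<in> L" using that assms(2) k by (auto simp: fock_space_def)
    then have e: "\<epsilon> 0 (\<mu> - lam) = 1" using assms(1) by (auto simp: lattice_cocycle_def)
    have "(\<lambda>l::nat. let k = int l - n - 1 - \<lfloor>0 \<bullet> \<mu>\<rfloor> in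
     if k < 0 then 0
     else E_minus 0 (nat k) (E_plus 0 l (sg (M, 0 + \<mu>) (of_int (\<epsilon> 0 (\<mu> - lam)))))) =
     (\<lambda>l. (if n = -1 then sg k 1 else 0) when (l = 0))"
      by (rule ext) (auto simp: E_0 e k Let_def when_def)
    then show ?thesis unfolding k prod.case by (simp only: Sum_any_when_equal)
  qed
  have "exp_modes \<epsilon> lam 0 n v = (\<Sum>k\<in>Poly_Mapping.keys v. scale (lk v k) (if n = -1 then sg k 1 else 0))"
    unfolding exp_modes_def lin_ext_def by (intro sum.cong refl) (simp only: *)
  also have "\<dots> = (if n = -1 then v else 0)"
    by (cases "n = -1") (simp_all flip: poly_mapping_expand)
  finally show ?thesis .
qed

lemma fock_space_add: "u \<in> fock_space L lam \<Longrightarrow> v \<in> fock_space L lam \<Longrightarrow> u + v \<in> fock_space L lam"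
  using Poly_Mapping.keys_add[of u v] by (fastforce simp: fock_space_def)

lemma fock_space_scale: "v \<in> fock_space L lam \<Longrightarrow> scale c v \<in> fock_space L lam"
  using keys_scale[of c v] by (fastforce simp: fock_space_def)

lemma fock_space_0: "0 \<in> fock_space L lam"
  by (simp add: fock_space_def)

lemma fock_space_sum: "(\<And>i. i \<in> A \<Longrightarrow> f i \<in> fock_space L lam) \<Longrightarrow> sum f A \<in> fock_space L lam"
  by (induction A rule: infinite_finite_induct) (auto intro: fock_space_add fock_space_0)

lemma fock_space_single:
  "set_mset M \<subseteq> Basis \<times> {1..} \<Longrightarrow> \<mu> - lam \<in> L \<Longrightarrow> sg (M, \<mu>) c \<in> fock_space L lam"
  by (auto simp: fock_space_def)

lemma heis_Basis_fock_space:
  assumes b: "b \<in> Basis" and v: "v \<in> fock_space L lam"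
  shows "heis b n v \<in> fock_space L lam"
proof -
  have eq: "heis b n v = (\<Sum>k\<in>Poly_Mapping.keys v. heis b n (sg k (lk v k)))"
    by (subst poly_mapping_expand[of v]) (simp add: heis_sum)
  have mem: "heis b n (sg k (lk v k)) \<in> fock_space L lam" if "k \<in> Poly_Mapping.keys v" for k
  proof -
    obtain M \<mu> where k: "k = (M, \<mu>)" by fastforce
    have M: "set_mset M \<subseteq> Basis \<times> {1..}" "\<mu> - lam \<in> L"
      using that v k by (auto simp: fock_space_def)
    consider m where "m > 0" "n = int m" | m where "m > 0" "n = - int m" | "n = 0"
      by (cases n rule: int_cases3) auto
    then show ?thesis
    proof cases
      case 1
      have "set_mset (M - {#(b, m)#}) \<subseteq> Basis \<times> {1..}"
        using M(1) by (meson in_diffD subset_iff)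
      with 1 show ?thesis using M b by (simp add: k heis_pos_single fock_space_single)
    next
      case 2 then show ?thesis using M b by (auto simp: k heis_neg_single intro!: fock_space_single)
    next
      case 3 then show ?thesis using M b by (auto simp: k heis_0_single intro!: fock_space_single)
    qed
  qed
  show ?thesis unfolding eq by (rule fock_space_sum) (rule mem)
qed

text \<open>Applied to the identity field, the step for b(-1) produces the current b(z): only the
  summand \<open>m = n\<close> survives.\<close>

lemma heis_step_vacuum:
  assumes F: "\<And>n v. v \<in> fock_space L lam \<Longrightarrow> F n v = (if n = -1 then v else 0)"
    and b: "b \<in> Basis" and v: "v \<in> fock_space L lam"
  shows "heis_step (b, 1) F n v = heis b n v"
proof -
  have "(\<lambda>m::int. scale ((of_int (- m - 1) :: complex) gchoose (1 - 1))
     (if m < 0 then heis b m (F (n - m - int 1) v) else F (n - m - int 1) (heis b m v))) =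
    (\<lambda>m. heis b m v when m = n)"
    using F v heis_Basis_fock_space[OF b v] by (auto simp: when_def fun_eq_iff)
  then show ?thesis unfolding heis_step_def prod.case by (simp only: Sum_any_when_equal)
qed

text \<open>This is the normally ordered square of the current b(z). Normal ordering makes the
  summands for \<open>m\<close> and \<open>- m\<close> equal, whence the factor 2, and
  \<open>m = 0\<close> gives the square of the charge. The bound \<open>K\<close> on the levels in
  \<open>v\<close> makes the sum over all integers finite.\<close>

lemma heis_step_current:
  fixes v :: "'a::euclidean_space fock"
  assumes F: "\<And>n v. v \<in> fock_space L lam \<Longrightarrow> F n v = heis b n v"
    and b: "b \<in> Basis" and v: "v \<in> fock_space L lam" 
    and K: "\<And>M \<mu> m. (M, \<mu>) \<in> Poly_Mapping.keys v \<Longrightarrow> (b, m) \<in># M \<Longrightarrow> m \<le> K"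
  shows "lk (heis_step (b, 1) F 1 v) (M, \<mu>) =
     ((of_real (b \<bullet> \<mu>))^2 + 2 * of_nat (\<Sum>m=1..K. m * count M (b, m))) * lk v (M, \<mu>)"
proof -
  define T where "T m = heis b (- \<bar>m\<bar>) (heis b \<bar>m\<bar> v)" for m
  have T: "(\<lambda>m::int. scale ((of_int (- m - 1) :: complex) gchoose (1 - 1))
     (if m < 0 then heis b m (F (1 - m - int 1) v) else F (1 - m - int 1) (heis b m v))) = T"
    using F v heis_Basis_fock_space[OF b v] by (auto simp: fun_eq_iff T_def)
  have Tpos: "lk (T m) (M, \<mu>) = of_nat (nat \<bar>m\<bar> * count M (b, nat \<bar>m\<bar>)) * lk v (M, \<mu>)" if "m \<noteq> 0" for m :: int and M :: "('a \<times> nat) multiset" and \<mu>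
    using lookup_heis_neg_pos[OF b, of "nat \<bar>m\<bar>" v M \<mu>] that by (simp add: T_def)
  have T0: "T m = 0" if "m \<notin> {- int K..int K}" for m
  proof (rule poly_mapping_eqI)
    fix k :: "'a fock_index"
    obtain M \<mu> where k: "k = (M, \<mu>)" by fastforce
    have "nat \<bar>m\<bar> > K" "m \<noteq> 0" using that by auto
    then have "(b, nat \<bar>m\<bar>) \<notin># M \<or> lk v (M, \<mu>) = 0"
      using K[of M \<mu> "nat \<bar>m\<bar>"] by (auto simp: in_keys_iff)
    then have "count M (b, nat \<bar>m\<bar>) = 0 \<or> lk v (M, \<mu>) = 0"
      by (metis not_in_iff)
    then show "lk (T m) k = lk 0 k" using Tpos[OF \<open>m \<noteq> 0\<close>, of M \<mu>] k by auto
  qed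
  have "heis_step (b, 1) F 1 v = Sum_any T"
    by (simp only: heis_step_def prod.case T)
  also have "\<dots> = (\<Sum>m\<in>{- int K..int K}. T m)"
    by (rule Sum_any.expand_superset) (use T0 in blast)+
  finally have "lk (heis_step (b, 1) F 1 v) (M, \<mu>) = (\<Sum>m\<in>{- int K..int K}. lk (T m) (M, \<mu>))"
    by (simp add: lookup_sum)
  also have "{- int K..int K} = insert 0 ((\<lambda>n. int n) ` {1..K} \<union> (\<lambda>n. - int n) ` {1..K})"
  proof -
    have "x \<in> insert 0 ((\<lambda>n. int n) ` {1..K} \<union> (\<lambda>n. - int n) ` {1..K})" if "x \<in> {- int K..int K}" for x
      using that by (cases x rule: int_cases3) auto
    then show ?thesis by (intro equalityI subsetI) (blast, auto)
  qed
  also have "(\<Sum>m\<in>\<dots>. lk (T m) (M, \<mu>)) = lk (T 0) (M, \<mu>) + 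
     ((\<Sum>m\<in>(\<lambda>n. int n) ` {1..K}. lk (T m) (M, \<mu>)) + (\<Sum>m\<in>(\<lambda>n. - int n) ` {1..K}. lk (T m) (M, \<mu>)))"
    by (subst sum.insert) (auto intro!: sum.union_disjoint)
  also have "(\<Sum>m\<in>(\<lambda>n. int n) ` {1..K}. lk (T m) (M, \<mu>)) = (\<Sum>m=1..K. of_nat (m * count M (b, m)) * lk v (M, \<mu>))"
    by (subst sum.reindex) (auto simp: inj_on_def Tpos)
  also have "(\<Sum>m\<in>(\<lambda>n. - int n) ` {1..K}. lk (T m) (M, \<mu>)) = (\<Sum>m=1..K. of_nat (m * count M (b, m)) * lk v (M, \<mu>))"
    by (subst sum.reindex) (auto simp: inj_on_def Tpos)
  also have "lk (T 0) (M, \<mu>) = (of_real (b \<bullet> \<mu>))^2 * lk v (M, \<mu>)"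
    by (simp add: T_def lookup_heis_0 power2_eq_square)
  finally show ?thesis
    unfolding sum_distrib_right[symmetric] of_nat_sum[symmetric] by (simp only: distrib_right mult_2)
qed

text \<open>With a single distinct element, folding only requires that element to commute with
  itself, so any \<open>f\<close> is allowed. This matters for \<open>heis_step\<close>, whose
  commutation on arbitrary families of modes is not established here.\<close>

lemma fold_mset_double: "fold_mset f s {#x, x#} = f x (f x s)"
proof -
  interpret comp_fun_commute_on "{x}" "\<lambda>y. f y ^^ 2"
    by unfold_locales auto
  have "Finite_Set.fold (\<lambda>y. f y ^^ 2) s {x} = (f x ^^ 2) (Finite_Set.fold (\<lambda>y. f y ^^ 2) s {})"
    by (rule fold_insert) auto
  moreover have "fold_mset f s {#x, x#} = Finite_Set.fold (\<lambda>y. f y ^^ count {#x, x#} y) s {x}"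
    by (simp add: fold_mset_def)
  moreover have "\<dots> = Finite_Set.fold (\<lambda>y. f y ^^ 2) s {x}"
  proof (rule fold_closed_eq[where B = UNIV])
    show "(f a ^^ count {#x, x#} a) b = (f a ^^ 2) b" if "a \<in> {x}" for a b
      using that by (simp add: numeral_2_eq_2)
  qed auto
  ultimately show ?thesis by (simp add: numeral_2_eq_2)
qed

lemma fold_mset_one: "fold_mset f s {#x#} = f x s"
proof -
  interpret comp_fun_commute_on "{x}" "\<lambda>y. f y"
    by unfold_locales auto
  have "Finite_Set.fold f s {x} = f x (Finite_Set.fold f s {})"
    by (rule fold_insert) auto
  moreover have "fold_mset f s {#x#} = Finite_Set.fold (\<lambda>y. f y ^^ count {#x#} y) s {x}"
    by (simp add: fold_mset_def)
  moreover have "\<dots> = Finite_Set.fold f s {x}"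
    by (rule fold_closed_eq[where B = UNIV]) auto
  ultimately show ?thesis by simp
qed

lemma sum_mset_eq_sum_count:
  fixes f :: "'b \<Rightarrow> nat"
  assumes "finite A" "set_mset M \<subseteq> A"
  shows "(\<Sum>x\<in>#M. f x) = (\<Sum>x\<in>A. f x * count M x)"
  using assms(2)
proof (induction M)
  case (add y M)
  have "(\<Sum>x\<in>A. f x * count (add_mset y M) x) = (\<Sum>x\<in>A. f x * count M x + (if x = y then f y else 0))"
    by (intro sum.cong) auto
  also have "\<dots> = (\<Sum>x\<in>A. f x * count M x) + f y"
    using add.prems assms(1) by (simp add: sum.distrib sum.delta)
  finally show ?case using add by simp
qed simp

abbreviation conformal :: "'a::euclidean_space fock" where
  "conformal \<equiv> (\<Sum>b\<in>Basis. sg ({#(b, 1), (b, 1)#}, 0) (1 / 2))"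

text \<open>Mode 1 of the conformal vector is the degree operator L(0): oscillators count with their
  level, e^mu with half the norm of mu. Since it is diagonal, weight one can be tested coefficient
  by coefficient.\<close>

lemma vertex_op_conformal:
  fixes v :: "'a::euclidean_space fock"
  assumes coc: "lattice_cocycle L \<epsilon>" and v: "v \<in> fock_space L lam"
  shows "lk (vertex_op \<epsilon> lam conformal 1 v) (M, \<mu>) =
    (of_nat (\<Sum>x\<in>#M. snd x) + of_real (\<mu> \<bullet> \<mu>) / 2) * lk v (M, \<mu>)"
proof -
  \<comment> \<open>The element 0 keeps the maximum meaningful when \<open>v\<close> contains no
    oscillator.\<close>
  define K where "K = Max (insert 0 (\<Union>k\<in>Poly_Mapping.keys v. snd ` set_mset (fst k)))"
  have K: "m \<le> K" if "(M, \<mu>) \<in> Poly_Mapping.keys v" "(b, m) \<in># M" for M \<mu> b m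
    unfolding K_def using that by (intro Max_ge) (auto intro!: bexI[of _ "(M, \<mu>)"] image_eqI[of _ _ "(b, m)"])
  have "vertex_op \<epsilon> lam conformal 1 v =
    (\<Sum>b\<in>Basis. scale (1 / 2) (heis_step (b, 1) (heis_step (b, 1) (exp_modes \<epsilon> lam 0)) 1 v))"
    unfolding vertex_op_def lin_ext_sum lin_ext_single prod.case fold_mset_double ..
  then have "lk (vertex_op \<epsilon> lam conformal 1 v) (M, \<mu>) =
    (\<Sum>b\<in>Basis. 1 / 2 * lk (heis_step (b, 1) (heis_step (b, 1) (exp_modes \<epsilon> lam 0)) 1 v) (M, \<mu>))"
    by (simp add: lookup_sum)
  also have "\<dots> = (\<Sum>b\<in>Basis. 1 / 2 * (((of_real (b \<bullet> \<mu>))^2 + 2 * of_nat (\<Sum>m=1..K. m * count M (b, m))) * lk v (M, \<mu>)))"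
    using heis_step_vacuum[OF exp_modes_0[OF coc]]
    by (intro sum.cong refl arg_cong2[where f = "(*)"] heis_step_current[OF _ _ v K]) auto
  also have "\<dots> = ((\<Sum>b\<in>Basis. (of_real (b \<bullet> \<mu>))\<^sup>2) / 2 + of_nat (\<Sum>b\<in>Basis. \<Sum>m=1..K. m * count M (b, m))) * lk v (M, \<mu>)"
    unfolding of_nat_sum[of _ Basis] sum_divide_distrib sum.distrib[symmetric] sum_distrib_right
    by (intro sum.cong refl) (simp add: field_simps)
  also have "(\<Sum>b\<in>Basis. (complex_of_real (b \<bullet> \<mu>))\<^sup>2) = of_real (\<mu> \<bullet> \<mu>)"
    by (subst (2) euclidean_inner) (simp add: power2_eq_square inner_commute)
  also have "(of_real (\<mu> \<bullet> \<mu>) / 2 + of_nat (\<Sum>b\<in>Basis. \<Sum>m=1..K. m * count M (b, m))) * lk v (M, \<mu>) =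
     (of_real (\<mu> \<bullet> \<mu>) / 2 + of_nat (\<Sum>x\<in>#M. snd x)) * lk v (M, \<mu>)"
  proof (cases "(M, \<mu>) \<in> Poly_Mapping.keys v")
    case True
    then have "set_mset M \<subseteq> Basis \<times> {1..K}"
      using K[OF True] v by (fastforce simp: fock_space_def)
    then have "(\<Sum>x\<in>#M. snd x) = (\<Sum>x\<in>Basis \<times> {1..K}. snd x * count M x)"
      by (intro sum_mset_eq_sum_count) auto
    then show ?thesis by (simp add: sum.cartesian_product case_prod_beta)
  qed (simp add: in_keys_iff)
  finally show ?thesis by (simp add: add.commute)
qed

text \<open>The zero modes of the vectors h(-1) measure the charge \<open>h \<bullet> \<mu>\<close>.
  Taken for all \<open>h\<close>, they determine \<open>\<mu>\<close>, which is how images under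
  module lifts are located.\<close>

lemma vertex_op_creation:
  fixes v :: "'a::euclidean_space fock"
  assumes coc: "lattice_cocycle L \<epsilon>" and v: "v \<in> fock_space L lam"
  shows "vertex_op \<epsilon> lam (creation h 1) 0 v = heis h 0 v"
proof -
  have "vertex_op \<epsilon> lam (creation h 1) 0 v = (\<Sum>b\<in>Basis. scale (of_real (h \<bullet> b)) (heis_step (b, 1) (exp_modes \<epsilon> lam 0) 0 v))"
    unfolding vertex_op_def creation_def lin_ext_sum lin_ext_single prod.case fold_mset_one ..
  also have "\<dots> = (\<Sum>b\<in>Basis. scale (of_real (h \<bullet> b)) (heis b 0 v))"
    using heis_step_vacuum[OF exp_modes_0[OF coc] _ v] by (intro sum.cong refl) simp
  also have "\<dots> = heis h 0 v"
  proof (rule poly_mapping_eqI)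
    fix k :: "'a fock_index"
    obtain M \<mu> where k: "k = (M, \<mu>)" by fastforce
    show "lk (\<Sum>b\<in>Basis. scale (of_real (h \<bullet> b)) (heis b 0 v)) k = lk (heis h 0 v) k"
      unfolding k lookup_sum lookup_scale lookup_heis_0
      by (subst (2) euclidean_inner) (simp add: sum_distrib_right mult.assoc inner_commute)
  qed
  finally show ?thesis .
qed

section \<open>Lifts of isometries acting on the vectors h(-1) and on the conformal vector\<close>

lemma creation_fock_space: "0 \<in> L \<Longrightarrow> n > 0 \<Longrightarrow> creation h n \<in> fock_space L 0"
  unfolding creation_def by (intro fock_space_sum fock_space_single) auto

lemma conformal_fock_space: "0 \<in> L \<Longrightarrow> conformal \<in> fock_space L 0"
  by (intro fock_space_sum fock_space_single) auto

text \<open>Only the sign is open, and multiplicativity applied to e^0 e^0 = e^0 turns the sign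
  \<open>s\<close> into \<open>s * s\<close>.\<close>

lemma lift_zero:
  assumes "lattice_cocycle L \<epsilon>" "0 \<in> L" "ghat \<in> lifts L \<epsilon> g" "linear g"
  shows "ghat (1, 0) = (1, 0)"
proof -
  have hom: "ghat \<in> hom (L_hat L \<epsilon>) (L_hat L \<epsilon>)" using assms(3) by (auto simp: lifts_def iso_def)
  have e: "\<epsilon> 0 0 = 1" using assms(1,2) by (auto simp: lattice_cocycle_def)
  obtain s where s: "ghat (1, 0) = (s, 0)" "s = 1 \<or> s = -1"
    using assms(2,3) linear_0[OF assms(4)] by (fastforce simp: lifts_def)
  have "(1, 0) \<in> carrier (L_hat L \<epsilon>)" using assms(2) by (simp add: L_hat_def)
  from hom_mult[OF hom this this] have "ghat (1, 0) = (s * s, 0)"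
    by (simp add: L_hat_def e s)
  with s show ?thesis by auto
qed

lemma lift_action_add: "lift_action g \<phi> (u + v) = lift_action g \<phi> u + lift_action g \<phi> v"
  and lift_action_scale: "lift_action g \<phi> (scale c v) = scale c (lift_action g \<phi> v)"
  and lift_action_sum: "lift_action g \<phi> (sum f A) = (\<Sum>i\<in>A. lift_action g \<phi> (f i))"
  by (simp_all add: lift_action_def lin_ext_add lin_ext_scale lin_ext_sum)

lemma creation_sum: "creation (sum f A) n = (\<Sum>i\<in>A. creation (f i) n)"
  by (induction A rule: infinite_finite_induct) (auto simp: creation_add)

lemma single_empty_zero: "sg ({#}, 0) 1 = 1"
  by (metis single_one zero_multiset_def zero_prod_def)

lemma lift_action_creation:
  assumes "\<phi> (1, 0) = (1, 0)" "linear g"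
  shows "lift_action g \<phi> (creation h n) = creation (g h) n"
proof -
  have "lift_action g \<phi> (creation h n) = (\<Sum>b\<in>Basis. scale (of_real (h \<bullet> b)) (creation (g b) n))"
    by (simp add: lift_action_def creation_def[of h] lin_ext_sum assms(1) single_empty_zero)
  also have "\<dots> = creation (g (\<Sum>b\<in>Basis. (h \<bullet> b) *\<^sub>R b)) n"
    by (simp add: linear_sum[OF assms(2)] linear_cmul[OF assms(2)] creation_sum creation_scaleR)
  finally show ?thesis by (simp add: euclidean_representation)
qed

text \<open>Parseval's identity for the orthonormal basis that is the image of \<open>Basis\<close>
  under \<open>g\<close>.\<close>

lemma orthogonal_sum_Basis:
  fixes g :: "'a::euclidean_space \<Rightarrow> 'a"
  assumes g: "orthogonal_transformation g"
  shows "(\<Sum>b\<in>Basis. (g b \<bullet> x) * (g b \<bullet> y)) = x \<bullet> y"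
proof -
  obtain x' y' where "x = g x'" "y = g y'"
    using orthogonal_transformation_surj[OF g] by (meson surjD)
  then show ?thesis using g
    by (simp add: orthogonal_transformation_def euclidean_inner[of x' y'] inner_commute)
qed

text \<open>The conformal vector does not depend on the orthonormal basis used to write it. So it
  lies in the fixed-point subVOA, and isomorphisms of modules over that subVOA respect
  weights.\<close>

lemma lift_action_conformal:
  fixes g :: "'a::euclidean_space \<Rightarrow> 'a"
  assumes "\<phi> (1, 0) = (1, 0)" "orthogonal_transformation g"
  shows "lift_action g \<phi> conformal = conformal"
proof -
  let ?s = "\<lambda>b c. sg ({#(b, 1), (c, 1)#}, 0 :: 'a)"
  have prod: "creation x 1 * creation x 1 = (\<Sum>b\<in>Basis. \<Sum>c\<in>Basis. ?s b c (of_real ((x \<bullet> b) * (x \<bullet> c))))" for x :: 'a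
    by (simp add: creation_def sum_product mult_single) (subst sum.swap, intro sum.cong refl, simp only: mult.commute)
  have "lift_action g \<phi> conformal = (\<Sum>a\<in>Basis. scale (1 / 2) (creation (g a) 1 * creation (g a) 1))"
    by (simp add: lift_action_def lin_ext_sum assms(1) single_empty_zero)
  also have "\<dots> = (\<Sum>a\<in>Basis. \<Sum>b\<in>Basis. \<Sum>c\<in>Basis. ?s b c (of_real ((g a \<bullet> b) * (g a \<bullet> c)) / 2))"
    unfolding prod scale_sum by simp
  also have "\<dots> = (\<Sum>b\<in>Basis. \<Sum>c\<in>Basis. \<Sum>a\<in>Basis. ?s b c (of_real ((g a \<bullet> b) * (g a \<bullet> c)) / 2))"
    by (rule trans[OF sum.swap]) (rule sum.cong[OF refl], rule sum.swap)
  also have "\<dots> = (\<Sum>b\<in>Basis. \<Sum>c\<in>Basis. ?s b c (of_real (b \<bullet> c) / 2))"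
  proof (intro sum.cong refl)
    fix b c :: 'a
    have "(\<Sum>a\<in>Basis. ?s b c (complex_of_real ((g a \<bullet> b) * (g a \<bullet> c)) / 2)) =
      ?s b c (\<Sum>a\<in>Basis. complex_of_real ((g a \<bullet> b) * (g a \<bullet> c)) / 2)"
      by (rule poly_mapping_eqI) (simp add: lookup_sum lookup_single when_def)
    also have "(\<Sum>a\<in>Basis. complex_of_real ((g a \<bullet> b) * (g a \<bullet> c)) / 2) = of_real (b \<bullet> c) / 2"
      unfolding sum_divide_distrib[symmetric] of_real_sum[symmetric] orthogonal_sum_Basis[OF assms(2)] ..
    finally show "(\<Sum>a\<in>Basis. ?s b c (complex_of_real ((g a \<bullet> b) * (g a \<bullet> c)) / 2)) = ?s b c (of_real (b \<bullet> c) / 2)" .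
  qed
  also have "\<dots> = conformal"
  proof (intro sum.cong refl)
    fix b :: 'a assume b: "b \<in> Basis"
    show "(\<Sum>c\<in>Basis. ?s b c (complex_of_real (b \<bullet> c) / 2)) = ?s b b (1 / 2)"
      using b by (subst sum.remove[of _ b]) (auto simp: inner_Basis intro!: sum.neutral split: if_splits)
  qed
  finally show ?thesis .
qed

text \<open>Gaussian elimination by induction on the equations: equation \<open>s\<close> is solved
  for one unknown \<open>y0\<close>, and the remaining equations become a system in the other
  unknowns.\<close>

lemma homogeneous_system_nontrivial:
  fixes m :: "'b \<Rightarrow> 'c \<Rightarrow> complex"
  assumes "finite S" "finite Z" "card S < card Z"
  shows "\<exists>a. (\<exists>y\<in>Z. a y \<noteq> 0) \<and> (\<forall>s\<in>S. (\<Sum>y\<in>Z. a y * m y s) = 0)"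
  using assms
proof (induction S arbitrary: Z m rule: finite_induct)
  case empty
  then have "Z \<noteq> {}" by auto
  then show ?case by (intro exI[of _ "\<lambda>_. 1"]) auto
next
  case (insert s S)
  show ?case
  proof (cases "\<forall>y\<in>Z. m y s = 0")
    case True
    have "card S < card Z" using insert by simp
    from insert.IH[OF insert.prems(1) this, of m]
    obtain a where "\<exists>y\<in>Z. a y \<noteq> 0" "\<forall>s\<in>S. (\<Sum>y\<in>Z. a y * m y s) = 0" by blast
    then show ?thesis using True by (intro exI[of _ a]) auto
  next
    case False
    then obtain y0 where y0: "y0 \<in> Z" "m y0 s \<noteq> 0" by auto
    define m' where "m' y u = m y u - m y s / m y0 s * m y0 u" for y u
    have "card S < card (Z - {y0})" using insert y0 by simp
    then obtain a where a: "\<exists>y\<in>Z - {y0}. a y \<noteq> 0" "\<forall>u\<in>S. (\<Sum>y\<in>Z - {y0}. a y * m' y u) = 0"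
      using insert.IH[of "Z - {y0}" m'] insert.prems by auto
    \<comment> \<open>The value of the unknown \<open>y0\<close> that equation \<open>s\<close>
      forces.\<close>
    define k where "k = - (\<Sum>y\<in>Z - {y0}. a y * m y s) / m y0 s"
    have eq: "(\<Sum>y\<in>Z. (a(y0 := k)) y * m y u) = (\<Sum>y\<in>Z - {y0}. a y * m' y u)" for u
    proof -
      have "(\<Sum>y\<in>Z. (a(y0 := k)) y * m y u) = k * m y0 u + (\<Sum>y\<in>Z - {y0}. a y * m y u)"
        using insert.prems y0 by (subst sum.remove[of _ y0]) auto
      also have "k * m y0 u = - (\<Sum>y\<in>Z - {y0}. a y * (m y s / m y0 s * m y0 u))"
      proof -
        have "(\<Sum>y\<in>Z - {y0}. a y * (m y s / m y0 s * m y0 u)) =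
            (\<Sum>y\<in>Z - {y0}. a y * m y s) * (m y0 u / m y0 s)"
          unfolding sum_distrib_right by (intro sum.cong refl) simp
        then show ?thesis by (simp add: k_def)
      qed
      finally show ?thesis by (simp add: m'_def right_diff_distrib sum_subtractf)
    qed
    have "(\<Sum>y\<in>Z. (a(y0 := k)) y * m y s) = 0"
      unfolding eq using y0 by (simp add: m'_def)
    then show ?thesis using a eq by (intro exI[of _ "a(y0 := k)"]) auto
  qed
qed

section \<open>Weight-one spaces\<close>

lemma linear_on_space_0: "linear_on_space V f \<Longrightarrow> 0 \<in> V \<Longrightarrow> f 0 = 0"
  unfolding linear_on_space_def by (metis scale_simps(2))

lemma linear_on_space_sum:
  assumes f: "linear_on_space V f" and V: "0 \<in> V" "\<And>u v. u \<in> V \<Longrightarrow> v \<in> V \<Longrightarrow> u + v \<in> V"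
    and h: "\<And>i. i \<in> A \<Longrightarrow> h i \<in> V"
  shows "f (sum h A) = (\<Sum>i\<in>A. f (h i))"
proof -
  have "sum h A \<in> V \<and> f (sum h A) = (\<Sum>i\<in>A. f (h i))"
    using h
  proof (induction A rule: infinite_finite_induct)
    case (insert x F)
    then have "sum h F \<in> V" "f (sum h F) = (\<Sum>i\<in>F. f (h i))" "h x \<in> V" by auto
    then show ?case using insert.hyps V(2) f by (simp add: linear_on_space_def)
  qed (use V(1) linear_on_space_0[OF f V(1)] in auto)
  then show ?thesis ..
qed

text \<open>Weight one is expressed by a mode of the conformal vector, so that every map
  intertwining the vertex operators sees it.\<close>

definition weight1 where
  "weight1 L \<epsilon> lam = {v \<in> fock_space L lam. vertex_op \<epsilon> lam conformal 1 v = v}"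

text \<open>The condition on \<open>lam\<close> keeps \<open>\<mu>\<close> away from 0. Then half
  the norm of \<open>\<mu>\<close> is positive, which leaves no room for an oscillator, whose level
  is at least 1.\<close>

lemma weight1_keys:
  fixes v :: "'a::euclidean_space fock"
  assumes coc: "lattice_cocycle L \<epsilon>" and v: "v \<in> weight1 L \<epsilon> lam" and k: "(M, \<mu>) \<in> Poly_Mapping.keys v"
    and lam: "- lam \<notin> L"
  shows "M = {#} \<and> \<mu> - lam \<in> L \<and> \<mu> \<bullet> \<mu> = 2"
proof -
  have fs: "v \<in> fock_space L lam" using v by (simp add: weight1_def)
  have M: "set_mset M \<subseteq> Basis \<times> {1..}" "\<mu> - lam \<in> L" using fs k by (auto simp: fock_space_def)
  have "lk v (M, \<mu>) \<noteq> 0" using k by (simp add: in_keys_iff)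
  define n where "n = (\<Sum>x\<in>#M. snd x)"
  have "of_nat n + complex_of_real (\<mu> \<bullet> \<mu>) / 2 = 1"
    using vertex_op_conformal[OF coc fs, of M \<mu>, folded n_def] v \<open>lk v (M, \<mu>) \<noteq> 0\<close>
    by (simp add: weight1_def)
  then have "complex_of_real (real n + (\<mu> \<bullet> \<mu>) / 2) = of_real 1" by simp
  then have eq: "real n + (\<mu> \<bullet> \<mu>) / 2 = 1" by (simp only: of_real_eq_iff)
  have "\<mu> \<noteq> 0" using M(2) lam by auto
  then have "\<mu> \<bullet> \<mu> > 0" by simp
  with eq have "n = 0" by (cases n) auto
  have "M = {#}"
  proof (rule ccontr)
    assume "M \<noteq> {#}"
    then obtain x where x: "x \<in># M" by (meson multiset_nonemptyE)
    then have "snd x = 0" using \<open>n = 0\<close> by (simp add: n_def)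
    moreover have "snd x \<ge> 1" using x M(1) by (cases x) auto
    ultimately show False by simp
  qed
  with eq M \<open>n = 0\<close> show ?thesis by simp
qed

lemma creation_weight1:
  assumes coc: "lattice_cocycle L \<epsilon>" and 0: "0 \<in> L"
  shows "creation h 1 \<in> weight1 L \<epsilon> 0"
proof -
  have fs: "creation h 1 \<in> fock_space L 0" using 0 by (simp add: creation_fock_space)
  have "lk (vertex_op \<epsilon> 0 conformal 1 (creation h 1)) (M, \<mu>) = lk (creation h 1) (M, \<mu>)" for M \<mu>
  proof (cases "lk (creation h 1) (M, \<mu>) = 0")
    case False
    then have "\<exists>b\<in>Basis. lk (sg ({#(b, 1)#}, 0) (of_real (h \<bullet> b))) (M, \<mu>) \<noteq> (0::complex)"
      unfolding creation_def lookup_sum by (meson sum.neutral)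
    then obtain b where "M = {#(b, 1)#}" "\<mu> = 0" by (auto simp: lookup_single when_def split: if_splits)
    then show ?thesis using vertex_op_conformal[OF coc fs, of M \<mu>] by simp
  qed (use vertex_op_conformal[OF coc fs] in simp)
  then have "vertex_op \<epsilon> 0 conformal 1 (creation h 1) = creation h 1"
    by (intro poly_mapping_eqI) auto
  then show ?thesis using fs by (simp add: weight1_def)
qed

lemma weight1_single:
  assumes coc: "lattice_cocycle L \<epsilon>" and "\<mu> - lam \<in> L" "\<mu> \<bullet> \<mu> = 2"
  shows "sg ({#}, \<mu>) c \<in> weight1 L \<epsilon> lam"
proof -
  have fs: "sg ({#}, \<mu>) c \<in> fock_space L lam" using assms(2) by (simp add: fock_space_single)
  have "lk (vertex_op \<epsilon> lam conformal 1 (sg ({#}, \<mu>) c)) (M, \<nu>) = lk (sg ({#}, \<mu>) c) (M, \<nu>)" for M \<nu>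
    using vertex_op_conformal[OF coc fs, of M \<nu>] assms(3)
    by (cases "M = {#} \<and> \<nu> = \<mu>") (auto simp: lookup_single when_def)
  then have "vertex_op \<epsilon> lam conformal 1 (sg ({#}, \<mu>) c) = sg ({#}, \<mu>) c"
    by (intro poly_mapping_eqI) auto
  then show ?thesis using fs by (simp add: weight1_def)
qed

locale twisted_lattice =
  fixes L :: "'a::euclidean_space set" and g :: "'a \<Rightarrow> 'a" and p :: nat
    and \<epsilon> :: "'a \<Rightarrow> 'a \<Rightarrow> int" and ghat :: "int \<times> 'a \<Rightarrow> int \<times> 'a"
  assumes zero: "0 \<in> L" and minus: "x \<in> L \<Longrightarrow> - x \<in> L"
    and g: "orthogonal_transformation g" and gp: "(g ^^ p) x = x"
    and coc: "lattice_cocycle L \<epsilon>" and ghat: "ghat \<in> lifts L \<epsilon> g"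
begin

lemma lin: "linear g"
  using g by (simp add: orthogonal_transformation_def)

lemma ghat_zero: "ghat (1, 0) = (1, 0)"
  using coc zero ghat lin by (rule lift_zero)

lemma inj_g: "g x = g y \<Longrightarrow> x = y"
  using g by (metis orthogonal_transformation_inj injD)

lemma module_lift_weight1:
  assumes G: "module_lift L \<epsilon> p (lift_action g ghat) lam G" and v: "v \<in> weight1 L \<epsilon> lam"
  shows "G v \<in> weight1 L \<epsilon> lam"
proof -
  have fs: "v \<in> fock_space L lam" using v by (simp add: weight1_def)
  have "G (vertex_op \<epsilon> lam conformal 1 v) = vertex_op \<epsilon> lam (lift_action g ghat conformal) 1 (G v)"
    using G fs conformal_fock_space[OF zero] by (auto simp: module_lift_def)
  then show ?thesis
    using v fs G lift_action_conformal[of ghat, OF ghat_zero g]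
    by (auto simp: weight1_def module_lift_def bij_betw_def)
qed

text \<open>\<open>G\<close> intertwines h(0) with (g h)(0), so the image of e^mu has charge
  \<open>g \<mu>\<close>. In weight one no oscillators occur, and a single basis vector has this
  charge.\<close>

lemma module_lift_single:
  assumes G: "module_lift L \<epsilon> p (lift_action g ghat) lam G" and lam: "lam \<notin> L"
    and \<mu>: "\<mu> - lam \<in> L" "\<mu> \<bullet> \<mu> = 2"
  shows "\<exists>c. G (sg ({#}, \<mu>) a) = sg ({#}, g \<mu>) c"
proof -
  let ?v = "sg ({#}, \<mu>) a"
  have lam': "- lam \<notin> L" using lam minus by fastforce
  have v: "?v \<in> weight1 L \<epsilon> lam" using coc \<mu> by (rule weight1_single)
  have Gv: "G ?v \<in> weight1 L \<epsilon> lam" by (rule module_lift_weight1[OF G v])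
  then have Gfs: "G ?v \<in> fock_space L lam" by (simp add: weight1_def)
  have fs: "?v \<in> fock_space L lam" using v by (simp add: weight1_def)
  have linG: "linear_on_space (fock_space L lam) G" using G by (simp add: module_lift_def)
  have heis: "heis (g h) 0 (G ?v) = scale (of_real (h \<bullet> \<mu>)) (G ?v)" for h
  proof -
    have cf: "creation h 1 \<in> fock_space L 0" using zero by (simp add: creation_fock_space)
    then have "G (vertex_op \<epsilon> lam (creation h 1) 0 ?v) = vertex_op \<epsilon> lam (lift_action g ghat (creation h 1)) 0 (G ?v)"
      using G fs by (auto simp: module_lift_def)
    moreover have "lift_action g ghat (creation h 1) = creation (g h) 1"
      using ghat_zero lin by (rule lift_action_creation)
    ultimately have "G (heis h 0 ?v) = heis (g h) 0 (G ?v)"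
      by (simp only: vertex_op_creation[OF coc fs] vertex_op_creation[OF coc Gfs])
    moreover have "heis h 0 ?v = scale (of_real (h \<bullet> \<mu>)) ?v" by (simp add: heis_0_single)
    ultimately show ?thesis using linG fs by (simp only: linear_on_space_def)
  qed
  have keys: "k = ({#}, g \<mu>)" if "k \<in> Poly_Mapping.keys (G ?v)" for k
  proof -
    obtain M \<nu> where k: "k = (M, \<nu>)" by fastforce
    have nz: "lk (G ?v) (M, \<nu>) \<noteq> 0" using that k by (simp add: in_keys_iff)
    have "g h \<bullet> \<nu> = g h \<bullet> g \<mu>" for h
    proof -
      have "of_real (g h \<bullet> \<nu>) * lk (G ?v) (M, \<nu>) = of_real (h \<bullet> \<mu>) * lk (G ?v) (M, \<nu>)"
        using arg_cong[OF heis[of h], of "\<lambda>v. lk v (M, \<nu>)"] by (simp add: lookup_heis_0)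
      then have "g h \<bullet> \<nu> = h \<bullet> \<mu>" using nz by simp
      then show ?thesis using g by (simp add: orthogonal_transformation_def)
    qed
    then have "x \<bullet> \<nu> = x \<bullet> g \<mu>" for x
      using orthogonal_transformation_surj[OF g] by (metis surjD)
    then have "\<nu> = g \<mu>" by (metis vector_eq_rdot inner_commute)
    then show ?thesis using weight1_keys[OF coc Gv _ lam', of M \<nu>] that k by simp
  qed
  have "G ?v = sg ({#}, g \<mu>) (lk (G ?v) ({#}, g \<mu>))"
    using keys by (intro poly_mapping_eqI) (auto simp: lookup_single when_def in_keys_iff)
  then show ?thesis ..
qed

text \<open>\<open>G\<close> moves the line of e^nu to that of its image under \<open>g\<close>, so
  a coefficient of \<open>G v\<close> comes from a single coefficient of \<open>v\<close>. As the
  eigenvalue is not zero, vanishing travels along the orbit.\<close>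

lemma eigenvector_lookup_zero:
  assumes G: "module_lift L \<epsilon> p (lift_action g ghat) lam G" and lam: "lam \<notin> L"
    and v: "v \<in> weight1 L \<epsilon> lam" "G v = scale z v" "z \<noteq> 0" and 0: "lk v ({#}, \<mu>) = 0"
  shows "lk v ({#}, (g ^^ i) \<mu>) = 0"
proof (induction i)
  case (Suc i)
  have lam': "- lam \<notin> L" using lam minus by fastforce
  have fs: "v \<in> fock_space L lam" using v by (simp add: weight1_def)
  have linG: "linear_on_space (fock_space L lam) G" using G by (simp add: module_lift_def)
  have "lk (G (sg k (lk v k))) ({#}, g ((g ^^ i) \<mu>)) = 0" if k: "k \<in> Poly_Mapping.keys v" for k
  proof -
    obtain M \<nu> where kk: "k = (M, \<nu>)" by fastforce
    have M: "M = {#}" "\<nu> - lam \<in> L" "\<nu> \<bullet> \<nu> = 2"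
      using weight1_keys[OF coc v(1) _ lam', of M \<nu>] k kk by auto
    obtain c where c: "G (sg k (lk v k)) = sg ({#}, g \<nu>) c"
      using module_lift_single[OF G lam M(2,3)] M(1) kk by blast
    have "\<nu> \<noteq> (g ^^ i) \<mu>" using Suc k kk M(1) by (auto simp: in_keys_iff)
    then have "g \<nu> \<noteq> g ((g ^^ i) \<mu>)" using inj_g by blast
    then show ?thesis by (simp add: c lookup_single when_def)
  qed
  moreover have "G v = (\<Sum>k\<in>Poly_Mapping.keys v. G (sg k (lk v k)))"
    by (subst poly_mapping_expand[of v], rule linear_on_space_sum[OF linG])
       (use fs in \<open>auto simp: fock_space_0 fock_space_add, auto simp: fock_space_def\<close>)
  ultimately have "lk (G v) ({#}, g ((g ^^ i) \<mu>)) = 0" by (simp add: lookup_sum)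
  then show ?case using v by simp
qed (use 0 in simp)

text \<open>If \<open>Z\<close> were larger, a nontrivial combination of the eigenvectors
  \<open>w y\<close> would be sent to an eigenvector that vanishes on \<open>S\<close>, hence to
  zero. Injectivity of the isomorphism then contradicts the independence of the
  \<open>w y\<close>.\<close>

theorem orthogonal_orbits_le:
  fixes lam :: 'a and \<tau> G :: "'a fock \<Rightarrow> 'a fock"
  assumes p: "prime p" and j: "1 \<le> j" "j \<le> p - 1" and lam: "lam \<notin> L"
    and \<tau>: "\<tau> \<in> voa_Aut (fixed_subVOA (lattice_VOA L \<epsilon>) (lift_action g ghat))"
    and G: "module_lift L \<epsilon> p (lift_action g ghat) lam G"
    and iso: "module_isomorphic (fixed_subVOA (lattice_VOA L \<epsilon>) (lift_action g ghat))
           (module_twist (eigen_module (lattice_module L \<epsilon> 0) p (lift_action g ghat) j) \<tau>)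
           (eigen_module (lattice_module L \<epsilon> lam) p G r)"
    and S: "finite S" "\<And>x. x - lam \<in> L \<Longrightarrow> x \<bullet> x = 2 \<Longrightarrow> \<exists>s\<in>S. \<exists>i. x = (g ^^ i) s"
    and Z: "finite Z" "\<And>y. y \<in> Z \<Longrightarrow> g y \<noteq> y"
      "\<And>y i. y \<in> Z \<Longrightarrow> (g ^^ i) y \<bullet> y \<in> \<int>"
      "\<And>y z i. y \<in> Z \<Longrightarrow> z \<in> Z \<Longrightarrow> y \<noteq> z \<Longrightarrow> (g ^^ i) y \<bullet> z = 0"
  shows "card Z \<le> card S"
proof (rule ccontr)
  assume "\<not> card Z \<le> card S"
  then have less: "card S < card Z" by simp
  define F where "F = lift_action g ghat"
  define \<zeta> where "\<zeta> = exp (2 * complex_of_real pi * \<i> * of_nat j / of_nat p)"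
  define \<eta> where "\<eta> = exp (2 * complex_of_real pi * \<i> * of_nat r / of_nat p)"
  define V0 where "V0 = {v \<in> fock_space L 0. F v = scale \<zeta> v}"
  define V1 where "V1 = {v \<in> fock_space L lam. G v = scale \<eta> v}"
  have p0: "p > 0" using p by (rule prime_gt_0_nat)
  have lam': "- lam \<notin> L" using lam minus by fastforce
  have "\<exists>f. bij_betw f V0 V1 \<and> linear_on_space V0 f \<and>
      (\<forall>a\<in>{v \<in> fock_space L 0. F v = v}. \<forall>n. \<forall>v\<in>V0.
        f (vertex_op \<epsilon> 0 (\<tau> a) n v) = vertex_op \<epsilon> lam a n (f v))"
    using iso unfolding module_isomorphic_def module_twist_def eigen_module_def lattice_module_def
        fixed_subVOA_def lattice_VOA_def V0_def V1_def F_def \<zeta>_def \<eta>_def by simp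
  then obtain f where f: "bij_betw f V0 V1" "linear_on_space V0 f"
    and fY: "\<And>a n v. a \<in> fock_space L 0 \<Longrightarrow> F a = a \<Longrightarrow> v \<in> V0 \<Longrightarrow>
      f (vertex_op \<epsilon> 0 (\<tau> a) n v) = vertex_op \<epsilon> lam a n (f v)" by blast
  \<comment> \<open>The conformal vector belongs to the fixed-point subVOA and is not moved by
    \<open>\<tau>\<close>, so \<open>f\<close> commutes with its modes.\<close>
  have conf: "F conformal = conformal" "\<tau> conformal = conformal"
    using lift_action_conformal[of ghat, OF ghat_zero g] \<tau>
    by (simp_all add: F_def voa_Aut_def fixed_subVOA_def lattice_VOA_def)
  have f1: "f v \<in> weight1 L \<epsilon> lam" if v: "v \<in> V0" "v \<in> weight1 L \<epsilon> 0" for v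
  proof -
    have "f v \<in> V1" using f(1) v by (auto simp: bij_betw_def)
    moreover have "vertex_op \<epsilon> 0 conformal 1 v = v" using v by (simp add: weight1_def)
    then have "vertex_op \<epsilon> lam conformal 1 (f v) = f v"
      using fY[OF conformal_fock_space[OF zero] conf(1) v(1), of 1] unfolding conf(2) by simp
    ultimately show ?thesis by (simp add: weight1_def V1_def)
  qed
  have V0: "0 \<in> V0" "\<And>u v. u \<in> V0 \<Longrightarrow> v \<in> V0 \<Longrightarrow> u + v \<in> V0" "\<And>c v. v \<in> V0 \<Longrightarrow> scale c v \<in> V0"
    using lift_action_scale[of g ghat 0 0]
    by (simp_all add: V0_def F_def fock_space_0 fock_space_add fock_space_scale lift_action_add
        lift_action_scale scale_add mult.commute)
  define \<omega> where "\<omega> = inverse \<zeta>"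
  have \<zeta>: "\<zeta> ^ p = 1" "\<zeta> \<noteq> 1"
    using complex_root_unity[of p j] complex_root_unity_eq_1[of p j] p0 j nat_dvd_not_less[of j p]
    by (auto simp: \<zeta>_def)
  have \<zeta>0: "\<zeta> \<noteq> 0" by (simp add: \<zeta>_def)
  have \<omega>: "\<omega> ^ p = 1" "\<omega> \<noteq> 1" "\<zeta> * \<omega> = 1"
    using \<zeta> \<zeta>0 by (simp_all add: \<omega>_def power_inverse)
  \<comment> \<open>Up to a factor \<open>p\<close>, the projection of \<open>y\<close> to the
    eigenspace of \<open>g\<close> for \<open>\<zeta>\<close>. The powers are those of the inverse
    of \<open>\<zeta>\<close>, so that applying \<open>g\<close> multiplies by
    \<open>\<zeta>\<close>.\<close>
  define w where "w y = (\<Sum>i<p. scale (\<omega> ^ i) (creation ((g ^^ i) y) 1))" for y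
  have Fw: "F (w y) = scale \<zeta> (w y)" for y
  proof -
    let ?a = "\<lambda>i. scale (\<omega> ^ i) (creation ((g ^^ i) y) 1)"
    have "F (w y) = (\<Sum>i<p. scale \<zeta> (?a (Suc i)))"
      using \<omega>(3) by (simp add: F_def w_def lift_action_sum lift_action_scale
          lift_action_creation[of ghat, OF ghat_zero lin] flip: mult.assoc)
    also have "\<dots> = scale \<zeta> (\<Sum>i<p. ?a (Suc i))" by (simp only: scale_sum)
    also have "(\<Sum>i<p. ?a (Suc i)) = (\<Sum>i<p. ?a i)"
      using sum.lessThan_Suc_shift[of ?a p] sum.lessThan_Suc[of ?a p] \<omega>(1) gp by (simp add: add.commute)
    finally show ?thesis by (simp add: w_def)
  qed
  have w1: "w y \<in> weight1 L \<epsilon> 0" and wV: "w y \<in> V0" for y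
  proof -
    have fs: "w y \<in> fock_space L 0"
      unfolding w_def using zero by (intro fock_space_sum fock_space_scale creation_fock_space) auto
    show "w y \<in> V0" using fs Fw by (simp add: V0_def)
    have "lk (vertex_op \<epsilon> 0 conformal 1 (w y)) (M, \<mu>) = lk (w y) (M, \<mu>)" for M \<mu>
    proof (cases "lk (w y) (M, \<mu>) = 0")
      case False
      then have "\<exists>i<p. lk (scale (\<omega> ^ i) (creation ((g ^^ i) y) 1)) (M, \<mu>) \<noteq> 0"
        unfolding w_def lookup_sum by (meson sum.neutral lessThan_iff)
      then obtain i where i: "lk (creation ((g ^^ i) y) 1) (M, \<mu>) \<noteq> 0" by auto
      have c: "creation ((g ^^ i) y) 1 \<in> weight1 L \<epsilon> 0" using coc zero by (rule creation_weight1)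
      then have "of_nat (\<Sum>x\<in>#M. snd x) + complex_of_real (\<mu> \<bullet> \<mu>) / 2 = 1"
        using vertex_op_conformal[OF coc, of "creation ((g ^^ i) y) 1" 0 M \<mu>] i
        unfolding weight1_def by simp
      then show ?thesis unfolding vertex_op_conformal[OF coc fs] by simp
    qed (simp only: vertex_op_conformal[OF coc fs], simp)
    then have "vertex_op \<epsilon> 0 conformal 1 (w y) = w y"
      by (intro poly_mapping_eqI) auto
    then show "w y \<in> weight1 L \<epsilon> 0" using fs by (simp add: weight1_def)
  qed
  obtain a where a: "\<exists>y\<in>Z. a y \<noteq> 0" "\<And>s. s \<in> S \<Longrightarrow> (\<Sum>y\<in>Z. a y * lk (f (w y)) ({#}, s)) = 0"
    using homogeneous_system_nontrivial[OF S(1) Z(1) less, of "\<lambda>y s. lk (f (w y)) ({#}, s)"] by blast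
  define u where "u = (\<Sum>y\<in>Z. scale (a y) (w y))"
  have uV: "u \<in> V0"
    unfolding u_def using V0 wV by (induction Z rule: infinite_finite_induct) auto
  have fu: "f u = (\<Sum>y\<in>Z. scale (a y) (f (w y)))"
    unfolding u_def
    by (subst linear_on_space_sum[OF f(2) V0(1,2)]) (use V0 wV f(2) in \<open>auto simp: linear_on_space_def\<close>)
  have fuV: "f u \<in> V1" using uV f(1) by (auto simp: bij_betw_def)
  have fw: "f (w y) \<in> weight1 L \<epsilon> lam" for y using wV w1 by (rule f1)
  have keys: "\<exists>\<mu>. k = ({#}, \<mu>) \<and> \<mu> - lam \<in> L \<and> \<mu> \<bullet> \<mu> = 2" if k: "lk (f u) k \<noteq> 0" for k
  proof -
    have "\<exists>y\<in>Z. lk (scale (a y) (f (w y))) k \<noteq> 0"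
      using k unfolding fu lookup_sum by (meson sum.neutral)
    then obtain y where "lk (f (w y)) k \<noteq> 0" by auto
    then show ?thesis using weight1_keys[OF coc fw _ lam', of "fst k" "snd k" y]
      by (cases k) (auto simp: in_keys_iff)
  qed
  have "f u \<in> weight1 L \<epsilon> lam"
  proof -
    have fs: "f u \<in> fock_space L lam" using fuV by (simp add: V1_def)
    have "lk (vertex_op \<epsilon> lam conformal 1 (f u)) (M, \<mu>) = lk (f u) (M, \<mu>)" for M \<mu>
      using vertex_op_conformal[OF coc fs, of M \<mu>] keys[of "(M, \<mu>)"]
      by (cases "lk (f u) (M, \<mu>) = 0") auto
    then have "vertex_op \<epsilon> lam conformal 1 (f u) = f u" by (intro poly_mapping_eqI) auto
    then show ?thesis using fs by (simp add: weight1_def)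
  qed
  have "lk (f u) k = 0" for k
  proof (rule ccontr)
    assume nz: "lk (f u) k \<noteq> 0"
    then obtain \<mu> where \<mu>: "k = ({#}, \<mu>)" "\<mu> - lam \<in> L" "\<mu> \<bullet> \<mu> = 2" using keys by blast
    then obtain s i where s: "s \<in> S" "\<mu> = (g ^^ i) s" using S(2) by blast
    have "lk (f u) ({#}, s) = 0" using a(2)[OF s(1)] by (simp add: fu lookup_sum)
    moreover have "G (f u) = scale \<eta> (f u)" using fuV by (simp add: V1_def)
    moreover have "\<eta> \<noteq> 0" by (simp add: \<eta>_def)
    ultimately have "lk (f u) ({#}, (g ^^ i) s) = 0"
      using eigenvector_lookup_zero[OF G lam \<open>f u \<in> weight1 L \<epsilon> lam\<close>] by blast
    with nz \<mu> s show False by simp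
  qed
  then have "f u = 0" by (intro poly_mapping_eqI) auto
  then have "f u = f 0" using linear_on_space_0[OF f(2) V0(1)] by simp
  then have u0: "u = 0" using f(1) uV V0(1) by (auto simp: bij_betw_def inj_on_def)
  \<comment> \<open>The complex-linear extension of the inner product with \<open>z\<close> to the
    span of the vectors h(-1). Orthogonality of the orbits lets it isolate the coefficient
    \<open>a z\<close>.\<close>
  define pr where "pr z v = (\<Sum>b\<in>Basis. lk v ({#(b, 1)#}, 0) * of_real (b \<bullet> z))" for z :: 'a and v :: "'a fock"
  have pr_sum: "pr z (sum h A) = (\<Sum>i\<in>A. pr z (h i))" for z h and A :: "'b set"
    by (simp add: pr_def lookup_sum sum_distrib_right sum.swap[of _ _ A])
  have pr_scale: "pr z (scale c v) = c * pr z v" for z c v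
    by (simp add: pr_def sum_distrib_left mult.assoc)
  have pr_creation: "pr z (creation h 1) = of_real (h \<bullet> z)" for z h
  proof -
    have "lk (creation h 1) ({#(b, 1)#}, 0) = of_real (h \<bullet> b)" if "b \<in> Basis" for b
      using that by (simp add: creation_def lookup_sum lookup_single when_def sum.delta)
    then show ?thesis
      by (subst euclidean_inner) (simp add: pr_def inner_commute)
  qed
  have "a z = 0" if z: "z \<in> Z" for z
  proof (rule ccontr)
    assume az: "a z \<noteq> 0"
    have prw: "pr z (w y) = (\<Sum>i<p. \<omega> ^ i * of_real ((g ^^ i) y \<bullet> z))" for y
      by (simp only: w_def pr_sum pr_scale pr_creation)
    have "pr z u = (\<Sum>y\<in>Z. a y * pr z (w y))"
      by (simp only: u_def pr_sum pr_scale)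
    also have "\<dots> = a z * pr z (w z)"
      using z Z(1,4) by (subst sum.remove[of _ z]) (auto intro!: sum.neutral simp: prw)
    finally have "pr z (w z) = 0" using u0 az by (simp add: pr_def)
    define n where "n i = \<lfloor>(g ^^ i) z \<bullet> z\<rfloor>" for i
    have n: "of_int (n i) = (g ^^ i) z \<bullet> z" for i
      using Z(3)[OF z, of i] by (simp add: n_def)
    have "complex_of_int (n i) = of_real ((g ^^ i) z \<bullet> z)" for i
      by (simp flip: n)
    then have "(\<Sum>i<p. of_int (n i) * \<omega> ^ i) = 0"
      using \<open>pr z (w z) = 0\<close> unfolding prw by (simp add: mult.commute)
    \<comment> \<open>All coefficients of the relation agree. Indices 1 and 0 give (g z|z) = (z|z),
      and two vectors of equal norm with this inner product coincide.\<close>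
    from root_of_unity_int_relation[OF p \<omega>(1,2) this, of 1] have "n 1 = n 0"
      using prime_gt_1_nat[OF p] by simp
    then have "g z \<bullet> z = z \<bullet> z" using n[of 1] n[of 0] by simp
    moreover have "g z \<bullet> g z = z \<bullet> z" using g by (simp add: orthogonal_transformation_def)
    ultimately have "(g z - z) \<bullet> (g z - z) = 0" by (simp add: inner_diff inner_commute)
    then show False using Z(2)[OF z] by simp
  qed
  with a(1) show False by blast
qed

end

section \<open>Blocks of extended Dynkin diagrams of type A\<close>

lemma int_span_zero: "0 \<in> int_span S"
  unfolding int_span_def by (rule CollectI, rule exI[of _ "{}"]) auto

lemma int_span_base: "x \<in> S \<Longrightarrow> x \<in> int_span S"
  unfolding int_span_def
  by (rule CollectI, rule exI[of _ "{x}"], rule exI[of _ "\<lambda>_. 1"]) auto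

lemma int_span_add:
  assumes "x \<in> int_span S" "y \<in> int_span S"
  shows "x + y \<in> int_span S"
proof -
  obtain T c U d where T: "finite T" "T \<subseteq> S" "x = (\<Sum>x\<in>T. of_int (c x) *\<^sub>R x)"
    and U: "finite U" "U \<subseteq> S" "y = (\<Sum>x\<in>U. of_int (d x) *\<^sub>R x)"
    using assms by (auto simp: int_span_def)
  define c' d' where "c' z = (if z \<in> T then c z else 0)" and "d' z = (if z \<in> U then d z else 0)" for z
  have "x = (\<Sum>z\<in>T \<union> U. of_int (c' z) *\<^sub>R z)" "y = (\<Sum>z\<in>T \<union> U. of_int (d' z) *\<^sub>R z)"
    unfolding T(3) U(3) c'_def d'_def using T(1) U(1)
    by (intro sum.mono_neutral_cong_left; auto)+
  then have "x + y = (\<Sum>z\<in>T \<union> U. of_int (c' z + d' z) *\<^sub>R z)"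
    by (simp add: scaleR_add_left sum.distrib)
  then show ?thesis using T U unfolding int_span_def by (intro CollectI exI[of _ "T \<union> U"] exI[of _ "\<lambda>z. c' z + d' z"]) auto
qed

lemma int_span_scale:
  assumes "x \<in> int_span S"
  shows "of_int n *\<^sub>R x \<in> int_span S"
proof -
  obtain T c where T: "finite T" "T \<subseteq> S" "x = (\<Sum>x\<in>T. of_int (c x) *\<^sub>R x)"
    using assms by (auto simp: int_span_def)
  then have "of_int n *\<^sub>R x = (\<Sum>x\<in>T. of_int (n * c x) *\<^sub>R x)"
    by (simp add: scaleR_sum_right)
  then show ?thesis using T unfolding int_span_def by (intro CollectI exI[of _ T] exI[of _ "\<lambda>z. n * c z"]) auto
qed

locale int_module =
  fixes H :: "'a::real_vector set"
  assumes zero: "0 \<in> H" and add: "x \<in> H \<Longrightarrow> y \<in> H \<Longrightarrow> x + y \<in> H"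
    and scale_int: "x \<in> H \<Longrightarrow> of_int n *\<^sub>R x \<in> H"
begin

lemma minus: "x \<in> H \<Longrightarrow> - x \<in> H"
  using scale_int[of x "-1"] by simp

lemma diff: "x \<in> H \<Longrightarrow> y \<in> H \<Longrightarrow> x - y \<in> H"
  using add[of x "- y"] minus by simp

lemma sum: "(\<And>i. i \<in> A \<Longrightarrow> f i \<in> H) \<Longrightarrow> sum f A \<in> H"
  by (induction A rule: infinite_finite_induct) (auto simp: zero add)

lemma scale_nat: "x \<in> H \<Longrightarrow> of_nat n *\<^sub>R x \<in> H"
  using scale_int[of x "int n"] by simp

lemma scale_Ints: "x \<in> H \<Longrightarrow> c \<in> \<int> \<Longrightarrow> c *\<^sub>R x \<in> H"
  using scale_int by (auto elim!: Ints_cases)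

lemma int_span_subset:
  assumes "S \<subseteq> H"
  shows "int_span S \<subseteq> H"
proof
  fix y assume "y \<in> int_span S"
  then obtain T c where T: "T \<subseteq> S" "y = (\<Sum>x\<in>T. of_int (c x) *\<^sub>R x)"
    by (auto simp: int_span_def)
  show "y \<in> H" unfolding T(2) using T(1) assms by (intro sum scale_int) auto
qed

end

lemma int_module_int_span: "int_module (int_span S)"
  by unfold_locales (auto intro: int_span_zero int_span_add int_span_scale)

lemma int_span_insert:
  assumes "int_module L"
  shows "int_span (insert lam L) = {of_int n *\<^sub>R lam + x | n x. x \<in> L}" (is "_ = ?N")
proof -
  interpret L: int_module L by fact
  have "int_module ?N"
  proof
    show "0 \<in> ?N" using L.zero by (intro CollectI exI[of _ 0]) auto
    show "x + y \<in> ?N" if xy: "x \<in> ?N" "y \<in> ?N" for x y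
    proof -
      obtain n x' m y' where "x = of_int n *\<^sub>R lam + x'" "y = of_int m *\<^sub>R lam + y'" "x' \<in> L" "y' \<in> L"
        using xy by auto
      then have "x + y = of_int (n + m) *\<^sub>R lam + (x' + y')" "x' + y' \<in> L"
        by (auto simp: L.add scaleR_add_left)
      then show ?thesis by blast
    qed
    show "of_int k *\<^sub>R x \<in> ?N" if x: "x \<in> ?N" for x k
    proof -
      obtain n x' where "x = of_int n *\<^sub>R lam + x'" "x' \<in> L" using x by auto
      then have "of_int k *\<^sub>R x = of_int (k * n) *\<^sub>R lam + of_int k *\<^sub>R x'" "of_int k *\<^sub>R x' \<in> L"
        by (auto simp: L.scale_int scaleR_add_right)
      then show ?thesis by blast
    qed
  qed
  then interpret N: int_module ?N .
  have "lam \<in> ?N" using L.zero by (intro CollectI exI[of _ 1] exI[of _ 0]) auto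
  moreover have "L \<subseteq> ?N" by (auto intro: exI[of _ 0])
  ultimately have "int_span (insert lam L) \<subseteq> ?N" by (intro N.int_span_subset) auto
  moreover have "of_int n *\<^sub>R lam + x \<in> int_span (insert lam L)" if "x \<in> L" for n x
    using that by (intro int_span_add int_span_scale int_span_base) auto
  then have "?N \<subseteq> int_span (insert lam L)" by blast
  ultimately show ?thesis by blast
qed

section \<open>Sums over one period of a cyclic sequence\<close>

lemma sum_periodic_Suc:
  fixes f :: "nat \<Rightarrow> 'a::ab_group_add"
  assumes "f p = f 0"
  shows "(\<Sum>j<p. f (Suc j)) = (\<Sum>j<p. f j)"
  using sum.lessThan_Suc_shift[of f p] sum.lessThan_Suc[of f p] assms by (simp add: add.commute)

lemma sum_periodic_shift:
  fixes f :: "nat \<Rightarrow> 'a::ab_group_add"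
  assumes "\<And>j. f (j + p) = f j"
  shows "(\<Sum>j<p. f (j + k)) = (\<Sum>j<p. f j)"
proof (induction k)
  case (Suc k)
  then show ?case using sum_periodic_Suc[of "\<lambda>j. f (j + k)" p] assms[of k] by (simp add: add.commute)
qed simp

text \<open>Write the weight \<open>j\<close> as (j + 1) - 1 and reindex; the only boundary term is
  the one at the wrap-around, of weight \<open>p\<close>.\<close>

lemma weighted_sum_periodic_Suc:
  fixes f :: "nat \<Rightarrow> 'a::real_vector"
  assumes "f p = f 0"
  shows "(\<Sum>j<p. real j *\<^sub>R f (Suc j)) = (\<Sum>j<p. real j *\<^sub>R f j) + real p *\<^sub>R f 0 - (\<Sum>j<p. f j)"
proof -
  have "(\<Sum>j<p. real j *\<^sub>R f (Suc j)) = (\<Sum>j<p. real (Suc j) *\<^sub>R f (Suc j)) - (\<Sum>j<p. f (Suc j))"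
    by (simp add: scaleR_add_left sum.distrib)
  also have "(\<Sum>j<p. real (Suc j) *\<^sub>R f (Suc j)) = (\<Sum>j<p. real j *\<^sub>R f j) + real p *\<^sub>R f 0"
    using sum.lessThan_Suc_shift[of "\<lambda>j. real j *\<^sub>R f j" p] sum.lessThan_Suc[of "\<lambda>j. real j *\<^sub>R f j" p] assms
    by simp
  finally show ?thesis by (simp add: sum_periodic_Suc assms)
qed

lemma weighted_sum_periodic_shift:
  fixes f :: "nat \<Rightarrow> 'a::real_vector"
  assumes f: "\<And>j. f (j + p) = f j" and 0: "(\<Sum>j<p. f j) = 0"
  shows "(\<Sum>j<p. real j *\<^sub>R f (j + k)) = (\<Sum>j<p. real j *\<^sub>R f j) + real p *\<^sub>R (\<Sum>m<k. f m)"
proof (induction k)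
  case (Suc k)
  have "(\<Sum>j<p. real j *\<^sub>R f (j + Suc k)) = (\<Sum>j<p. real j *\<^sub>R f (j + k)) + real p *\<^sub>R f k"
    using weighted_sum_periodic_Suc[of "\<lambda>j. f (j + k)" p] f[of k] sum_periodic_shift[of f p k] f 0
    by (simp add: add.commute)
  then show ?case using Suc by (simp add: scaleR_add_right)
qed simp

lemma sum_by_parts:
  fixes w :: "nat \<Rightarrow> 'a::real_vector"
  shows "(\<Sum>l<n. a l *\<^sub>R w l) = (\<Sum>l<n. (\<Sum>m\<le>l. a m) *\<^sub>R (w l - w (Suc l))) + (\<Sum>l<n. a l) *\<^sub>R w n"
  by (induction n) (simp_all add: scaleR_diff_right scaleR_add_left flip: lessThan_Suc_atMost)

text \<open>If the roots of a block are written cyclically as differences of consecutive standard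
  basis vectors of a \<open>p\<close>-dimensional space, this is the projection of basis vector
  \<open>l\<close> to the hyperplane of coordinate sum zero. Inner products with these
  \<open>p\<close> vectors are thus the coordinates in the standard model of A_(p-1).\<close>

definition dual_vec :: "nat \<Rightarrow> (nat \<Rightarrow> nat \<Rightarrow> 'a::real_vector) \<Rightarrow> nat \<Rightarrow> nat \<Rightarrow> 'a" where
  "dual_vec p \<beta> i l = - (1 / real p) *\<^sub>R (\<Sum>j<p. real j *\<^sub>R \<beta> i (l + j))"

text \<open>The pairing with chi. Coordinate \<open>l\<close> of the Weyl vector divided by
  \<open>p\<close> is (p - 1 - 2l) / (2p), and its part independent of \<open>l\<close> drops out
  because the coordinates of each block sum to zero. It is the usual height of a root divided by
  \<open>p\<close>.\<close>

definition height :: "nat \<Rightarrow> nat \<Rightarrow> (nat \<Rightarrow> nat \<Rightarrow> 'a::real_inner) \<Rightarrow> 'a \<Rightarrow> real" where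
  "height p t \<beta> x = - (1 / real p) * (\<Sum>i<t. \<Sum>l<p. real l * (x \<bullet> dual_vec p \<beta> i l))"

text \<open>Numbering each diagram by all natural numbers with period \<open>p\<close> allows the
  affine node to be moved by a mere shift of the index. With \<open>p \<ge> 3\<close> the two
  neighbours of a node are distinct.\<close>

locale affine_blocks =
  fixes p t :: nat and \<beta> :: "nat \<Rightarrow> nat \<Rightarrow> 'a::euclidean_space"
  assumes p3: "p \<ge> 3"
    and periodic: "\<beta> i (l + p) = \<beta> i l"
    and sum_zero: "i < t \<Longrightarrow> (\<Sum>l<p. \<beta> i l) = 0"
    and inner_eq: "i < t \<Longrightarrow> \<beta> i l \<bullet> \<beta> i m = 2 * of_bool ([l = m] (mod p)) - of_bool ([Suc l = m] (mod p)) - of_bool ([l = Suc m] (mod p))"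
    and inner_neq: "i < t \<Longrightarrow> i' < t \<Longrightarrow> i \<noteq> i' \<Longrightarrow> \<beta> i l \<bullet> \<beta> i' m = 0"
begin

abbreviation "v \<equiv> dual_vec p \<beta>"

abbreviation "h \<equiv> height p t \<beta>"

lemma p0: "p > 0" using p3 by simp

lemma v_periodic: "v i (l + p) = v i l"
proof -
  have "\<beta> i (l + p + j) = \<beta> i (l + j)" for j
    using periodic[of i "l + j"] by (simp add: add_ac)
  then show ?thesis by (simp add: dual_vec_def)
qed

lemma v_mod: "v i (l mod p) = v i l"
proof -
  have "v i (r + p * q) = v i r" for r q
    by (induction q) (simp_all add: add.assoc[symmetric] add.commute[of p] v_periodic)
  from this[of "l mod p" "l div p"] show ?thesis by simp
qed

lemma \<beta>_mod: "\<beta> i (l mod p) = \<beta> i l"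
proof -
  have "\<beta> i (r + p * q) = \<beta> i r" for r q
    by (induction q) (simp_all add: add.assoc[symmetric] add.commute[of p] periodic)
  from this[of "l mod p" "l div p"] show ?thesis by simp
qed

lemma sum_shift_zero: "i < t \<Longrightarrow> (\<Sum>j<p. \<beta> i (l + j)) = 0"
  using sum_periodic_shift[of "\<beta> i" p l] periodic sum_zero by (simp add: add.commute)

lemma v_diff:
  assumes "i < t"
  shows "v i l - v i (Suc l) = \<beta> i l"
proof -
  have "(\<Sum>j<p. real j *\<^sub>R \<beta> i (l + Suc j)) = (\<Sum>j<p. real j *\<^sub>R \<beta> i (l + j)) + real p *\<^sub>R \<beta> i l"
    using weighted_sum_periodic_Suc[of "\<lambda>j. \<beta> i (l + j)" p] periodic sum_shift_zero[OF assms] by simp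
  then show ?thesis using p0
    by (simp add: dual_vec_def scaleR_add_right)
qed

lemma v_sum_zero:
  assumes "i < t"
  shows "(\<Sum>l<p. v i l) = 0"
proof -
  have "(\<Sum>l<p. v i l) = - (1 / real p) *\<^sub>R (\<Sum>j<p. real j *\<^sub>R (\<Sum>l<p. \<beta> i (j + l)))"
    unfolding dual_vec_def scaleR_sum_right[symmetric]
    by (subst sum.swap) (simp add: scaleR_sum_right add.commute)
  then show ?thesis by (simp add: sum_shift_zero[OF assms])
qed

lemma sum_indicator: "(\<Sum>j<p. of_bool ([l + j = m] (mod p)) :: real) = 1"
proof -
  have per: "of_bool ([j + p = m] (mod p)) = (of_bool ([j = m] (mod p)) :: real)" for j
    by (simp add: cong_def)
  have "(\<Sum>j<p. of_bool ([l + j = m] (mod p)) :: real) = (\<Sum>j<p. of_bool ([j = m] (mod p)))"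
    using sum_periodic_shift[of "\<lambda>j. of_bool ([j = m] (mod p)) :: real" p l] per by (simp add: add.commute)
  also have "\<dots> = (\<Sum>j<p. if j = m mod p then 1 else 0)"
    by (intro sum.cong) (auto simp: cong_def)
  also have "\<dots> = 1" using p0 by (simp add: sum.delta)
  finally show ?thesis .
qed

text \<open>The cyclic indicator \<open>E\<close> depends only on the difference of its indices, so
  the weighted sums for both neighbours arise from the central one by a single shift. The
  contributions -1 and +1 of the two shifts cancel.\<close>

lemma v_inner_eq:
  assumes i: "i < t"
  shows "v i l \<bullet> \<beta> i m = of_bool ([l = m] (mod p)) - of_bool ([l = Suc m] (mod p))"
proof -
  define E :: "nat \<Rightarrow> nat \<Rightarrow> real" where "E l m = of_bool ([l = m] (mod p))" for l m
  have per: "E (l + p) m = E l m" for l m by (simp add: E_def cong_def)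
  have SS: "E (Suc l) (Suc m) = E l m" for l m
    by (simp add: E_def cong_add_rcancel_nat[of _ 1, simplified] del: cong_def)
  have 1: "(\<Sum>j<p. E (l + j) m) = 1" for l m using sum_indicator[of l m] by (simp add: E_def)
  have step: "(\<Sum>j<p. real j * E (Suc (l + j)) m) = (\<Sum>j<p. real j * E (l + j) m) + real p * E l m - 1" for l m
    using weighted_sum_periodic_Suc[of "\<lambda>j. E (l + j) m" p] per[of l m] 1[of l m] by simp
  have "(\<Sum>j<p. real j * (\<beta> i (l + j) \<bullet> \<beta> i m)) =
    2 * (\<Sum>j<p. real j * E (l + j) m) - (\<Sum>j<p. real j * E (Suc (l + j)) m) - (\<Sum>j<p. real j * E (l + j) (Suc m))"
  proof -
    have "\<beta> i (l + j) \<bullet> \<beta> i m = 2 * E (l + j) m - E (Suc (l + j)) m - E (l + j) (Suc m)" for j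
      by (simp only: inner_eq[OF i] E_def)
    then show ?thesis by (simp add: sum_distrib_left sum_subtractf right_diff_distrib mult_ac)
  qed
  also have "\<dots> = - real p * E l m + real p * E l (Suc m)"
    using step[of l m] step[of l "Suc m"] by (simp add: SS)
  finally show ?thesis using p0
    by (simp add: dual_vec_def inner_sum_left E_def field_simps)
qed

lemma v_inner_neq: "i < t \<Longrightarrow> i' < t \<Longrightarrow> i \<noteq> i' \<Longrightarrow> v i l \<bullet> \<beta> i' m = 0"
  by (simp add: dual_vec_def inner_sum_left inner_neq)

lemma v_inner:
  assumes "i < t" "i' < t" "l < p" "m < p"
  shows "v i l \<bullet> \<beta> i' m = (if i = i' then of_bool (l = m) - of_bool (l = Suc m mod p) else 0)"
  using assms v_inner_eq[of i l m] v_inner_neq[of i i' l m] by (auto simp: cong_def)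

text \<open>The orthogonal projection to the span of the blocks: a vector is rebuilt from its
  coordinates in the standard model.\<close>

definition expand :: "'a \<Rightarrow> 'a" where
  "expand x = (\<Sum>i<t. \<Sum>l<p. (x \<bullet> v i l) *\<^sub>R v i l)"

text \<open>A root has coordinates 1 and -1 at consecutive places and 0 elsewhere, so its pairing
  with \<open>expand x\<close> is a difference of two coordinates of \<open>x\<close>, which is its
  pairing with \<open>x\<close>.\<close>

lemma expand_orthogonal:
  assumes "i < t"
  shows "(x - expand x) \<bullet> \<beta> i m = 0"
proof -
  have "expand x \<bullet> \<beta> i m = expand x \<bullet> \<beta> i (m mod p)" by (simp add: \<beta>_mod)
  also have "\<dots> = (\<Sum>i'<t. \<Sum>l<p. (x \<bullet> v i' l) * (v i' l \<bullet> \<beta> i (m mod p)))"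
    by (simp add: expand_def inner_sum_left)
  also have "\<dots> = (\<Sum>i'<t. if i' = i then \<Sum>l<p. (x \<bullet> v i' l) * (v i' l \<bullet> \<beta> i (m mod p)) else 0)"
    using assms by (intro sum.cong refl) (auto simp: v_inner_neq)
  also have "\<dots> = (\<Sum>l<p. (x \<bullet> v i l) * (v i l \<bullet> \<beta> i (m mod p)))"
    using assms by (simp add: sum.delta)
  also have "\<dots> = (\<Sum>l<p. (if l = m mod p then x \<bullet> v i l else 0) - (if l = Suc (m mod p) mod p then x \<bullet> v i l else 0))"
    using p0 by (intro sum.cong refl) (auto simp: v_inner assms)
  also have "\<dots> = x \<bullet> v i (m mod p) - x \<bullet> v i (Suc (m mod p) mod p)"
    using p0 by (simp add: sum_subtractf sum.delta)
  also have "\<dots> = x \<bullet> \<beta> i m"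
    using v_diff[OF assms, of "m mod p"] by (simp add: v_mod \<beta>_mod flip: inner_diff_right)
  finally show ?thesis by (simp add: inner_diff_left)
qed

lemma inner_v_scaled: "real p * (x \<bullet> v i l) = - (\<Sum>j<p. real j * (x \<bullet> \<beta> i (l + j)))"
  using p0 by (simp add: dual_vec_def inner_sum_right)

lemma v_scaled: "real p *\<^sub>R v i l = - (\<Sum>j<p. real j *\<^sub>R \<beta> i (l + j))"
  using p0 by (simp add: dual_vec_def)

text \<open>Consecutive \<open>v i l\<close> differ by a root of the block. So all coordinates of a
  block lie in one class modulo the integers, the class that the code word records.\<close>

lemma inner_v_diff_Ints:
  assumes i: "i < t" and x: "\<And>m. x \<bullet> \<beta> i m \<in> \<int>"
  shows "x \<bullet> v i l - x \<bullet> v i 0 \<in> \<int>"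
proof (induction l)
  case (Suc l)
  have "x \<bullet> v i (Suc l) - x \<bullet> v i 0 = (x \<bullet> v i l - x \<bullet> v i 0) - x \<bullet> \<beta> i l"
    by (simp add: inner_diff_right flip: v_diff[OF i])
  then show ?case using Suc x by (metis Ints_diff)
qed simp

lemma inner_v_scaled_Ints:
  assumes x: "\<And>m. x \<bullet> \<beta> i m \<in> \<int>"
  shows "real p * (x \<bullet> v i l) \<in> \<int>"
  unfolding inner_v_scaled using x by (intro Ints_minus Ints_sum Ints_mult) auto

text \<open>Abel summation. As the coefficients sum to zero, the boundary term disappears.\<close>

lemma abel:
  assumes "i < t" "(\<Sum>l<p. a l) = 0"
  shows "(\<Sum>l<p. a l *\<^sub>R v i l) = (\<Sum>l<p. (\<Sum>m\<le>l. a m) *\<^sub>R \<beta> i l)"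
  using sum_by_parts[of a "v i" p] assms by (simp add: v_diff)

lemma shift: "affine_blocks p t (\<lambda>i l. \<beta> i (l + c i))"
proof
  show "3 \<le> p" by (rule p3)
  show "\<beta> i (l + p + c i) = \<beta> i (l + c i)" for i l
    using periodic[of i "l + c i"] by (simp add: add_ac)
  show "(\<Sum>l<p. \<beta> i (l + c i)) = 0" if "i < t" for i
    using sum_shift_zero[OF that, of "c i"] by (simp add: add.commute)
  show "\<beta> i (l + c i) \<bullet> \<beta> i (m + c i) = 2 * of_bool ([l = m] (mod p)) - of_bool ([Suc l = m] (mod p)) - of_bool ([l = Suc m] (mod p))"
    if "i < t" for i l m
    using inner_eq[OF that, of "l + c i" "m + c i"] cong_add_rcancel_nat[of l "c i" m p]
      cong_add_rcancel_nat[of "Suc l" "c i" m p] cong_add_rcancel_nat[of l "c i" "Suc m" p] by simp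
  show "\<beta> i (l + c i) \<bullet> \<beta> i' (m + c i') = 0" if "i < t" "i' < t" "i \<noteq> i'" for i i' l m
    using inner_neq[OF that] .
qed

lemma dual_vec_shift: "dual_vec p (\<lambda>i l. \<beta> i (l + c i)) i l = v i (l + c i)"
  by (simp add: dual_vec_def add_ac)

text \<open>Moving the start of block \<open>i\<close> to place \<open>c i\<close> rotates the
  weights \<open>l\<close>; what wraps around are the coordinates passed over.\<close>

lemma height_shift:
  "height p t (\<lambda>i l. \<beta> i (l + c i)) x = h x - (\<Sum>i<t. \<Sum>m<c i. x \<bullet> v i m)"
proof -
  have "(\<Sum>l<p. real l * (x \<bullet> v i (l + c i))) = (\<Sum>l<p. real l * (x \<bullet> v i l)) + real p * (\<Sum>m<c i. x \<bullet> v i m)"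
    if "i < t" for i
    using weighted_sum_periodic_shift[of "\<lambda>l. x \<bullet> v i l" p "c i"] v_periodic v_sum_zero[OF that]
    by (simp flip: inner_sum_right)
  then have "height p t (\<lambda>i l. \<beta> i (l + c i)) x = - (1 / real p) *
      ((\<Sum>i<t. \<Sum>l<p. real l * (x \<bullet> v i l)) + real p * (\<Sum>i<t. \<Sum>m<c i. x \<bullet> v i m))"
    by (simp add: height_def dual_vec_shift sum.distrib flip: sum_distrib_left)
  then show ?thesis using p0 by (simp add: height_def distrib_left)
qed

lemma height_add: "h (x + y) = h x + h y"
  by (simp add: height_def inner_add_left distrib_left sum.distrib)

lemma height_scale: "h (c *\<^sub>R x) = c * h x"
  by (simp add: height_def sum_distrib_left mult_ac)

lemma height_sum: "h (sum f A) = (\<Sum>a\<in>A. h (f a))"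
  using height_scale[of 0 0] by (induction A rule: infinite_finite_induct) (auto simp: height_add)

text \<open>The last root of a block is minus the sum of the other \<open>p - 1\<close> roots, of
  height 1/p each. Modulo the integers all roots of the blocks thus have height 1/p.\<close>

lemma height_\<beta>:
  assumes "i < t" "m < p"
  shows "h (\<beta> i m) = 1 / real p - of_bool (Suc m = p)"
proof -
  have "(\<Sum>i'<t. \<Sum>l<p. real l * (\<beta> i m \<bullet> v i' l)) = (\<Sum>i'<t. if i' = i then \<Sum>l<p. real l * (\<beta> i m \<bullet> v i' l) else 0)"
    using assms by (intro sum.cong refl) (auto simp: v_inner_neq inner_commute[of "\<beta> i m"])
  also have "\<dots> = (\<Sum>l<p. real l * (v i l \<bullet> \<beta> i m))" using assms by (simp add: sum.delta inner_commute)
  also have "\<dots> = (\<Sum>l<p. (if l = m then real l else 0) - (if l = Suc m mod p then real l else 0))"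
    using assms by (intro sum.cong refl) (auto simp: v_inner)
  also have "\<dots> = real m - real (Suc m mod p)"
    using assms by (simp add: sum_subtractf sum.delta)
  finally have "h (\<beta> i m) = - (1 / real p) * (real m - real (Suc m mod p))" by (simp add: height_def)
  then show ?thesis using assms
    by (cases "Suc m = p") (auto simp: field_simps)
qed

end

section \<open>Cosets of the root lattice\<close>

lemma divide_in_Ints_iff:
  assumes "p > 0"
  shows "of_int n / real p \<in> \<int> \<longleftrightarrow> int p dvd n"
proof
  assume "of_int n / real p \<in> \<int>"
  then obtain k where "of_int n / real p = of_int k" by (elim Ints_cases)
  then have "real_of_int n = of_int (k * int p)" using assms by (simp add: field_simps)
  then have "n = k * int p" by (simp only: of_int_eq_iff)
  then show "int p dvd n" by simp
next
  assume "int p dvd n"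
  then obtain k where "n = int p * k" by (elim dvdE)
  then show "of_int n / real p \<in> \<int>" using assms by simp
qed

text \<open>Duality over the field with \<open>p\<close> elements, with values and coefficients
  lifted to numbers. In the induction the first functionals suffice on the kernel of the last one,
  and the defect outside is a multiple of that last one. The natural coefficients will serve as
  shifts of blocks.\<close>

lemma functional_extension:
  fixes F :: "'a::real_vector \<Rightarrow> int" and \<kappa> :: "nat \<Rightarrow> 'a \<Rightarrow> int"
  assumes p: "prime p" and H: "int_module H"
    and F: "\<And>x y. x \<in> H \<Longrightarrow> y \<in> H \<Longrightarrow> F (x + y) = F x + F y" "\<And>n x. x \<in> H \<Longrightarrow> F (of_int n *\<^sub>R x) = n * F x"
    and \<kappa>: "\<And>i x y. x \<in> H \<Longrightarrow> y \<in> H \<Longrightarrow> \<kappa> i (x + y) = \<kappa> i x + \<kappa> i y" "\<And>i n x. x \<in> H \<Longrightarrow> \<kappa> i (of_int n *\<^sub>R x) = n * \<kappa> i x"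
    and ker: "\<And>x. x \<in> H \<Longrightarrow> \<forall>i<t. int p dvd \<kappa> i x \<Longrightarrow> int p dvd F x"
  shows "\<exists>c :: nat \<Rightarrow> nat. \<forall>x\<in>H. int p dvd F x - (\<Sum>i<t. int (c i) * \<kappa> i x)"
  using H F \<kappa> ker
proof (induction t arbitrary: H)
  case (Suc t H)
  interpret H: int_module H by (rule Suc.prems)
  note F = Suc.prems(2,3) and \<kappa> = Suc.prems(4,5)
  define H' where "H' = {x \<in> H. int p dvd \<kappa> t x}"
  have 0: "\<kappa> t 0 = 0" using \<kappa>(2)[OF H.zero, of t 0] by simp
  have H': "int_module H'"
    by unfold_locales (auto simp: H'_def H.zero H.add H.scale_int \<kappa> 0)
  have "\<exists>c :: nat \<Rightarrow> nat. \<forall>x\<in>H'. int p dvd F x - (\<Sum>i<t. int (c i) * \<kappa> i x)"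
    by (rule Suc.IH[OF H']) (auto simp: H'_def F \<kappa> less_Suc_eq intro!: Suc.prems(6))
  then obtain c :: "nat \<Rightarrow> nat" where c: "\<And>x. x \<in> H' \<Longrightarrow> int p dvd F x - (\<Sum>i<t. int (c i) * \<kappa> i x)" by blast
  define F' where "F' x = F x - (\<Sum>i<t. int (c i) * \<kappa> i x)" for x
  have F'_diff: "F' (x + of_int n *\<^sub>R y) = F' x + n * F' y" if "x \<in> H" "y \<in> H" for x y n
    using that by (simp add: F'_def F \<kappa> H.scale_int sum.distrib sum_distrib_left algebra_simps)
  have upd: "F x - (\<Sum>i<Suc t. int ((c(t := d)) i) * \<kappa> i x) = F' x - int d * \<kappa> t x" for x d
    by (simp add: F'_def)
  show ?case
  proof (cases "\<forall>x\<in>H. int p dvd \<kappa> t x")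
    case True
    then have "int p dvd F' x" if "x \<in> H" for x using c that by (auto simp: H'_def F'_def)
    then show ?thesis by (intro exI[of _ "c(t := 0)"] ballI) (simp only: upd, simp)
  next
    case False
    then obtain y where y: "y \<in> H" "\<not> int p dvd \<kappa> t y" by blast
    have "coprime (\<kappa> t y) (int p)" using y(2) p by (simp add: prime_imp_coprime coprime_commute)
    then obtain u where u: "[\<kappa> t y * u = 1] (mod int p)" by (meson cong_solve_coprime_int)
    \<comment> \<open>Since \<open>u\<close> inverts \<open>\<kappa> t y\<close>, this is the
      multiple of \<open>\<kappa> t\<close> that agrees with \<open>F'\<close> at \<open>y\<close>
      modulo \<open>p\<close>.\<close>
    define d where "d = nat ((u * F' y) mod int p)"
    have p0: "p > 0" using p by (rule prime_gt_0_nat)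
    then have d: "int p dvd int d - u * F' y" by (simp add: d_def mod_eq_dvd_iff[symmetric])
    have "int p dvd F' x - int d * \<kappa> t x" if x: "x \<in> H" for x
    proof -
      \<comment> \<open>A multiple of \<open>y\<close> moves \<open>x\<close> into the kernel of
        \<open>\<kappa> t\<close>, where the induction hypothesis applies.\<close>
      define z where "z = x + of_int (- (u * \<kappa> t x)) *\<^sub>R y"
      have "\<kappa> t z = \<kappa> t x + (- (u * \<kappa> t x)) * \<kappa> t y"
        unfolding z_def using x y(1) by (simp only: \<kappa> H.scale_int)
      also have "\<dots> = - \<kappa> t x * (\<kappa> t y * u - 1)" by (simp add: algebra_simps)
      finally have "int p dvd \<kappa> t z" using u by (simp add: cong_iff_dvd_diff)
      then have "z \<in> H'" unfolding H'_def z_def using x y(1) H.add H.scale_int by blast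
      then have "int p dvd F' z" using c by (simp add: F'_def)
      moreover have "F' z = F' x + (- (u * \<kappa> t x)) * F' y" unfolding z_def using x y(1) by (rule F'_diff)
      moreover have "F' x - int d * \<kappa> t x = F' x + (- (u * \<kappa> t x)) * F' y - (int d - u * F' y) * \<kappa> t x"
        by (simp add: algebra_simps)
      ultimately show ?thesis using d by (metis dvd_diff dvd_mult2)
    qed
    then show ?thesis by (intro exI[of _ "c(t := d)"] ballI) (simp only: upd)
  qed
qed simp

lemma fund_weight_alt:
  "k \<le> p \<Longrightarrow> p > 0 \<Longrightarrow> fund_weight p k = (\<lambda>j. if j < p then of_bool (j < k) - real k / real p else 0)"
  by (rule ext) (auto simp: fund_weight_def field_simps)

text \<open>Modulo the integers every coordinate of the \<open>k\<close>-th fundamental weight is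
  -k/p.\<close>

lemma fund_weight_coset:
  assumes "a \<in> A_space p" "k < p"
  shows "a - fund_weight p k \<in> A_lattice p \<longleftrightarrow> (\<forall>l<p. a l + real k / real p \<in> \<int>)"
proof -
  have fw: "fund_weight p k = (\<lambda>j. if j < p then of_bool (j < k) - real k / real p else 0)"
    using assms by (intro fund_weight_alt) auto
  have "(\<Sum>j<p. fund_weight p k j) = (\<Sum>j<p. of_bool (j < k)) - real k"
    using assms(2) by (simp add: fw sum_subtractf)
  also have "(\<Sum>j<p. of_bool (j < k) :: real) = real (card ({..<p} \<inter> {j. j < k}))"
    by simp
  also have "{..<p} \<inter> {j. j < k} = {..<k}" using assms(2) by auto
  finally have "a - fund_weight p k \<in> A_space p"
    using assms by (simp add: A_space_def sum_subtractf fw)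
  then have "a - fund_weight p k \<in> A_lattice p \<longleftrightarrow> (\<forall>l. a l - fund_weight p k l \<in> \<int>)"
    by (simp add: A_lattice_def)
  also have "\<dots> \<longleftrightarrow> (\<forall>l<p. a l - fund_weight p k l \<in> \<int>)"
    using assms by (auto simp: A_space_def fw)
  also have "\<dots> \<longleftrightarrow> (\<forall>l<p. a l + real k / real p \<in> \<int>)"
  proof (intro all_cong)
    fix l assume "l < p"
    then have "a l - fund_weight p k l = (a l + real k / real p) - of_bool (l < k)"
      by (simp add: fw)
    then show "(a l - fund_weight p k l \<in> \<int>) = (a l + real k / real p \<in> \<int>)"
      by (metis Ints_diff Ints_add diff_add_cancel of_bool_eq Ints_0 Ints_1)
  qed
  finally show ?thesis .
qed

text \<open>The dual of the root lattice: integrality against the roots means that coordinates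
  differ by integers.\<close>

definition A_dual :: "nat \<Rightarrow> (nat \<Rightarrow> real) set" where
  "A_dual p = {a \<in> A_space p. \<forall>l<p. a l - a 0 \<in> \<int>}"

lemma A_dual_scaled:
  assumes "a \<in> A_dual p"
  shows "real p * a 0 \<in> \<int>"
proof -
  have "real p * a 0 = (\<Sum>l<p. a l) - (\<Sum>l<p. a l - a 0)" by (simp add: sum_subtractf)
  also have "(\<Sum>l<p. a l) = 0" using assms by (simp add: A_dual_def A_space_def)
  finally show ?thesis using assms by (auto simp: A_dual_def)
qed

lemma A_dual_coset_iff:
  assumes a: "a \<in> A_dual p" and p: "p > 0"
  shows "(\<forall>l<p. a l + of_int k / real p \<in> \<int>) \<longleftrightarrow> int p dvd k + \<lfloor>real p * a 0\<rfloor>"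
proof -
  have "a l + of_int k / real p = (a 0 + of_int k / real p) + (a l - a 0)" for l by simp
  then have "(\<forall>l<p. a l + of_int k / real p \<in> \<int>) \<longleftrightarrow> a 0 + of_int k / real p \<in> \<int>"
    using a p by (metis (no_types, lifting) A_dual_def Ints_add mem_Collect_eq)
  also have "a 0 + of_int k / real p = of_int (k + \<lfloor>real p * a 0\<rfloor>) / real p"
  proof -
    obtain z where z: "real p * a 0 = of_int z" using A_dual_scaled[OF a] by (elim Ints_cases)
    then have "a 0 = of_int z / real p" using p by (simp add: field_simps)
    then show ?thesis using p by (simp add: add_divide_distrib)
  qed
  finally show ?thesis using p by (simp only: divide_in_Ints_iff)
qed

text \<open>A single coordinate determines the coset, because all coordinates are congruent to -k/p
  modulo the integers. This gives the \<open>THE\<close> in \<open>R_quot\<close> an explicit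
  value.\<close>

lemma R_quot_eq:
  assumes i: "i < t" and a: "x i \<in> A_dual p" and p: "p > 0"
  shows "R_quot p t x i = (- \<lfloor>real p * x i 0\<rfloor>) mod int p"
proof -
  have "(k \<in> {0..<int p} \<and> x i - fund_weight p (nat k) \<in> A_lattice p) \<longleftrightarrow> k = (- \<lfloor>real p * x i 0\<rfloor>) mod int p" for k
  proof (cases "k \<in> {0..<int p}")
    case True
    then have k: "k = int (nat k)" "nat k < p" by auto
    have rk: "real (nat k) = of_int k" using True by simp
    have "x i - fund_weight p (nat k) \<in> A_lattice p \<longleftrightarrow> (\<forall>l<p. x i l + of_int k / real p \<in> \<int>)"
      using a k(2) by (subst fund_weight_coset) (simp_all add: A_dual_def rk)
    also have "\<dots> \<longleftrightarrow> int p dvd k + \<lfloor>real p * x i 0\<rfloor>" using a p by (rule A_dual_coset_iff)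
    also have "\<dots> \<longleftrightarrow> k mod int p = (- \<lfloor>real p * x i 0\<rfloor>) mod int p"
      by (simp add: mod_eq_dvd_iff)
    also have "k mod int p = k" using True by simp
    finally show ?thesis using True by blast
  qed (use p in auto)
  then show ?thesis using i by (simp add: R_quot_def)
qed

lemma R_quot_props:
  assumes i: "i < t" and a: "x i \<in> A_dual p" and p: "p > 0"
  shows "R_quot p t x i \<in> {0..<int p}" "l < p \<Longrightarrow> x i l + of_int (R_quot p t x i) / real p \<in> \<int>"
proof -
  show "R_quot p t x i \<in> {0..<int p}" using p by (simp add: R_quot_eq[where x = x, OF assms])
  have "int p dvd R_quot p t x i + \<lfloor>real p * x i 0\<rfloor>"
    unfolding R_quot_eq[where x = x, OF assms] by (simp add: mod_eq_dvd_iff[symmetric] dvd_eq_mod_eq_0 mod_add_left_eq)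
  then show "l < p \<Longrightarrow> x i l + of_int (R_quot p t x i) / real p \<in> \<int>"
    using A_dual_coset_iff[OF a p] by blast
qed

lemma R_quot_cong:
  assumes "\<And>i. i < t \<Longrightarrow> x i \<in> A_dual p" "\<And>i. i < t \<Longrightarrow> y i \<in> A_dual p" "p > 0"
    and eq: "R_quot p t x = R_quot p t y" and i: "i < t"
  shows "x i - y i \<in> A_lattice p"
proof -
  define k where "k = real_of_int (R_quot p t x i) / real p"
  have "x i l - y i l \<in> \<int>" for l
  proof (cases "l < p")
    case True
    have "x i l - y i l = (x i l + k) - (y i l + k)" by simp
    then show ?thesis
      using R_quot_props(2)[where x = x, OF i assms(1)[OF i] assms(3) True] R_quot_props(2)[where x = y, OF i assms(2)[OF i] assms(3) True] eq
      by (metis k_def Ints_diff)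
  qed (use assms(1,2)[OF i] in \<open>auto simp: A_dual_def A_space_def\<close>)
  then show ?thesis using assms(1,2)[OF i] by (auto simp: A_lattice_def A_dual_def A_space_def sum_subtractf)
qed

text \<open>Adding the constants k/p and k'/p makes all coordinates integral. The mixed terms vanish
  because coordinates sum to zero, and the constants leave p (k/p) (k'/p).\<close>

lemma A_dual_inner:
  assumes "a \<in> A_space p" "b \<in> A_space p" "p > 0"
    and "\<And>l. l < p \<Longrightarrow> a l + of_int k / real p \<in> \<int>" "\<And>l. l < p \<Longrightarrow> b l + of_int k' / real p \<in> \<int>"
  shows "(\<Sum>l<p. a l * b l) + of_int (k * k') / real p \<in> \<int>"
proof -
  have "(\<Sum>l<p. (a l + c) * (b l + d)) = (\<Sum>l<p. a l * b l) + d * (\<Sum>l<p. a l) + c * (\<Sum>l<p. b l) + real p * (c * d)" for c d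
    by (simp add: algebra_simps sum.distrib sum_distrib_left)
  then have "(\<Sum>l<p. (a l + of_int k / real p) * (b l + of_int k' / real p)) =
     (\<Sum>l<p. a l * b l) + of_int k' / real p * (\<Sum>l<p. a l) + of_int k / real p * (\<Sum>l<p. b l) + real p * (of_int k / real p * (of_int k' / real p))"
    by blast
  also have "\<dots> = (\<Sum>l<p. a l * b l) + of_int (k * k') / real p"
    using assms by (simp add: A_space_def)
  finally show ?thesis using assms(4,5) by (metis (no_types, lifting) Ints_mult Ints_sum lessThan_iff)
qed

text \<open>Going back \<open>n\<close> places is written as going forward
  \<open>n * (p - 1)\<close> places, which avoids truncated subtraction.\<close>

lemma cyc_shift_funpow:
  assumes "p > 0" "\<And>l. l \<ge> p \<Longrightarrow> a l = 0"
  shows "(cyc_shift p ^^ n) a l = (if l < p then a ((l + n * (p - 1)) mod p) else 0)"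
proof (induction n arbitrary: l)
  case (Suc n)
  have "((l + p - 1) mod p + n * (p - 1)) mod p = (l + Suc n * (p - 1)) mod p"
    using assms(1) by (cases p) (simp_all add: mod_simps add_ac)
  then show ?case using Suc assms(1) by (simp add: cyc_shift_def)
qed (use assms in auto)

lemma R_dual_A_dual:
  assumes x: "x \<in> R_dual p t" and i: "i < t"
  shows "x i \<in> A_dual p"
proof -
  have A: "x i \<in> A_space p" using x i by (auto simp: R_dual_def)
  have "x i l - x i 0 \<in> \<int>" if l: "l < p" for l
  proof (cases "l = 0")
    case False
    define y where "y = (\<lambda>i'. if i' = i then std_basis l - std_basis 0 else 0)"
    have "(std_basis l - std_basis 0) \<in> A_lattice p"
      using l False by (auto simp: A_lattice_def A_space_def std_basis_def sum_subtractf sum.delta)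
    then have "y \<in> R_lattice p t"
      using i by (auto simp: R_lattice_def y_def A_lattice_def A_space_def)
    then have "block_inner p t x y \<in> \<int>" using x by (auto simp: R_dual_def)
    also have "block_inner p t x y = (\<Sum>i'<t. if i' = i then \<Sum>j<p. x i j * y i j else 0)"
      unfolding block_inner_def by (intro sum.cong refl) (auto simp: y_def)
    also have "\<dots> = (\<Sum>j<p. x i j * y i j)" using i by (simp add: sum.delta)
    also have "\<dots> = (\<Sum>j<p. (if j = l then x i j else 0) - (if j = 0 then x i j else 0))"
      using False by (intro sum.cong refl) (auto simp: y_def std_basis_def)
    also have "\<dots> = x i l - x i 0" using l by (simp add: sum_subtractf sum.delta)
    finally show ?thesis .
  qed simp
  with A show ?thesis by (simp add: A_dual_def)
qed

lemma independent_if_separated: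
  fixes B :: "'a::euclidean_space set"
  assumes "\<And>b. b \<in> B \<Longrightarrow> \<exists>w. w \<bullet> b \<noteq> 0 \<and> (\<forall>b'\<in>B - {b}. w \<bullet> b' = 0)"
  shows "independent B"
proof
  assume "dependent B"
  then obtain b where b: "b \<in> B" "b \<in> span (B - {b})" by (auto simp: dependent_def)
  obtain w where w: "w \<bullet> b \<noteq> 0" "\<forall>b'\<in>B - {b}. w \<bullet> b' = 0" using assms[OF b(1)] by blast
  have "span (B - {b}) \<subseteq> {x. w \<bullet> x = 0}"
    using w(2) by (intro span_minimal subspace_hyperplane) auto
  then show False using b w by auto
qed

text \<open>The blocks span the whole space. Stating this through the projection makes the
  coordinate map an isometry at once.\<close>

locale full_blocks = affine_blocks +
  assumes expand_id: "expand x = x"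
begin

definition coord :: "'a \<Rightarrow> nat \<Rightarrow> nat \<Rightarrow> real" where
  "coord x = (\<lambda>i l. if i < t \<and> l < p then x \<bullet> v i l else 0)"

lemma coord_add: "coord (x + y) = coord x + coord y"
  by (auto simp: coord_def fun_eq_iff inner_add_left)

lemma block_inner_coord: "block_inner p t (coord x) (coord y) = x \<bullet> y"
proof -
  have "block_inner p t (coord x) (coord y) = expand x \<bullet> y"
    by (simp add: block_inner_def coord_def expand_def inner_sum_left inner_commute[of y])
  then show ?thesis by (simp add: expand_id)
qed

lemma coord_inj: "coord x = coord y \<Longrightarrow> x = y"
proof -
  assume eq: "coord x = coord y"
  have "x \<bullet> z = y \<bullet> z" for z using block_inner_coord[of x z] block_inner_coord[of y z] eq by simp
  then show "x = y" by (metis vector_eq_rdot)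
qed

lemma coord_A_dual:
  assumes "\<And>l. x \<bullet> \<beta> i l \<in> \<int>" "i < t"
  shows "coord x i \<in> A_dual p"
proof -
  have "(\<Sum>l<p. x \<bullet> v i l) = 0"
    using v_sum_zero[OF assms(2)] by (simp flip: inner_sum_right)
  then show ?thesis
    using inner_v_diff_Ints[OF assms(2,1)] assms(2) p0
    by (simp add: A_dual_def A_space_def coord_def)
qed

lemma height_coord: "block_inner p t (coord x) (chi p t) = h x"
proof -
  have "(\<Sum>l<p. coord x i l * chi p t i l) = - (1 / real p) * (\<Sum>l<p. real l * (x \<bullet> v i l))" if "i < t" for i
  proof -
    have 0: "(\<Sum>l<p. x \<bullet> v i l) = 0" using v_sum_zero[OF that] by (simp flip: inner_sum_right)
    have "(\<Sum>l<p. coord x i l * chi p t i l) =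
      (\<Sum>l<p. (real p - 1) / (2 * real p) * (x \<bullet> v i l) + - (1 / real p) * (real l * (x \<bullet> v i l)))"
      using that p0 by (intro sum.cong refl) (simp add: coord_def chi_def weyl_vector_def field_simps)
    also have "\<dots> = (real p - 1) / (2 * real p) * (\<Sum>l<p. x \<bullet> v i l) + - (1 / real p) * (\<Sum>l<p. real l * (x \<bullet> v i l))"
      by (simp only: sum.distrib sum_distrib_left)
    finally show ?thesis by (simp add: 0)
  qed
  then show ?thesis by (simp add: block_inner_def height_def sum_distrib_left)
qed

lemma coord_\<beta>:
  assumes "i < t" "Suc m < p"
  shows "coord (\<beta> i m) = (\<lambda>i'. if i' = i then std_basis m - std_basis (Suc m) else 0)"
proof (rule ext, rule ext)
  fix i' l
  show "coord (\<beta> i m) i' l = (if i' = i then std_basis m - std_basis (Suc m) else 0) l"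
    using assms v_inner[of i' i l m] by (auto simp: coord_def std_basis_def inner_commute)
qed

text \<open>By \<open>abel\<close> this is the coefficient of \<open>x\<close> at the root
  \<open>\<beta> i l\<close>; it vanishes at the last root of a block.\<close>

definition part where "part x i l = (\<Sum>m\<le>l. x \<bullet> v i m)"

lemma \<beta>_expand: "x = (\<Sum>i<t. \<Sum>l<p. part x i l *\<^sub>R \<beta> i l)"
proof -
  have "(\<Sum>l<p. (x \<bullet> v i l) *\<^sub>R v i l) = (\<Sum>l<p. part x i l *\<^sub>R \<beta> i l)" if "i < t" for i
    using abel[OF that, of "\<lambda>l. x \<bullet> v i l"] v_sum_zero[OF that]
    by (simp add: part_def flip: inner_sum_right)
  then have "expand x = (\<Sum>i<t. \<Sum>l<p. part x i l *\<^sub>R \<beta> i l)" by (simp add: expand_def)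
  then show ?thesis by (simp add: expand_id)
qed

lemma part_last: "i < t \<Longrightarrow> part x i (p - 1) = 0"
proof -
  assume i: "i < t"
  have "{..p - 1} = {..<p}" using p0 by auto
  then show ?thesis using v_sum_zero[OF i] by (simp add: part_def flip: inner_sum_right)
qed

lemma \<beta>_expand': "x = (\<Sum>i<t. \<Sum>l<p-1. part x i l *\<^sub>R \<beta> i l)"
proof -
  have "(\<Sum>l<p. part x i l *\<^sub>R \<beta> i l) = (\<Sum>l<p-1. part x i l *\<^sub>R \<beta> i l)" if "i < t" for i
    using p0 part_last[OF that, of x] by (cases p) auto
  then have "(\<Sum>i<t. \<Sum>l<p. part x i l *\<^sub>R \<beta> i l) = (\<Sum>i<t. \<Sum>l<p-1. part x i l *\<^sub>R \<beta> i l)"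
    by simp
  with \<beta>_expand[of x] show ?thesis by (rule trans)
qed

text \<open>The Weyl vector is a positive combination of the simple roots; this is the pairing of that
  identity with \<open>x\<close>.\<close>

lemma height_inner: "real p * h x = (\<Sum>i<t. \<Sum>l<p. (real l + 1) * (real p - 1 - real l) / 2 * (x \<bullet> \<beta> i l))"
proof -
  have partial: "(\<Sum>m\<le>l. (real p - 1) / 2 - real m) = (real l + 1) * (real p - 1 - real l) / 2" for l
    by (induction l) (simp_all add: field_simps)
  have "(\<Sum>l<p. (real p - 1) / 2 - real l) = 0"
    using partial[of "p - 1"] p0 lessThan_Suc_atMost[of "p - 1"] by (simp add: of_nat_diff)
  then have eq': "(\<Sum>l<p. ((real p - 1) / 2 - real l) *\<^sub>R v i l) = (\<Sum>l<p. ((real l + 1) * (real p - 1 - real l) / 2) *\<^sub>R \<beta> i l)"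
    if "i < t" for i
    using abel[OF that, of "\<lambda>l. (real p - 1) / 2 - real l"] by (simp only: partial)
  then have eq: "(\<Sum>l<p. ((real p - 1) / 2 - real l) * (x \<bullet> v i l)) = (\<Sum>l<p. (real l + 1) * (real p - 1 - real l) / 2 * (x \<bullet> \<beta> i l))"
    if "i < t" for i
  proof -
    have "x \<bullet> (\<Sum>l<p. ((real p - 1) / 2 - real l) *\<^sub>R v i l) =
      x \<bullet> (\<Sum>l<p. ((real l + 1) * (real p - 1 - real l) / 2) *\<^sub>R \<beta> i l)"
      using that by (simp only: eq')
    then show ?thesis by (simp only: inner_sum_right inner_scaleR_right)
  qed
  have "(\<Sum>l<p. ((real p - 1) / 2 - real l) * (x \<bullet> v i l)) = - (\<Sum>l<p. real l * (x \<bullet> v i l))" if "i < t" for i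
  proof -
    have 0: "(\<Sum>l<p. x \<bullet> v i l) = 0" using v_sum_zero[OF that] by (simp flip: inner_sum_right)
    show ?thesis
      by (simp only: left_diff_distrib sum_subtractf sum_distrib_left[symmetric] 0)
  qed
  note neg = this
  have "real p * h x = (\<Sum>i<t. - (\<Sum>l<p. real l * (x \<bullet> v i l)))"
    using p0 by (simp add: height_def sum_negf)
  also have "\<dots> = (\<Sum>i<t. \<Sum>l<p. (real l + 1) * (real p - 1 - real l) / 2 * (x \<bullet> \<beta> i l))"
    by (intro sum.cong refl, subst eq[symmetric]) (auto simp only: neg lessThan_iff)
  finally show ?thesis .
qed

definition \<Delta> where "\<Delta> = (\<lambda>(i, l). \<beta> i l) ` ({..<t} \<times> {..<p - 1})"

text \<open>Partial sums of the \<open>v i m\<close> are the fundamental weights. Their duality to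
  the simple roots shows that the roots in \<open>\<Delta>\<close> are distinct and
  independent.\<close>

lemma fundamental_dual:
  assumes "i < t" "i' < t" "k < p - 1" "l < p - 1"
  shows "(\<Sum>m\<le>k. v i m) \<bullet> \<beta> i' l = of_bool (i = i' \<and> k = l)"
proof (cases "i = i'")
  case True
  have "(\<Sum>m\<le>k. v i m) \<bullet> \<beta> i' l = (\<Sum>m\<le>k. of_bool (m = l) - of_bool (m = Suc l))"
    unfolding inner_sum_left using assms True by (intro sum.cong refl) (auto simp: v_inner)
  also have "\<dots> = (\<Sum>m\<le>k. if m = l then 1 else 0) - (\<Sum>m\<le>k. if m = Suc l then 1 else 0)"
    unfolding sum_subtractf[symmetric] by (intro sum.cong) auto
  also have "\<dots> = of_bool (i = i' \<and> k = l)"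
    using True by (auto simp: sum.delta)
  finally show ?thesis .
qed (use assms in \<open>simp add: inner_sum_left v_inner_neq\<close>)

lemma \<Delta>_inj: "inj_on (\<lambda>(i, l). \<beta> i l) ({..<t} \<times> {..<p - 1})"
proof (rule inj_onI)
  fix a b
  assume *: "a \<in> {..<t} \<times> {..<p - 1}" "b \<in> {..<t} \<times> {..<p - 1}" "(case a of (i, l) \<Rightarrow> \<beta> i l) = (case b of (i, l) \<Rightarrow> \<beta> i l)"
  obtain i l i' l' where ab: "a = (i, l)" "b = (i', l')" by (metis surj_pair)
  have "(\<Sum>m\<le>l. v i m) \<bullet> \<beta> i' l' = 1"
    using * ab fundamental_dual[of i i l l] by simp
  then show "a = b" using * ab fundamental_dual[of i i' l l'] by (auto split: if_splits)
qed

lemma \<Delta>_independent: "independent \<Delta>"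
proof (rule independent_if_separated)
  fix b assume "b \<in> \<Delta>"
  then obtain i l where b: "b = \<beta> i l" "i < t" "l < p - 1" by (auto simp: \<Delta>_def)
  have "(\<Sum>m\<le>l. v i m) \<bullet> b' = 0" if b': "b' \<in> \<Delta> - {b}" for b'
  proof -
    obtain i' l' where "b' = \<beta> i' l'" "i' < t" "l' < p - 1" using b' by (auto simp: \<Delta>_def)
    then show ?thesis using b' b fundamental_dual[of i i' l l'] by auto
  qed
  moreover have "(\<Sum>m\<le>l. v i m) \<bullet> b \<noteq> 0" using fundamental_dual[of i i l l] b by simp
  ultimately show "\<exists>w. w \<bullet> b \<noteq> 0 \<and> (\<forall>b'\<in>\<Delta> - {b}. w \<bullet> b' = 0)" by blast
qed

lemma rank_eq: "t * (p - 1) = DIM('a)"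
proof -
  have "(\<Sum>i<t. \<Sum>l<p-1. part x i l *\<^sub>R \<beta> i l) \<in> span \<Delta>" for x
    by (intro span_sum span_scale span_base) (auto simp: \<Delta>_def)
  then have "x \<in> span \<Delta>" for x by (metis \<beta>_expand')
  then have "span \<Delta> = UNIV" by auto
  then have "card \<Delta> = DIM('a)"
    using dim_span_eq_card_independent[OF \<Delta>_independent] by simp
  moreover have "card \<Delta> = t * (p - 1)"
    using \<Delta>_inj by (simp add: \<Delta>_def card_image card_cartesian_product)
  ultimately show ?thesis by simp
qed

lemma coord_\<Delta>: "coord ` \<Delta> = R_base p t"
proof -
  have "R_base p t = {coord (\<beta> i l) | i l. i < t \<and> Suc l < p}"
    unfolding R_base_def using coord_\<beta> by (metis (no_types, lifting))
  also have "\<dots> = (\<lambda>(i, l). coord (\<beta> i l)) ` ({..<t} \<times> {..<p - 1})"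
    unfolding image_def by (force simp: less_diff_conv)
  finally show ?thesis by (simp add: \<Delta>_def image_image case_prod_unfold)
qed

end

locale lattice_blocks = full_blocks p t \<beta> + L: int_module L
  for p t and \<beta> :: "nat \<Rightarrow> nat \<Rightarrow> 'a::euclidean_space" and L :: "'a set" +
  fixes N :: "'a set" and lam :: 'a
  assumes prime: "prime p" and t0: "t > 0"
    and N_eq: "N = {of_int n *\<^sub>R lam + x | n x. x \<in> L}"
    and \<beta>_lam: "i < t \<Longrightarrow> \<beta> i l - lam \<in> L"
    and order: "of_int n *\<^sub>R lam \<in> L \<longleftrightarrow> int p dvd n"
    and integral: "x \<in> N \<Longrightarrow> y \<in> N \<Longrightarrow> x \<bullet> y \<in> \<int>"
    and no_root: "x \<in> L \<Longrightarrow> x \<bullet> x \<noteq> 2"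
begin

lemma L_N: "x \<in> L \<Longrightarrow> x \<in> N"
  unfolding N_eq by (intro CollectI exI[of _ 0] exI[of _ x]) simp

lemma N_span: "N = int_span (insert lam L)"
  by (simp add: N_eq int_span_insert L.int_module_axioms)

sublocale N: int_module N
  unfolding N_span by (rule int_module_int_span)

lemma \<beta>_N:
  assumes "i < t" shows "\<beta> i l \<in> N"
proof -
  have "\<beta> i l = of_int 1 *\<^sub>R lam + (\<beta> i l - lam)" by simp
  then show ?thesis unfolding N_eq using \<beta>_lam[OF assms, of l] by blast
qed

lemma inner_\<beta>_Ints: "x \<in> N \<Longrightarrow> i < t \<Longrightarrow> x \<bullet> \<beta> i l \<in> \<int>"
  using integral \<beta>_N by blast

text \<open>Every \<open>\<beta> i l\<close> is congruent to \<open>lam\<close> modulo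
  \<open>L\<close>, so only the sum of the coefficients matters, and \<open>lam\<close> has order
  \<open>p\<close>.\<close>

lemma combination_L_iff:
  assumes "\<And>i l. i < t \<Longrightarrow> l < p \<Longrightarrow> of_int (s i l) = c i l"
  shows "(\<Sum>i<t. \<Sum>l<p. c i l *\<^sub>R \<beta> i l) \<in> L \<longleftrightarrow> int p dvd (\<Sum>i<t. \<Sum>l<p. s i l)"
proof -
  let ?x = "\<Sum>i<t. \<Sum>l<p. c i l *\<^sub>R \<beta> i l" and ?n = "\<Sum>i<t. \<Sum>l<p. s i l"
  have "?x - of_int ?n *\<^sub>R lam = (\<Sum>i<t. \<Sum>l<p. of_int (s i l) *\<^sub>R (\<beta> i l - lam))"
    using assms by (simp add: scaleR_sum_left sum_subtractf scaleR_diff_right)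
  also have "\<dots> \<in> L" by (intro L.sum L.scale_int \<beta>_lam) auto
  finally have d: "?x - of_int ?n *\<^sub>R lam \<in> L" .
  have "?x \<in> L \<longleftrightarrow> of_int ?n *\<^sub>R lam \<in> L"
    using L.diff[OF _ d, of ?x] L.add[OF d, of "of_int ?n *\<^sub>R lam"] by auto
  then show ?thesis by (simp only: order)
qed

text \<open>Modulo \<open>p\<close>, the integer \<open>p\<close> times the height depends on
  \<open>L\<close> only on the code word. It is thus a combination of the coordinates of the word,
  and shifting the blocks by its coefficients subtracts precisely this combination.\<close>

lemma exists_shift:
  assumes odd: "odd p"
  shows "\<exists>c. \<forall>x\<in>L. height p t (\<lambda>i l. \<beta> i (l + c i)) x \<in> \<int>"
proof -
  \<comment> \<open>Modulo \<open>p\<close> this is minus coordinate \<open>i\<close> of the code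
    word of \<open>x\<close>.\<close>
  define \<kappa> where "\<kappa> i x = (if i < t then \<lfloor>real p * (x \<bullet> v i 0)\<rfloor> else 0)" for i x
  have \<kappa>: "of_int (\<kappa> i x) = real p * (x \<bullet> v i 0)" if "x \<in> L" "i < t" for x i
  proof -
    have "real p * (x \<bullet> v i 0) \<in> \<int>"
      using that by (intro inner_v_scaled_Ints inner_\<beta>_Ints L_N)
    then show ?thesis using that by (simp add: \<kappa>_def)
  qed
  define F where "F x = \<lfloor>real p * h x\<rfloor>" for x
  have F: "of_int (F x) = real p * h x" if x: "x \<in> L" for x
  proof -
    have "real p * h x = - (\<Sum>i<t. \<Sum>l<p. real l * (x \<bullet> v i l))" using p0 by (simp add: height_def)
    moreover have "(\<Sum>l<p. real l * (x \<bullet> v i l)) \<in> \<int>" if i: "i < t" for i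
    proof -
      \<comment> \<open>Here \<open>p\<close> must be odd: the weights 0, ..., p - 1 add up to
        \<open>p\<close> times the integer (p - 1) / 2.\<close>
      have sum: "(\<Sum>l<p. real l) = real p * of_int ((int p - 1) div 2)"
      proof -
        have "2 * (\<Sum>l<p. real l) = real p * (real p - 1)" by (induction p) (simp_all add: algebra_simps)
        moreover have "real p - 1 = 2 * of_int ((int p - 1) div 2)"
          using odd by (auto elim!: oddE)
        ultimately show ?thesis by simp
      qed
      have "(\<Sum>l<p. real l * (x \<bullet> v i l)) = (\<Sum>l<p. real l * (x \<bullet> v i l - x \<bullet> v i 0)) + (\<Sum>l<p. real l) * (x \<bullet> v i 0)"
        by (simp add: right_diff_distrib sum_subtractf sum_distrib_right)
      also have "(\<Sum>l<p. real l) * (x \<bullet> v i 0) = of_int ((int p - 1) div 2) * of_int (\<kappa> i x)"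
        unfolding sum \<kappa>[OF x i] by simp
      finally show ?thesis
        using inner_v_diff_Ints[OF i] inner_\<beta>_Ints[OF L_N[OF x] i] by (auto intro!: Ints_add Ints_sum Ints_mult)
    qed
    ultimately have "real p * h x \<in> \<int>" by auto
    then show ?thesis by (simp add: F_def)
  qed
  have "\<exists>c :: nat \<Rightarrow> nat. \<forall>x\<in>L. int p dvd F x - (\<Sum>i<t. int (c i) * \<kappa> i x)"
  proof (rule functional_extension[OF prime L.int_module_axioms])
    fix x y n assume x: "x \<in> L"
    have "real_of_int (F (of_int n *\<^sub>R x)) = of_int (n * F x)"
      using x by (simp add: F L.scale_int height_scale)
    then show "F (of_int n *\<^sub>R x) = n * F x" by (simp only: of_int_eq_iff)
    show "\<kappa> i (of_int n *\<^sub>R x) = n * \<kappa> i x" for i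
    proof (cases "i < t")
      case True
      have "real_of_int (\<kappa> i (of_int n *\<^sub>R x)) = of_int (n * \<kappa> i x)"
        using x True by (simp add: \<kappa> L.scale_int)
      then show ?thesis by (simp only: of_int_eq_iff)
    qed (simp add: \<kappa>_def)
    assume y: "y \<in> L"
    have "real_of_int (F (x + y)) = of_int (F x + F y)"
      using x y by (simp add: F L.add height_add distrib_left)
    then show "F (x + y) = F x + F y" by (simp only: of_int_eq_iff)
    show "\<kappa> i (x + y) = \<kappa> i x + \<kappa> i y" for i
    proof (cases "i < t")
      case True
      have "real_of_int (\<kappa> i (x + y)) = of_int (\<kappa> i x + \<kappa> i y)"
        using x y True by (simp add: \<kappa> L.add inner_add_left distrib_left)
      then show ?thesis by (simp only: of_int_eq_iff)
    qed (simp add: \<kappa>_def)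
  next
    \<comment> \<open>With zero code word \<open>x\<close> has integral coordinates, hence integral
      coefficients at the roots. Their sum is divisible by \<open>p\<close> because \<open>x\<close>
      lies in \<open>L\<close>, and each root has height 1/p modulo the integers.\<close>
    fix x assume x: "x \<in> L" and ker: "\<forall>i<t. int p dvd \<kappa> i x"
    have "x \<bullet> v i l \<in> \<int>" if i: "i < t" for i l
    proof -
      have "of_int (\<kappa> i x) / real p \<in> \<int>" using ker i p0 by (simp add: divide_in_Ints_iff)
      then have "x \<bullet> v i 0 \<in> \<int>" using \<kappa>[OF x i] p0 by simp
      moreover have "x \<bullet> v i l - x \<bullet> v i 0 \<in> \<int>"
        using i x by (intro inner_v_diff_Ints inner_\<beta>_Ints L_N)
      ultimately show ?thesis using Ints_add[of "x \<bullet> v i l - x \<bullet> v i 0" "x \<bullet> v i 0"] by simp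
    qed
    then have part: "of_int \<lfloor>part x i l\<rfloor> = part x i l" if "i < t" for i l
      using that by (simp add: part_def Ints_sum)
    define s where "s i l = \<lfloor>part x i l\<rfloor>" for i l
    have s: "of_int (s i l) = part x i l" if "i < t" for i l using part[OF that] by (simp add: s_def)
    have "int p dvd (\<Sum>i<t. \<Sum>l<p. s i l)"
      using combination_L_iff[of s "part x"] s x by (simp flip: \<beta>_expand)
    then have d: "of_int (\<Sum>i<t. \<Sum>l<p. s i l) / real p \<in> \<int>" using p0 by (simp only: divide_in_Ints_iff)
    have "h x = h (\<Sum>i<t. \<Sum>l<p. part x i l *\<^sub>R \<beta> i l)" by (rule arg_cong[OF \<beta>_expand])
    also have "\<dots> = (\<Sum>i<t. \<Sum>l<p. part x i l * h (\<beta> i l))"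
      by (simp add: height_sum height_scale)
    also have "\<dots> = (\<Sum>i<t. \<Sum>l<p. of_int (s i l) * (1 / real p) - of_int (s i l) * of_bool (Suc l = p))"
      by (intro sum.cong refl) (simp add: s height_\<beta> right_diff_distrib)
    also have "\<dots> = of_int (\<Sum>i<t. \<Sum>l<p. s i l) / real p - (\<Sum>i<t. \<Sum>l<p. of_int (s i l) * of_bool (Suc l = p))"
      by (simp add: sum_subtractf sum_divide_distrib)
    also have "\<dots> \<in> \<int>" using d by (intro Ints_diff Ints_sum Ints_mult) auto
    finally have "of_int (F x) / real p \<in> \<int>" using F[OF x] p0 by simp
    then show "int p dvd F x" using p0 by (simp only: divide_in_Ints_iff)
  qed
  then obtain c :: "nat \<Rightarrow> nat" where c: "\<And>x. x \<in> L \<Longrightarrow> int p dvd F x - (\<Sum>i<t. int (c i) * \<kappa> i x)" by blast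
  have "height p t (\<lambda>i l. \<beta> i (l + c i)) x \<in> \<int>" if x: "x \<in> L" for x
  proof -
    \<comment> \<open>The \<open>c i\<close> coordinates passed over agree modulo the integers, so
      each of them may be replaced by the first.\<close>
    have sum_c: "(\<Sum>m<c i. x \<bullet> v i m) = of_int (int (c i) * \<kappa> i x) / real p + (\<Sum>m<c i. x \<bullet> v i m - x \<bullet> v i 0)" if "i < t" for i
    proof -
      have "of_int (int (c i) * \<kappa> i x) / real p = real (c i) * (x \<bullet> v i 0)"
        using \<kappa>[OF x that] p0 by (simp only: of_int_mult of_int_of_nat_eq) simp
      moreover have "(\<Sum>m<c i. x \<bullet> v i m - x \<bullet> v i 0) = (\<Sum>m<c i. x \<bullet> v i m) - real (c i) * (x \<bullet> v i 0)"
        by (simp add: sum_subtractf)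
      ultimately show ?thesis by linarith
    qed
    have "(\<Sum>i<t. \<Sum>m<c i. x \<bullet> v i m) =
      (\<Sum>i<t. of_int (int (c i) * \<kappa> i x) / real p + (\<Sum>m<c i. x \<bullet> v i m - x \<bullet> v i 0))"
      by (rule sum.cong[OF refl], rule sum_c) simp
    also have "\<dots> = of_int (\<Sum>i<t. int (c i) * \<kappa> i x) / real p + (\<Sum>i<t. \<Sum>m<c i. x \<bullet> v i m - x \<bullet> v i 0)"
      by (simp only: sum.distrib sum_divide_distrib of_int_sum)
    finally have shift: "height p t (\<lambda>i l. \<beta> i (l + c i)) x = h x -
      (of_int (\<Sum>i<t. int (c i) * \<kappa> i x) / real p + (\<Sum>i<t. \<Sum>m<c i. x \<bullet> v i m - x \<bullet> v i 0))"
      by (simp only: height_shift)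
    have "h x = of_int (F x) / real p" using F[OF x] p0 by simp
    then have "height p t (\<lambda>i l. \<beta> i (l + c i)) x =
      of_int (F x - (\<Sum>i<t. int (c i) * \<kappa> i x)) / real p - (\<Sum>i<t. \<Sum>m<c i. x \<bullet> v i m - x \<bullet> v i 0)"
      by (simp only: shift of_int_diff diff_divide_distrib diff_diff_eq)
    moreover have "of_int (F x - (\<Sum>i<t. int (c i) * \<kappa> i x)) / real p \<in> \<int>"
      using c[OF x] p0 by (simp only: divide_in_Ints_iff)
    moreover have "(\<Sum>i<t. \<Sum>m<c i. x \<bullet> v i m - x \<bullet> v i 0) \<in> \<int>"
      using x by (intro Ints_sum inner_v_diff_Ints inner_\<beta>_Ints L_N) auto
    ultimately show ?thesis by (simp only: Ints_diff)
  qed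
  then show ?thesis by blast
qed

end

section \<open>Constructions A and B\<close>

lemma R_quot_restrict: "R_quot p t x \<in> extensional {..<t}"
  by (simp add: R_quot_def)

locale cyclic_blocks = lattice_blocks +
  fixes g :: "'a \<Rightarrow> 'a" and e :: "nat \<Rightarrow> nat"
  assumes height_Ints: "x \<in> L \<Longrightarrow> h x \<in> \<int>"
    and g_linear: "linear g" and g_inner: "g x \<bullet> g y = x \<bullet> y"
    and g_\<beta>: "i < t \<Longrightarrow> g (\<beta> i l) = \<beta> i (l + e i)"
    and e_range: "i < t \<Longrightarrow> 0 < e i \<and> e i < p"
    and g_N: "x \<in> N \<Longrightarrow> g x \<in> N" and g_diff: "x \<in> N \<Longrightarrow> x - g x \<in> L"
begin

text \<open>The root \<open>\<beta> 0 0\<close> generates N/L as well as \<open>lam\<close> does,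
  and its height is known.\<close>

lemma decompose:
  assumes "x \<in> N"
  obtains n y where "x = of_int n *\<^sub>R \<beta> 0 0 + y" "y \<in> L"
proof -
  obtain n y where x: "x = of_int n *\<^sub>R lam + y" "y \<in> L" using assms by (auto simp: N_eq)
  have "of_int n *\<^sub>R (\<beta> 0 0 - lam) \<in> L" using \<beta>_lam t0 by (intro L.scale_int)
  then have "y - of_int n *\<^sub>R (\<beta> 0 0 - lam) \<in> L" using x(2) by (simp add: L.diff)
  moreover have "x = of_int n *\<^sub>R \<beta> 0 0 + (y - of_int n *\<^sub>R (\<beta> 0 0 - lam))"
    by (simp add: x(1) scaleR_diff_right)
  ultimately show thesis using that by blast
qed

lemma height_decompose:
  "h (of_int n *\<^sub>R \<beta> 0 0 + y) = of_int n / real p + h y"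
  using p3 t0 by (simp add: height_add height_scale height_\<beta>)

text \<open>Modulo the integers a multiple \<open>n\<close> of \<open>\<beta> 0 0\<close> plus a
  vector of \<open>L\<close> has height n/p, and this is integral only for multiples of
  \<open>p\<close>.\<close>

lemma height_Ints_iff:
  assumes "x \<in> N"
  shows "h x \<in> \<int> \<longleftrightarrow> x \<in> L"
proof
  assume hx: "h x \<in> \<int>"
  obtain n y where x: "x = of_int n *\<^sub>R \<beta> 0 0 + y" "y \<in> L" using assms by (rule decompose)
  have "of_int n / real p = h x - h y" by (simp add: x(1) height_decompose)
  then have "of_int n / real p \<in> \<int>" using hx height_Ints[OF x(2)] by simp
  then have "of_int n *\<^sub>R lam \<in> L" using p0 by (simp add: divide_in_Ints_iff order)
  moreover have "of_int n *\<^sub>R (\<beta> 0 0 - lam) \<in> L" using \<beta>_lam t0 by (intro L.scale_int)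
  ultimately have "of_int n *\<^sub>R lam + of_int n *\<^sub>R (\<beta> 0 0 - lam) \<in> L" by (rule L.add)
  then show "x \<in> L" using x L.add by (simp add: scaleR_diff_right)
qed (rule height_Ints)

lemma height_scaled_Ints:
  assumes "x \<in> N"
  shows "real p * h x \<in> \<int>"
proof -
  obtain n y where x: "x = of_int n *\<^sub>R \<beta> 0 0 + y" "y \<in> L" using assms by (rule decompose)
  have "real p * h x = of_int n + real p * h y" using p0 by (simp add: x(1) height_decompose distrib_left)
  then show ?thesis using height_Ints[OF x(2)] by auto
qed

lemma \<beta>_norm: "i < t \<Longrightarrow> \<beta> i l \<bullet> \<beta> i l = 2"
proof -
  assume i: "i < t"
  have "\<not> [Suc l = l] (mod p)" "\<not> [l = Suc l] (mod p)"
    using p3 cong_add_lcancel_0_nat[of l 1 p] by (auto simp: cong_sym_eq cong_def)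
  then show ?thesis by (simp add: inner_eq[OF i])
qed

text \<open>Simple roots are subtracted one at a time. The weights in \<open>height_inner\<close>
  are not negative, so positive height yields a simple root of positive inner product. Subtracting
  it keeps the norm, unless zero is reached, and lowers the height by 1/p.\<close>

lemma positive_root:
  assumes "\<alpha> \<in> N" "\<alpha> \<bullet> \<alpha> = 2" "h \<alpha> > 0"
  shows "\<exists>c :: 'a \<Rightarrow> nat. \<alpha> = (\<Sum>\<delta>\<in>\<Delta>. of_nat (c \<delta>) *\<^sub>R \<delta>)"
  using assms
proof (induction "nat \<lfloor>real p * h \<alpha>\<rfloor>" arbitrary: \<alpha> rule: less_induct)
  case (less \<alpha>)
  have "real p * h \<alpha> > 0" using less.prems p0 by simp
  have "\<exists>i<t. \<exists>l<p. (real l + 1) * (real p - 1 - real l) / 2 * (\<alpha> \<bullet> \<beta> i l) > 0"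
  proof (rule ccontr)
    assume "\<not> (\<exists>i<t. \<exists>l<p. (real l + 1) * (real p - 1 - real l) / 2 * (\<alpha> \<bullet> \<beta> i l) > 0)"
    then have neg: "\<forall>i<t. \<forall>l<p. (real l + 1) * (real p - 1 - real l) / 2 * (\<alpha> \<bullet> \<beta> i l) \<le> 0"
      unfolding not_less[symmetric] by blast
    have "real p * h \<alpha> \<le> 0" unfolding height_inner by (rule sum_nonpos, rule sum_nonpos) (use neg in blast)
    with \<open>real p * h \<alpha> > 0\<close> show False by simp
  qed
  then obtain i l where il: "i < t" "l < p" and pos: "(real l + 1) * (real p - 1 - real l) / 2 * (\<alpha> \<bullet> \<beta> i l) > 0" by blast
  have "real p - 1 - real l \<ge> 0" using il by linarith
  then have "(real l + 1) * (real p - 1 - real l) / 2 \<ge> 0" by simp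
  with pos have ip: "\<alpha> \<bullet> \<beta> i l > 0" and "real p - 1 - real l \<noteq> 0" by (auto simp: zero_less_mult_iff)
  \<comment> \<open>The weight vanishes at \<open>l = p - 1\<close>, so the root found is not the
    omitted one.\<close>
  then have l: "l < p - 1" using il(2) by (cases "Suc l = p") auto
  let ?b = "\<beta> i l"
  have b: "?b \<in> \<Delta>" "?b \<in> N" "?b \<bullet> ?b = 2" using il l \<beta>_N \<beta>_norm by (auto simp: \<Delta>_def)
  have hb: "h ?b = 1 / real p" using il l by (simp add: height_\<beta>)
  have fin: "finite \<Delta>" by (simp add: \<Delta>_def)
  obtain k :: int where k: "\<alpha> \<bullet> ?b = of_int k" using integral[OF less.prems(1) b(2)] by (elim Ints_cases)
  have norm: "(\<alpha> - ?b) \<bullet> (\<alpha> - ?b) = 4 - 2 * of_int k"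
    using less.prems b by (simp add: inner_diff inner_commute k)
  show ?case
  proof (cases "k \<ge> 2")
    case True
    then have "(\<alpha> - ?b) \<bullet> (\<alpha> - ?b) \<le> 0" using norm by simp
    then have eq: "\<alpha> = ?b" by (metis antisym inner_eq_zero_iff inner_ge_zero right_minus_eq)
    have "?b = (\<Sum>\<delta>\<in>\<Delta>. of_nat (if \<delta> = ?b then 1 else 0) *\<^sub>R \<delta>)"
      using b fin by (simp add: if_distrib[of of_nat] if_distrib[of "\<lambda>c. c *\<^sub>R _"] sum.delta' cong: if_cong)
    then show ?thesis using eq by (intro exI[of _ "\<lambda>\<delta>. if \<delta> = ?b then 1 else 0"]) simp
  next
    case False
    then have "k = 1" using ip k by simp
    then have n2: "(\<alpha> - ?b) \<bullet> (\<alpha> - ?b) = 2" using norm by simp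
    have N: "\<alpha> - ?b \<in> N" using less.prems b N.diff by blast
    have "h (\<alpha> - ?b) = h \<alpha> + h ((-1) *\<^sub>R ?b)" using height_add[of \<alpha> "(-1) *\<^sub>R ?b"] by simp
    then have hd: "real p * h (\<alpha> - ?b) = real p * h \<alpha> - 1" using p0 by (simp only: height_scale hb) (simp add: right_diff_distrib)
    obtain z :: int where z: "real p * h \<alpha> = of_int z" using height_scaled_Ints[OF less.prems(1)] by (elim Ints_cases)
    have "z > 0" using z \<open>real p * h \<alpha> > 0\<close> by simp
    \<comment> \<open>Height 0 would put a vector of norm 2 into the rootless lattice
      \<open>L\<close>, so the descent cannot leave the positive side.\<close>
    have "h (\<alpha> - ?b) \<noteq> 0"
      using height_Ints_iff[OF N] no_root n2 by (metis Ints_0)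
    then have "real p * h (\<alpha> - ?b) \<noteq> 0" using p0 by simp
    then have "z \<noteq> 1" using hd z by auto
    then have "z - 1 > 0" using \<open>z > 0\<close> by simp
    moreover have hz: "real p * h (\<alpha> - ?b) = of_int (z - 1)" using hd z by simp
    ultimately have "h (\<alpha> - ?b) > 0" using p0 by (metis of_int_0_less_iff of_nat_0_less_iff zero_less_mult_pos)
    moreover have "nat \<lfloor>real p * h (\<alpha> - ?b)\<rfloor> < nat \<lfloor>real p * h \<alpha>\<rfloor>" using \<open>z > 0\<close> unfolding hz z by simp
    ultimately obtain c :: "'a \<Rightarrow> nat" where c: "\<alpha> - ?b = (\<Sum>\<delta>\<in>\<Delta>. of_nat (c \<delta>) *\<^sub>R \<delta>)"
      using less.hyps[OF _ N n2] by blast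
    have "(\<Sum>\<delta>\<in>\<Delta>. of_nat ((c(?b := Suc (c ?b))) \<delta>) *\<^sub>R \<delta>) = (\<Sum>\<delta>\<in>\<Delta>. of_nat (c \<delta>) *\<^sub>R \<delta> + (if \<delta> = ?b then \<delta> else 0))"
      by (intro sum.cong) (auto simp: scaleR_add_left)
    also have "\<dots> = \<alpha>" using b fin by (simp add: sum.distrib sum.delta' flip: c)
    finally show ?thesis by metis
  qed
qed

lemma root_base_\<Delta>: "root_base (norm2_vectors N) \<Delta>"
  unfolding root_base_def
proof (intro conjI ballI)
  show "\<Delta> \<subseteq> norm2_vectors N" by (auto simp: \<Delta>_def norm2_vectors_def \<beta>_N \<beta>_norm)
  show "independent \<Delta>" by (rule \<Delta>_independent)
  fix \<alpha> assume "\<alpha> \<in> norm2_vectors N"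
  then have \<alpha>: "\<alpha> \<in> N" "\<alpha> \<bullet> \<alpha> = 2" by (auto simp: norm2_vectors_def)
  have "h \<alpha> \<noteq> 0" using height_Ints_iff[OF \<alpha>(1)] no_root \<alpha>(2) by (metis Ints_0)
  moreover have "h (- \<alpha>) = - h \<alpha>" using height_scale[of "-1" \<alpha>] by simp
  ultimately consider "h \<alpha> > 0" | "h (- \<alpha>) > 0" by fastforce
  then show "\<exists>c :: 'a \<Rightarrow> nat. \<alpha> = (\<Sum>\<delta>\<in>\<Delta>. of_nat (c \<delta>) *\<^sub>R \<delta>) \<or> \<alpha> = - (\<Sum>\<delta>\<in>\<Delta>. of_nat (c \<delta>) *\<^sub>R \<delta>)"
  proof cases
    case 1 then show ?thesis using positive_root[OF \<alpha>] by blast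
  next
    case 2 then show ?thesis using positive_root[of "- \<alpha>"] \<alpha> N.minus by (metis minus_minus inner_minus_left inner_minus_right)
  qed
qed

section \<open>The code of \<open>N\<close> and the coordinates as an isometry to Constructions A
  and B\<close>

abbreviation K :: "'a \<Rightarrow> nat \<Rightarrow> int" where "K x \<equiv> R_quot p t (coord x)"

definition code where "code = K ` N"

lemma coord_N: "x \<in> N \<Longrightarrow> i < t \<Longrightarrow> coord x i \<in> A_dual p"
  by (intro coord_A_dual inner_\<beta>_Ints)

lemma coord_zero_block: "i \<ge> t \<Longrightarrow> coord x i = 0"
  by (simp add: coord_def zero_fun_def)

lemma K_props:
  assumes "x \<in> N" "i < t"
  shows "K x i \<in> {0..<int p}" "l < p \<Longrightarrow> x \<bullet> v i l + of_int (K x i) / real p \<in> \<int>"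
  using R_quot_props[where x = "coord x", OF assms(2) coord_N[OF assms] p0] assms(2)
  by (auto simp: coord_def)

lemma K_eq: "x \<in> N \<Longrightarrow> i < t \<Longrightarrow> K x i = (- \<lfloor>real p * (x \<bullet> v i 0)\<rfloor>) mod int p"
  using R_quot_eq[where x = "coord x", OF _ coord_N p0] p0 by (simp add: coord_def)

lemma K_carrier: "x \<in> N \<Longrightarrow> K x \<in> carrier (Zp_power p t)"
  using p0 K_props(1) R_quot_restrict[of p t "coord x"]
  by (auto simp: Zp_power_def carrier_integer_mod_group PiE_iff)

lemma K_add:
  assumes "x \<in> N" "y \<in> N"
  shows "K (x + y) = K x \<otimes>\<^bsub>Zp_power p t\<^esub> K y"
proof (rule extensionalityI[OF R_quot_restrict])
  show "K x \<otimes>\<^bsub>Zp_power p t\<^esub> K y \<in> extensional {..<t}" by (simp add: Zp_power_def)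
  fix i assume "i \<in> {..<t}"
  then have i: "i < t" by simp
  have "real p * (x \<bullet> v i 0) \<in> \<int>" "real p * (y \<bullet> v i 0) \<in> \<int>"
    using assms i by (auto intro!: inner_v_scaled_Ints inner_\<beta>_Ints)
  then have "\<lfloor>real p * ((x + y) \<bullet> v i 0)\<rfloor> = \<lfloor>real p * (x \<bullet> v i 0)\<rfloor> + \<lfloor>real p * (y \<bullet> v i 0)\<rfloor>"
    by (elim Ints_cases) (simp add: inner_add_left distrib_left flip: of_int_add)
  then show "K (x + y) i = (K x \<otimes>\<^bsub>Zp_power p t\<^esub> K y) i"
    using assms i by (simp add: Zp_power_def K_eq N.add mod_simps)
qed

lemma group_Zp_power: "group (Zp_power p t)"
  by (simp add: Zp_power_def)

lemma code_is_code: "is_code p t code"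
  unfolding is_code_def
proof (rule group.subgroupI[OF group_Zp_power])
  show "code \<subseteq> carrier (Zp_power p t)" using K_carrier by (auto simp: code_def)
  show "code \<noteq> {}" using N.zero by (auto simp: code_def)
  have one: "K 0 = \<one>\<^bsub>Zp_power p t\<^esub>"
    using K_add[of 0 0] K_carrier[of 0] N.zero group.l_cancel_one[OF group_Zp_power, of "K 0" "K 0"] by simp
  show "inv\<^bsub>Zp_power p t\<^esub> a \<in> code" if a: "a \<in> code" for a
  proof -
    obtain x where x: "x \<in> N" "a = K x" using a by (auto simp: code_def)
    have "K (- x) \<otimes>\<^bsub>Zp_power p t\<^esub> a = \<one>\<^bsub>Zp_power p t\<^esub>"
      using K_add[of "- x" x] x N.minus one by simp
    then have "inv\<^bsub>Zp_power p t\<^esub> a = K (- x)"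
      using x N.minus K_carrier by (intro group.inv_equality[OF group_Zp_power]) auto
    then show ?thesis using x N.minus by (auto simp: code_def)
  qed
  show "a \<otimes>\<^bsub>Zp_power p t\<^esub> b \<in> code" if ab: "a \<in> code" "b \<in> code" for a b
  proof -
    obtain x y where "x \<in> N" "a = K x" "y \<in> N" "b = K y" using ab by (auto simp: code_def)
    then show ?thesis using K_add[of x y] N.add[of x y] unfolding code_def by (metis imageI)
  qed
qed

text \<open>By \<open>A_dual_inner\<close>, summed over the blocks, the inner product of
  \<open>x\<close> and \<open>y\<close> is minus 1/p times the pairing of their code words modulo
  the integers, and \<open>N\<close> is integral.\<close>

lemma sum_K_dvd:
  assumes "x \<in> N" "y \<in> N"
  shows "int p dvd (\<Sum>i<t. K x i * K y i)"
proof -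
  have "(\<Sum>l<p. coord x i l * coord y i l) + of_int (K x i * K y i) / real p \<in> \<int>" if "i < t" for i
    using R_quot_props(2)[where x = "coord x", OF that coord_N[OF assms(1) that] p0]
      R_quot_props(2)[where x = "coord y", OF that coord_N[OF assms(2) that] p0]
      coord_N[OF assms(1) that] coord_N[OF assms(2) that] p0
    by (intro A_dual_inner) (auto simp: A_dual_def)
  then have "(\<Sum>i<t. (\<Sum>l<p. coord x i l * coord y i l) + of_int (K x i * K y i) / real p) \<in> \<int>" by auto
  also have "(\<Sum>i<t. (\<Sum>l<p. coord x i l * coord y i l) + of_int (K x i * K y i) / real p) =
     block_inner p t (coord x) (coord y) + of_int (\<Sum>i<t. K x i * K y i) / real p"
    by (simp add: sum.distrib block_inner_def sum_divide_distrib)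
  also have "\<dots> = x \<bullet> y + of_int (\<Sum>i<t. K x i * K y i) / real p" by (simp only: block_inner_coord)
  finally have "x \<bullet> y + of_int (\<Sum>i<t. K x i * K y i) / real p \<in> \<int>" .
  from Ints_diff[OF this integral[OF assms]] have "of_int (\<Sum>i<t. K x i * K y i) / real p \<in> \<int>"
    by (simp only: add_diff_cancel_left')
  then show ?thesis using p0 by (simp only: divide_in_Ints_iff)
qed

lemma code_self_orthogonal: "self_orthogonal p t code"
  using sum_K_dvd K_carrier by (auto simp: self_orthogonal_def dual_code_def code_def)

text \<open>The root lattice of the standard model lies in the image of \<open>N\<close>: integral
  coordinates of sum zero have integral partial sums, and these are the coefficients at the
  roots.\<close>

lemma integral_combination:
  assumes w: "w \<in> R_lattice p t" and y_def: "y = (\<Sum>i<t. \<Sum>l<p. (\<Sum>m\<le>l. w i m) *\<^sub>R \<beta> i l)"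
  shows "y \<in> N" and "coord y = w" and "block_inner p t (coord x) w = x \<bullet> y"
proof -
  have wA: "w i \<in> A_lattice p" if "i < t" for i using w that by (auto simp: R_lattice_def)
  show yN: "y \<in> N"
    unfolding y_def using wA by (intro N.sum N.scale_Ints \<beta>_N Ints_sum) (auto simp: A_lattice_def)
  have "(\<Sum>l<p. w i l *\<^sub>R v i l) = (\<Sum>l<p. (\<Sum>m\<le>l. w i m) *\<^sub>R \<beta> i l)" if "i < t" for i
    using wA[OF that] by (intro abel that) (simp add: A_lattice_def A_space_def)
  then have y: "y = (\<Sum>i<t. \<Sum>l<p. w i l *\<^sub>R v i l)"
    unfolding y_def by (intro sum.cong[OF refl, of "{..<t}"]) (simp only: lessThan_iff)
  show bi: "block_inner p t (coord x) w = x \<bullet> y" for x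
    unfolding y by (simp add: block_inner_def coord_def inner_sum_right mult.commute)
  have vv: "(\<Sum>l<p. w i l *\<^sub>R v i l) \<bullet> \<beta> j m = (if i = j then w i m - w i (Suc m) else 0)"
    if "i < t" "j < t" "Suc m < p" for i j m
  proof (cases "i = j")
    case True
    have "(\<Sum>l<p. w i l *\<^sub>R v i l) \<bullet> \<beta> j m = (\<Sum>l<p. (if l = m then w i l else 0) - (if l = Suc m then w i l else 0))"
      unfolding inner_sum_left using that True by (intro sum.cong refl) (auto simp: v_inner)
    then show ?thesis using that True by (simp add: sum_subtractf sum.delta)
  qed (use that in \<open>simp add: inner_sum_left v_inner_neq\<close>)
  have yb: "y \<bullet> \<beta> j m = w j m - w j (Suc m)" if "j < t" "Suc m < p" for j m
  proof -
    have "y \<bullet> \<beta> j m = (\<Sum>i<t. (\<Sum>l<p. w i l *\<^sub>R v i l) \<bullet> \<beta> j m)"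
      unfolding y by (rule inner_sum_left)
    also have "\<dots> = (\<Sum>i<t. if i = j then w i m - w i (Suc m) else 0)"
      using that by (intro sum.cong[OF refl, of "{..<t}"] vv) auto
    also have "\<dots> = w j m - w j (Suc m)" using that by (simp add: sum.delta')
    finally show ?thesis .
  qed
  show "coord y = w"
  proof (rule ext, rule ext)
    fix j l
    show "coord y j l = w j l"
    proof (cases "j < t \<and> l < p")
      case True
      \<comment> \<open>Two vectors with the same consecutive differences differ by a constant,
        which is zero because both coordinate sums vanish.\<close>
      have diff: "coord y j m - w j m = coord y j 0 - w j 0" if "m < p" for m
        using that
      proof (induction m)
        case (Suc m)
        have "coord y j m - coord y j (Suc m) = y \<bullet> v j m - y \<bullet> v j (Suc m)"
          using True Suc.prems by (simp add: coord_def)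
        also have "y \<bullet> v j m - y \<bullet> v j (Suc m) = y \<bullet> \<beta> j m"
          using True by (simp only: v_diff flip: inner_diff_right)
        finally have "coord y j m - coord y j (Suc m) = w j m - w j (Suc m)"
          using yb[of j m] True Suc.prems by simp
        moreover have "coord y j m - w j m = coord y j 0 - w j 0" using Suc by simp
        ultimately show ?case by linarith
      qed simp
      have "(\<Sum>m<p. coord y j m - w j m) = 0"
        using coord_N[OF yN, of j] wA[of j] True by (simp add: A_dual_def A_space_def A_lattice_def sum_subtractf)
      moreover have "(\<Sum>m<p. coord y j m - w j m) = (\<Sum>m<p. coord y j 0 - w j 0)"
        by (rule sum.cong[OF refl], rule diff) simp
      ultimately have "real p * (coord y j 0 - w j 0) = 0" by simp
      then have "coord y j l - w j l = 0" using diff[of l] True p0 by simp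
      then show ?thesis by simp
    next
      case False
      then show ?thesis using w wA[of j]
        by (cases "j < t") (auto simp: coord_def R_lattice_def A_lattice_def A_space_def not_less)
    qed
  qed
qed

lemma coord_R_dual: "x \<in> N \<Longrightarrow> coord x \<in> R_dual p t"
  using coord_N[of x] integral_combination(1,3)[OF _ refl] integral coord_zero_block[of _ x]
  by (auto simp: R_dual_def A_dual_def)

text \<open>For surjectivity, a vector with the code word of \<open>x\<close> differs from
  \<open>coord x\<close> by an element of the root lattice, which comes from \<open>N\<close> as
  well.\<close>

lemma coord_image_N: "coord ` N = L_A p t code"
proof (intro equalityI subsetI)
  fix w assume "w \<in> coord ` N"
  then show "w \<in> L_A p t code" by (auto simp: L_A_def code_def coord_R_dual)
next
  fix w assume w: "w \<in> L_A p t code"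
  then obtain x where x: "x \<in> N" "R_quot p t w = K x" by (auto simp: L_A_def code_def)
  have wR: "w \<in> R_dual p t" using w by (simp add: L_A_def)
  have "w - coord x \<in> R_lattice p t"
    using R_quot_cong[of t w p "coord x"] R_dual_A_dual[OF wR] coord_N[OF x(1)] p0 x(2) wR coord_zero_block[of _ x]
    by (auto simp: R_lattice_def R_dual_def)
  then obtain y where y: "y \<in> N" "coord y = w - coord x" using integral_combination(1,2)[OF _ refl] by blast
  then have "w = coord (x + y)" by (simp add: coord_add)
  then show "w \<in> coord ` N" using x(1) y(1) N.add by blast
qed

lemma coord_image_L: "coord ` L = L_B p t code"
proof -
  have "L_B p t code = {coord x | x. x \<in> N \<and> h x \<in> \<int>}"
    by (auto simp: L_B_def height_coord simp flip: coord_image_N)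
  also have "\<dots> = coord ` L" using height_Ints_iff L_N by blast
  finally show ?thesis by simp
qed

lemma lattice_isom_coord: "lattice_isom N (\<bullet>) (L_A p t code) (block_inner p t) coord"
  "lattice_isom L (\<bullet>) (L_B p t code) (block_inner p t) coord"
  using coord_inj coord_image_N coord_image_L
  by (auto simp: lattice_isom_def bij_betw_def inj_on_def coord_add block_inner_coord)

section \<open>The isometry as a cyclic shift of the coordinates\<close>

lemma g_v: "i < t \<Longrightarrow> g (v i l) = v i (l + e i)"
proof -
  assume i: "i < t"
  have "g (v i l) = - (1 / real p) *\<^sub>R (\<Sum>j<p. real j *\<^sub>R g (\<beta> i (l + j)))"
    unfolding dual_vec_def by (simp only: linear_cmul[OF g_linear] linear_sum[OF g_linear])
  then show ?thesis using i by (simp add: dual_vec_def g_\<beta> add_ac)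
qed

definition ecode :: "nat \<Rightarrow> int" where "ecode = (\<lambda>i\<in>{..<t}. int (e i))"

lemma coord_g: "coord (g x) = g_Delta p t ecode (coord x)"
proof (rule ext, rule ext)
  fix i l
  show "coord (g x) i l = g_Delta p t ecode (coord x) i l"
  proof (cases "i < t \<and> l < p")
    case True
    \<comment> \<open>The place that \<open>g\<close> moves to \<open>l\<close>, written with a
      forward shift as in \<open>cyc_shift_funpow\<close>.\<close>
    define l' where "l' = (l + e i * (p - 1)) mod p"
    have "(l' + e i) mod p = (l + e i * (p - 1) + e i) mod p" by (simp add: l'_def mod_simps)
    also have "l + e i * (p - 1) + e i = l + e i * p" using p0 by (cases p) simp_all
    also have "(l + e i * p) mod p = l" using True by simp
    finally have "v i l = v i (l' + e i)" using v_mod[of i "l' + e i"] by simp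
    then have "g x \<bullet> v i l = g x \<bullet> g (v i l')" using True by (simp add: g_v)
    then have "g x \<bullet> v i l = x \<bullet> v i l'" by (simp only: g_inner)
    moreover have "g_Delta p t ecode (coord x) i l = coord x i l'"
      using True p0 cyc_shift_funpow[of p "coord x i" "e i" l]
      by (simp add: g_Delta_def ecode_def l'_def coord_def)
    moreover have "l' < p" using p0 by (simp add: l'_def)
    ultimately show ?thesis using True by (simp add: coord_def)
  next
    case False
    then show ?thesis using p0 cyc_shift_funpow[of p "coord x i" "e i" l]
      by (auto simp: g_Delta_def ecode_def coord_def)
  qed
qed

lemma ecode_carrier: "ecode \<in> carrier (Zp_power p t)"
  using p0 e_range by (auto simp: Zp_power_def carrier_integer_mod_group ecode_def)

lemma hamming_ecode: "hamming_weight t ecode = t"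
proof -
  have "{i \<in> {..<t}. ecode i \<noteq> 0} = {..<t}" using e_range by (auto simp: ecode_def)
  then show ?thesis by (simp add: hamming_weight_def)
qed

text \<open>Moving \<open>x\<close> by \<open>g\<close> changes its height by a sum of coordinates, which modulo \<open>\<int>\<close> is
  \<open>-(1/p)\<close> times the pairing of \<open>e\<close> with the code word of \<open>x\<close>; and \<open>x - g x \<in> L\<close> has integral height.\<close>

lemma ecode_dual: "ecode \<in> dual_code p t code"
proof -
  have "int p dvd (\<Sum>i<t. ecode i * K x i)" if x: "x \<in> N" for x
  proof -
    have gx: "g x \<in> N" using x by (rule g_N)
    have "(\<Sum>l<p. real l * (x \<bullet> v i l)) = (\<Sum>l<p. real l * (g x \<bullet> v i l)) + real p * (\<Sum>m<e i. g x \<bullet> v i m)"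
      if i: "i < t" for i
    proof -
      have "(\<Sum>l<p. real l * (x \<bullet> v i l)) = (\<Sum>l<p. real l * (g x \<bullet> v i (l + e i)))"
        using i by (simp add: g_inner flip: g_v)
      then show ?thesis
        using weighted_sum_periodic_shift[of "\<lambda>l. g x \<bullet> v i l" p "e i"] v_periodic v_sum_zero[OF i]
        by (simp flip: inner_sum_right)
    qed
    then have "h x = - (1 / real p) * ((\<Sum>i<t. \<Sum>l<p. real l * (g x \<bullet> v i l)) + real p * (\<Sum>i<t. \<Sum>m<e i. g x \<bullet> v i m))"
      by (simp add: height_def sum.distrib flip: sum_distrib_left)
    then have hx: "h x = h (g x) - (\<Sum>i<t. \<Sum>m<e i. g x \<bullet> v i m)"
      using p0 by (simp add: height_def distrib_left)
    have "h (x - g x) = h x - h (g x)"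
      using height_add[of "x - g x" "g x"] by simp
    then have 1: "(\<Sum>i<t. \<Sum>m<e i. g x \<bullet> v i m) \<in> \<int>"
      using height_Ints[OF g_diff[OF x]] hx by (simp add: minus_in_Ints_iff)
    have 2: "g x \<bullet> v i m + of_int (K x i) / real p \<in> \<int>" if i: "i < t" for i m
    proof -
      have g: "g x \<bullet> v i (e i) = x \<bullet> v i 0" using g_v[OF i, of 0] g_inner[of x "v i 0"] by simp
      have d: "g x \<bullet> v i m - g x \<bullet> v i 0 \<in> \<int>" "g x \<bullet> v i (e i) - g x \<bullet> v i 0 \<in> \<int>"
        using gx i by (auto intro!: inner_v_diff_Ints inner_\<beta>_Ints)
      from Ints_add[OF Ints_diff[OF d] K_props(2)[OF x i p0]]
      show ?thesis by (simp add: g)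
    qed
    have "(\<Sum>i<t. \<Sum>m<e i. g x \<bullet> v i m + of_int (K x i) / real p) \<in> \<int>"
      using 2 by (intro Ints_sum) auto
    also have "(\<Sum>i<t. \<Sum>m<e i. g x \<bullet> v i m + of_int (K x i) / real p) =
        (\<Sum>i<t. \<Sum>m<e i. g x \<bullet> v i m) + of_int (\<Sum>i<t. ecode i * K x i) / real p"
      by (simp add: sum.distrib sum_divide_distrib ecode_def)
    finally have "(\<Sum>i<t. \<Sum>m<e i. g x \<bullet> v i m) + of_int (\<Sum>i<t. ecode i * K x i) / real p \<in> \<int>" .
    from Ints_diff[OF this 1] have "of_int (\<Sum>i<t. ecode i * K x i) / real p \<in> \<int>"
      by (simp only: add_diff_cancel_left')
    then show ?thesis using p0 by (simp only: divide_in_Ints_iff)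
  qed
  then show ?thesis using ecode_carrier by (auto simp: dual_code_def code_def)
qed

theorem construction_AB:
  "\<exists>t C. t * (p - 1) = DIM('a) \<and> is_code p t C \<and> self_orthogonal p t C \<and>
    (\<exists>\<psi>. lattice_isom L (\<bullet>) (L_B p t C) (block_inner p t) \<psi>) \<and>
    (\<exists>\<phi> \<Delta> e. lattice_isom N (\<bullet>) (L_A p t C) (block_inner p t) \<phi> \<and> \<phi> ` L = L_B p t C \<and>
       root_base (norm2_vectors N) \<Delta> \<and> \<phi> ` \<Delta> = R_base p t \<and>
       e \<in> dual_code p t C \<and> hamming_weight t e = t \<and>
       (\<forall>x\<in>N. \<phi> (g x) = g_Delta p t e (\<phi> x))) \<and>
    (\<exists>c\<in>dual_code p t C. hamming_weight t c = t)"
  using rank_eq code_is_code code_self_orthogonal lattice_isom_coord coord_image_L root_base_\<Delta>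
    coord_\<Delta> ecode_dual hamming_ecode coord_g by blast

end

section \<open>Orbits of minimal vectors\<close>

lemma linear_funpow:
  fixes g :: "'a::real_vector \<Rightarrow> 'a"
  shows "linear g \<Longrightarrow> linear (g ^^ i)"
  by (induction i) (simp_all add: linear_iff)

locale rootless_orbits = L: int_module L for L :: "'a::euclidean_space set" +
  fixes g :: "'a \<Rightarrow> 'a" and p :: nat and lam :: 'a
  assumes span_L: "span L = UNIV"
    and even: "x \<in> L \<Longrightarrow> \<exists>k::int. x \<bullet> x = 2 * of_int k"
    and no_root: "x \<in> L \<Longrightarrow> x \<bullet> x \<noteq> 2"
    and prime: "prime p" and odd: "odd p"
    and g: "orthogonal_transformation g" and g_L: "x \<in> L \<Longrightarrow> g x \<in> L"
    and gp: "(g ^^ p) x = x"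
    and fpf: "x \<in> L \<Longrightarrow> g x = x \<Longrightarrow> x = 0"
    and lam_dual: "lam \<in> dual_lattice L" and lam_notin: "lam \<notin> L" and lam_g: "lam - g lam \<in> L"
begin

definition X where "X = {x. x - lam \<in> L \<and> x \<bullet> x = 2}"

lemma p3: "p \<ge> 3"
  using prime odd prime_ge_2_nat[of p] by (cases "p = 2") auto

lemma p0: "p > 0" using p3 by simp

lemma lin: "linear g" using g by (simp add: orthogonal_transformation_def)

lemma funpow_inner: "(g ^^ i) x \<bullet> (g ^^ i) y = x \<bullet> y"
  using g by (induction i) (simp_all add: orthogonal_transformation_def)

lemma funpow_linear: "linear (g ^^ i)"
  using lin by (rule linear_funpow)

lemma funpow_mod: "(g ^^ (i mod p)) x = (g ^^ i) x"
  using gp by (rule funpow_mod_eq)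

lemma funpow_add_apply: "(g ^^ (i + j)) x = (g ^^ i) ((g ^^ j) x)"
  by (simp add: funpow_add)

lemma funpow_cong: "[i = j] (mod p) \<Longrightarrow> (g ^^ i) x = (g ^^ j) x"
  unfolding cong_def by (metis funpow_mod)

text \<open>Apply the isometry \<open>g ^^ ((p - 1) * j)\<close>, the inverse of
  \<open>g ^^ j\<close>, to both arguments.\<close>

lemma inner_shift: "(g ^^ i) x \<bullet> (g ^^ j) y = (g ^^ (i + (p - 1) * j)) x \<bullet> y"
proof -
  have "(g ^^ i) x \<bullet> (g ^^ j) y = (g ^^ ((p - 1) * j)) ((g ^^ i) x) \<bullet> (g ^^ ((p - 1) * j)) ((g ^^ j) y)"
    by (simp only: funpow_inner)
  also have "(g ^^ ((p - 1) * j)) ((g ^^ j) y) = (g ^^ ((p - 1) * j + j)) y" by (simp only: funpow_add_apply)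
  also have "(p - 1) * j + j = p * j" using p0 by (cases p) simp_all
  also have "(g ^^ (p * j)) y = y" using funpow_mod[of "p * j" y] by simp
  also have "(g ^^ ((p - 1) * j)) ((g ^^ i) x) = (g ^^ (i + (p - 1) * j)) x"
    by (simp only: funpow_add_apply[symmetric] add.commute)
  finally show ?thesis .
qed

text \<open>On \<open>L\<close> an orbit sum is a fixed vector of \<open>L\<close>, hence zero;
  linearity carries this to the whole space.\<close>

lemma orbit_sum: "(\<Sum>i<p. (g ^^ i) x) = 0"
proof -
  have L: "(\<Sum>i<p. (g ^^ i) x) = 0" if x: "x \<in> L" for x
  proof (rule fpf)
    have "(g ^^ i) x \<in> L" for i by (induction i) (use x g_L in auto)
    then show "(\<Sum>i<p. (g ^^ i) x) \<in> L" by (intro L.sum)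
    have "g (\<Sum>i<p. (g ^^ i) x) = (\<Sum>i<p. (g ^^ Suc i) x)" by (simp add: linear_sum[OF lin])
    also have "\<dots> = (\<Sum>i<p. (g ^^ i) x)" by (rule sum_periodic_Suc) (simp add: gp)
    finally show "g (\<Sum>i<p. (g ^^ i) x) = (\<Sum>i<p. (g ^^ i) x)" .
  qed
  have "linear (\<lambda>x. \<Sum>i<p. (g ^^ i) x)" by (intro linear_compose_sum) (simp add: funpow_linear)
  from linear_eq_0_on_span[OF this L] show ?thesis using span_L by blast
qed

text \<open>As \<open>p\<close> is prime, \<open>g\<close> is a power of \<open>g ^^ i\<close>, and
  a vector fixed by \<open>g\<close> is 1/p times its orbit sum.\<close>

lemma fixed_imp_zero:
  assumes "(g ^^ i) x = x" "\<not> p dvd i"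
  shows "x = 0"
proof -
  have "coprime i p" using prime_imp_coprime[OF prime assms(2)] by (simp add: coprime_commute)
  then obtain a where a: "[i * a = 1] (mod p)" using cong_solve_coprime_nat[of i p] by auto
  have "((g ^^ i) ^^ a) x = x" by (induction a) (use assms(1) in auto)
  then have "(g ^^ (i * a)) x = x" by (simp add: funpow_mult)
  then have gx: "g x = x" using funpow_cong[OF a, of x] by simp
  have "(g ^^ i) x = x" for i by (induction i) (use gx in auto)
  then have "real p *\<^sub>R x = 0" using orbit_sum[of x] by (simp add: sum_constant_scaleR)
  then show ?thesis using p0 by simp
qed

lemma L_integral:
  assumes "x \<in> L" "y \<in> L" shows "x \<bullet> y \<in> \<int>"
proof -
  obtain a :: int where a: "x \<bullet> x = 2 * of_int a" using even[OF assms(1)] ..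
  obtain b :: int where b: "y \<bullet> y = 2 * of_int b" using even[OF assms(2)] ..
  obtain c :: int where c: "(x + y) \<bullet> (x + y) = 2 * of_int c" using even[OF L.add[OF assms]] ..
  have "(x + y) \<bullet> (x + y) = x \<bullet> x + 2 * (x \<bullet> y) + y \<bullet> y" by (simp add: inner_add inner_commute)
  then have "x \<bullet> y = of_int (c - a - b)" unfolding a b c by simp
  then show ?thesis by simp
qed

lemma lam_inner: "y \<in> L \<Longrightarrow> lam \<bullet> y \<in> \<int>"
  using lam_dual by (simp add: dual_lattice_def)

lemma lam_funpow: "lam - (g ^^ i) lam \<in> L"
proof (induction i)
  case (Suc i)
  have "g (lam - (g ^^ i) lam) + (lam - g lam) \<in> L" using Suc g_L lam_g L.add by blast
  then show ?case by (simp add: linear_diff[OF lin])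
qed (simp add: L.zero)

text \<open>The vectors \<open>lam - (g ^^ i) lam\<close> lie in \<open>L\<close> and sum up to
  \<open>p\<close> times \<open>lam\<close>. So the order of \<open>lam\<close> modulo
  \<open>L\<close> divides the prime \<open>p\<close>, and it is not 1.\<close>

lemma order: "of_int n *\<^sub>R lam \<in> L \<longleftrightarrow> int p dvd n"
proof
  have "(\<Sum>i<p. lam - (g ^^ i) lam) = real p *\<^sub>R lam"
    by (simp add: sum_subtractf orbit_sum sum_constant_scaleR)
  moreover have "(\<Sum>i<p. lam - (g ^^ i) lam) \<in> L" using lam_funpow by (intro L.sum)
  ultimately have p: "real p *\<^sub>R lam \<in> L" by simp
  show "of_int n *\<^sub>R lam \<in> L" if dvd: "int p dvd n"
  proof -
    obtain k where n: "n = int p * k" using dvd by (elim dvdE)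
    show ?thesis using L.scale_int[OF p, of k] unfolding n by (simp add: mult.commute)
  qed
  show "int p dvd n" if n: "of_int n *\<^sub>R lam \<in> L"
  proof (rule ccontr)
    assume "\<not> int p dvd n"
    then have "coprime n (int p)" using prime_imp_coprime[of "int p" n] prime by (simp add: coprime_commute)
    then obtain u v where uv: "u * n + v * int p = 1"
      using bezout_int[of n "int p"] by (auto simp: coprime_iff_gcd_eq_1)
    have "of_int u *\<^sub>R (of_int n *\<^sub>R lam) + of_int v *\<^sub>R (real p *\<^sub>R lam) = real_of_int (u * n + v * int p) *\<^sub>R lam"
      by (simp add: scaleR_add_left)
    also have "\<dots> = lam" unfolding uv by simp
    finally have eq: "of_int u *\<^sub>R (of_int n *\<^sub>R lam) + of_int v *\<^sub>R (real p *\<^sub>R lam) = lam" .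
    have "lam \<in> L" using L.add[OF L.scale_int[OF n, of u] L.scale_int[OF p, of v]] unfolding eq .
    then show False using lam_notin by simp
  qed
qed

lemma X_inner_L: "x \<in> X \<Longrightarrow> y \<in> L \<Longrightarrow> x \<bullet> y \<in> \<int>"
  using Ints_add[OF lam_inner[of y] L_integral[of "x - lam" y]] by (simp add: X_def inner_diff_left)

lemma X_diff: "x \<in> X \<Longrightarrow> y \<in> X \<Longrightarrow> x - y \<in> L"
  using L.diff[of "x - lam" "y - lam"] by (simp add: X_def)

text \<open>The value 1 would make the difference, a vector of \<open>L\<close>, have norm 2. The
  value -2 would make the sum zero and put twice \<open>lam\<close> into \<open>L\<close>, against
  the odd order \<open>p\<close>.\<close>

lemma X_inner:
  assumes x: "x \<in> X" and y: "y \<in> X" and neq: "x \<noteq> y"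
  shows "x \<bullet> y = 0 \<or> x \<bullet> y = -1"
proof -
  have xy: "x \<bullet> x = 2" "y \<bullet> y = 2" using x y by (auto simp: X_def)
  have "x \<bullet> (x - y) \<in> \<int>" using x X_diff[OF x y] by (rule X_inner_L)
  then have "x \<bullet> x - x \<bullet> (x - y) \<in> \<int>" unfolding xy by (intro Ints_diff) auto
  then obtain k :: int where k: "x \<bullet> y = of_int k" by (auto simp: inner_diff_right elim!: Ints_cases)
  have norm: "(x - y) \<bullet> (x - y) = 4 - 2 * of_int k" "(x + y) \<bullet> (x + y) = 4 + 2 * of_int k"
    using xy k by (simp_all add: inner_diff inner_add inner_commute)
  have "(x - y) \<bullet> (x - y) > 0" using neq by simp
  then have "k < 2" using norm by simp
  moreover have "k \<noteq> 1" using no_root[OF X_diff[OF x y]] norm by auto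
  moreover have "x + y \<noteq> 0"
  proof
    assume "x + y = 0"
    then have "x - y = 2 *\<^sub>R x" by (simp add: add_eq_0_iff scaleR_2)
    then have "2 *\<^sub>R x \<in> L" using X_diff[OF x y] by simp
    moreover have "of_int 2 *\<^sub>R (x - lam) \<in> L" using x by (intro L.scale_int) (simp add: X_def)
    ultimately have "2 *\<^sub>R x - 2 *\<^sub>R (x - lam) \<in> L" using L.diff by fastforce
    then have "of_int 2 *\<^sub>R lam \<in> L" by (simp add: scaleR_diff_right)
    then have "int p dvd 2" by (simp only: order)
    then have "int p \<le> 2" by (rule zdvd_imp_le) simp
    then show False using p3 by simp
  qed
  then have "(x + y) \<bullet> (x + y) > 0" by simp
  then have "k > -2" using norm by simp
  ultimately have "k = 0 \<or> k = -1" by linarith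
  then show ?thesis using k by auto
qed

lemma X_funpow: "x \<in> X \<Longrightarrow> (g ^^ i) x \<in> X"
proof (induction i)
  case (Suc i)
  have "g ((g ^^ i) x - lam) - (lam - g lam) \<in> L"
    using Suc lam_g g_L L.diff by (simp add: X_def)
  then have "g ((g ^^ i) x) - lam \<in> L" by (simp add: linear_diff[OF lin])
  moreover have "g ((g ^^ i) x) \<bullet> g ((g ^^ i) x) = 2"
    using Suc g by (simp add: X_def orthogonal_transformation_def)
  ultimately show ?case by (simp add: X_def)
qed simp

text \<open>Distinct members have nonpositive inner product, so they are uniformly separated points
  of a sphere.\<close>

lemma finite_X: "finite X"
proof -
  have "dist x y \<ge> 1" if "x \<in> X" "y \<in> X" "x \<noteq> y" for x y
  proof -
    have "x \<bullet> y \<le> 0" using X_inner[OF that] by auto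
    then have "(x - y) \<bullet> (x - y) \<ge> 1" using that by (simp add: X_def inner_diff inner_commute)
    then have "(norm (x - y))\<^sup>2 \<ge> 1" by (simp add: power2_norm_eq_inner)
    then show ?thesis using power2_le_imp_le[of 1 "norm (x - y)"] by (simp add: dist_norm)
  qed
  then have "uniform_discrete X" by (intro uniformI2[of 1]) auto
  moreover have "bounded X"
    unfolding bounded_iff by (intro exI[of _ "sqrt 2"]) (auto simp: X_def norm_eq_sqrt_inner)
  ultimately show ?thesis using uniform_discrete_finite_iff by blast
qed

text \<open>The inner products along the orbit are not positive, and they sum to zero because the
  orbit does.\<close>

lemma distinct_orbits_orthogonal:
  assumes x: "x \<in> X" and y: "y \<in> X" and neq: "\<And>i. (g ^^ i) x \<noteq> y"
  shows "(g ^^ i) x \<bullet> y = 0"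
proof -
  have nonpos: "(g ^^ i) x \<bullet> y \<le> 0" for i
    using X_inner[OF X_funpow[OF x] y neq, of i] by auto
  have "(\<Sum>i<p. (g ^^ i) x \<bullet> y) = 0" using orbit_sum[of x] by (simp flip: inner_sum_left)
  then have "(\<Sum>i<p. - ((g ^^ i) x \<bullet> y)) = 0" by (simp add: sum_negf)
  moreover have "(\<Sum>i<p. - ((g ^^ i) x \<bullet> y)) = 0 \<longleftrightarrow> (\<forall>i\<in>{..<p}. - ((g ^^ i) x \<bullet> y) = 0)"
    using nonpos by (intro sum_nonneg_eq_0_iff) auto
  ultimately have "(g ^^ (i mod p)) x \<bullet> y = 0" using p0 by simp
  then show ?thesis by (simp add: funpow_mod)
qed

text \<open>The inner products of \<open>x\<close> with the other members of its orbit are \<open>0\<close> or \<open>-1\<close> and sum up to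
  \<open>-2\<close>, so exactly two of them are \<open>-1\<close>: the orbit is an extended Dynkin diagram of type \<open>A\<close>.\<close>

lemma orbit_cycle:
  assumes x: "x \<in> X"
  shows "\<exists>k. 0 < k \<and> k < p \<and> (\<forall>i<p. (g ^^ i) x \<bullet> x = 2 * of_bool (i = 0) - of_bool (i = k) - of_bool (i = p - k))"
proof -
  define c where "c i = (g ^^ i) x \<bullet> x" for i
  have c0: "c 0 = 2" using x by (simp add: c_def X_def)
  have x0: "x \<noteq> 0" using x by (auto simp: X_def)
  have c: "c i = 0 \<or> c i = -1" if "0 < i" "i < p" for i
  proof -
    have "(g ^^ i) x \<noteq> x" using fixed_imp_zero[of i x] x0 that nat_dvd_not_less[of i p] by blast
    then show ?thesis using X_inner[OF X_funpow[OF x] x] by (simp add: c_def)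
  qed
  have sym: "c (p - i) = c i" if "i < p" for i
  proof -
    have "c (p - i) = (g ^^ i) ((g ^^ (p - i)) x) \<bullet> (g ^^ i) x" by (simp only: c_def funpow_inner)
    also have "(g ^^ i) ((g ^^ (p - i)) x) = (g ^^ p) x" using that by (simp flip: funpow_add_apply)
    finally show ?thesis by (simp add: gp c_def inner_commute)
  qed
  define A where "A = {i \<in> {1..<p}. c i = -1}"
  have finA: "finite A" by (simp add: A_def)
  have "(\<Sum>i<p. c i) = 0" using orbit_sum[of x] by (simp add: c_def flip: inner_sum_left)
  moreover have "{..<p} = insert 0 {1..<p}" using p0 by auto
  ultimately have "(\<Sum>i\<in>{1..<p}. c i) = -2" using c0 by simp
  moreover have "(\<Sum>i\<in>{1..<p}. c i) = (\<Sum>i\<in>{1..<p}. if i \<in> A then -1 else 0)"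
  proof (intro sum.cong refl)
    show "c i = (if i \<in> A then -1 else 0)" if "i \<in> {1..<p}" for i
      using c[of i] that by (auto simp: A_def)
  qed
  moreover have "\<dots> = - real (card A)"
  proof -
    have "{1..<p} \<inter> A = A" by (auto simp: A_def)
    then show ?thesis by (simp add: sum.If_cases)
  qed
  ultimately have card: "card A = 2" by simp
  then obtain k where k: "k \<in> A" by (metis card.empty ex_in_conv zero_neq_numeral)
  have kp: "0 < k" "k < p" using k by (auto simp: A_def)
  have pk: "p - k \<in> A" using k sym[OF kp(2)] kp by (auto simp: A_def)
  have neq: "p - k \<noteq> k" using odd kp by presburger
  have "{k, p - k} \<subseteq> A" "card {k, p - k} = card A" using k pk neq card by auto
  then have A: "A = {k, p - k}" using finA by (metis card_subset_eq)
  have "c i = 2 * of_bool (i = 0) - of_bool (i = k) - of_bool (i = p - k)" if "i < p" for i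
  proof (cases "i = 0")
    case True then show ?thesis using c0 kp by simp
  next
    case False
    then have "i \<in> A \<longleftrightarrow> c i = -1" using that by (simp add: A_def)
    then show ?thesis using A c[of i] False that neq by auto
  qed
  then show ?thesis using kp by (auto simp: c_def)
qed

text \<open>Counting in multiples of \<open>k\<close> makes neighbours of the diagram consecutive.
  As \<open>k\<close> is invertible modulo \<open>p\<close>, the exponent \<open>k * (l - m)\<close>
  is 0, \<open>k\<close> or \<open>- k\<close> modulo \<open>p\<close> precisely when
  \<open>l - m\<close> is 0, 1 or -1.\<close>

lemma orbit_inner:
  assumes k: "0 < k" "k < p" and c: "\<And>i. i < p \<Longrightarrow> (g ^^ i) x \<bullet> x = 2 * of_bool (i = 0) - of_bool (i = k) - of_bool (i = p - k)"
  shows "(g ^^ (k * l)) x \<bullet> (g ^^ (k * m)) x =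
    2 * of_bool ([l = m] (mod p)) - of_bool ([Suc l = m] (mod p)) - of_bool ([l = Suc m] (mod p))"
proof -
  define d where "d = (k * l + (p - 1) * (k * m)) mod p"
  have d: "d < p" using p0 by (simp add: d_def)
  have di: "[int d = int k * (int l - int m)] (mod int p)"
  proof -
    have "int (k * l + (p - 1) * (k * m)) = int k * (int l - int m) + int p * (int k * int m)"
      using p0 by (cases p) (simp_all add: algebra_simps)
    then show ?thesis by (simp add: d_def cong_def of_nat_mod)
  qed
  have kdvd: "int p dvd int k * z \<longleftrightarrow> int p dvd z" for z
    using prime k nat_dvd_not_less[of k p] by (simp add: prime_dvd_mult_iff)
  have dd: "int d = j \<longleftrightarrow> int p dvd (int k * (int l - int m) - j)" if "0 \<le> j" "j < int p" for j
  proof -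
    have "int d = j \<longleftrightarrow> [int d = j] (mod int p)" using that d by (simp add: cong_def)
    also have "\<dots> \<longleftrightarrow> [int k * (int l - int m) = j] (mod int p)" using di by (meson cong_sym cong_trans)
    finally show ?thesis by (simp add: cong_iff_dvd_diff)
  qed
  have nat_cong: "[a = b] (mod p) \<longleftrightarrow> int p dvd int a - int b" for a b
    by (simp add: cong_iff_dvd_diff flip: cong_int_iff)
  have "d = 0 \<longleftrightarrow> [l = m] (mod p)" using dd[of 0] p0 kdvd by (simp add: nat_cong)
  moreover have "d = k \<longleftrightarrow> [l = Suc m] (mod p)"
  proof -
    have "int k * (int l - int m) - int k = int k * (int l - int (Suc m))" by (simp add: algebra_simps)
    then show ?thesis using dd[of "int k"] k kdvd[of "int l - int (Suc m)"] by (simp add: nat_cong)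
  qed
  moreover have "d = p - k \<longleftrightarrow> [Suc l = m] (mod p)"
  proof -
    have "d = p - k \<longleftrightarrow> int d = int p - int k" using k by linarith
    also have "\<dots> \<longleftrightarrow> int p dvd int k * (int (Suc l) - int m) - int p"
      using dd[of "int p - int k"] k by (simp add: algebra_simps)
    also have "\<dots> \<longleftrightarrow> int p dvd int k * (int (Suc l) - int m)" by (simp add: dvd_diff_left_iff)
    finally show ?thesis using kdvd by (simp add: nat_cong)
  qed
  moreover have "(g ^^ (k * l)) x \<bullet> (g ^^ (k * m)) x = (g ^^ d) x \<bullet> x"
    by (simp only: inner_shift d_def funpow_mod)
  ultimately show ?thesis using c[OF d] by simp
qed

lemma orbit_representatives:
  obtains S where "finite S" "S \<subseteq> X" "\<And>x. x \<in> X \<Longrightarrow> \<exists>s\<in>S. \<exists>i. x = (g ^^ i) s"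
    "\<And>s s' i. s \<in> S \<Longrightarrow> s' \<in> S \<Longrightarrow> (g ^^ i) s = s' \<Longrightarrow> s = s'"
proof -
  define orb where "orb x = range (\<lambda>i. (g ^^ i) x)" for x
  have self: "x \<in> orb x" for x unfolding orb_def by (rule range_eqI[of _ _ 0]) simp
  have sub: "orb y \<subseteq> orb x" if "y \<in> orb x" for x y
    using that by (auto simp: orb_def simp flip: funpow_add_apply)
  have orb_sym: "x \<in> orb y" if yx: "y \<in> orb x" for x y
  proof -
    obtain i where y: "y = (g ^^ i) x" using yx by (auto simp: orb_def)
    have "(g ^^ ((p - 1) * i)) y = (g ^^ ((p - 1) * i + i)) x" by (simp only: y funpow_add_apply)
    also have "(p - 1) * i + i = p * i" using p0 by (cases p) simp_all
    also have "(g ^^ (p * i)) x = x" using funpow_mod[of "p * i" x] by simp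
    finally show ?thesis unfolding orb_def by (metis rangeI)
  qed
  have eq: "orb y = orb x" if "y \<in> orb x" for x y
    using sub[OF that] sub[OF orb_sym[OF that]] by blast
  \<comment> \<open>The choice depends on the orbit as a set only, so members of one orbit get the
    same representative.\<close>
  define r where "r x = (SOME y. y \<in> orb x)" for x
  have r: "r x \<in> orb x" for x unfolding r_def using self by (rule someI)
  show thesis
  proof
    show "finite (r ` X)" using finite_X by simp
    show "r ` X \<subseteq> X"
    proof (rule image_subsetI)
      show "r x \<in> X" if x: "x \<in> X" for x
        using r[of x] X_funpow[OF x] by (auto simp: orb_def)
    qed
    show "\<exists>s\<in>r ` X. \<exists>i. x = (g ^^ i) s" if "x \<in> X" for x
      using orb_sym[OF r[of x]] that by (auto simp: orb_def)
    show "s = s'" if s: "s \<in> r ` X" "s' \<in> r ` X" "(g ^^ i) s = s'" for s s' i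
    proof -
      obtain x x' where x: "s = r x" "s' = r x'" using s(1,2) by blast
      have "s' \<in> orb s" using s(3) by (auto simp: orb_def)
      then have "orb x = orb x'" using eq r x by metis
      then show ?thesis by (simp add: x r_def)
    qed
  qed
qed

text \<open>The lattice half of the argument: all that remains of the vertex operator algebra is the
  inequality \<open>bound\<close>.\<close>

theorem construction_AB_from_orbits:
  fixes N :: "'a set"
  assumes N_def: "N = int_span (insert lam L)"
    and bound: "\<And>S Z. finite S \<Longrightarrow> (\<And>x. x \<in> X \<Longrightarrow> \<exists>s\<in>S. \<exists>i. x = (g ^^ i) s) \<Longrightarrow> finite Z \<Longrightarrow>
      (\<And>y. y \<in> Z \<Longrightarrow> g y \<noteq> y) \<Longrightarrow> (\<And>y i. y \<in> Z \<Longrightarrow> (g ^^ i) y \<bullet> y \<in> \<int>) \<Longrightarrow>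
      (\<And>y z i. y \<in> Z \<Longrightarrow> z \<in> Z \<Longrightarrow> y \<noteq> z \<Longrightarrow> (g ^^ i) y \<bullet> z = 0) \<Longrightarrow> card Z \<le> card S"
  shows "\<exists>t C. t * (p - 1) = DIM('a) \<and> is_code p t C \<and> self_orthogonal p t C \<and>
    (\<exists>\<psi>. lattice_isom L (\<bullet>) (L_B p t C) (block_inner p t) \<psi>) \<and>
    (\<exists>\<phi> \<Delta> e. lattice_isom N (\<bullet>) (L_A p t C) (block_inner p t) \<phi> \<and> \<phi> ` L = L_B p t C \<and>
       root_base (norm2_vectors N) \<Delta> \<and> \<phi> ` \<Delta> = R_base p t \<and>
       e \<in> dual_code p t C \<and> hamming_weight t e = t \<and>
       (\<forall>x\<in>N. \<phi> (g x) = g_Delta p t e (\<phi> x))) \<and>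
    (\<exists>c\<in>dual_code p t C. hamming_weight t c = t)"
proof -
  have N_eq: "N = {of_int n *\<^sub>R lam + x | n x. x \<in> L}"
    unfolding N_def by (rule int_span_insert) (rule L.int_module_axioms)
  interpret N: int_module N unfolding N_def by (rule int_module_int_span)
  have L_N: "x \<in> N" if "x \<in> L" for x
    using int_span_base[of x "insert lam L"] that unfolding N_def by blast
  have lam_N: "lam \<in> N" unfolding N_def by (rule int_span_base) simp
  have moved: "g y \<noteq> y" if "y \<noteq> 0" for y
    using fixed_imp_zero[of 1 y] that p3 by auto
  have L_funpow: "(g ^^ i) y \<in> L" if "y \<in> L" for y i
    by (induction i) (use that g_L in auto)
  have "\<not> L \<subseteq> {0}"
  proof
    assume "L \<subseteq> {0}"
    then have "span L \<subseteq> span {0}" by (rule span_mono)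
    then have "(SOME b. b \<in> Basis) = (0 :: 'a)" using span_L by auto
    then show False using nonempty_Basis by (metis nonzero_Basis some_in_eq)
  qed
  then obtain y0 where y0: "y0 \<in> L" "y0 \<noteq> 0" by blast
  \<comment> \<open>For empty \<open>X\<close> the empty set represents all orbits, and the bound
    fails for the single vector \<open>y0\<close>.\<close>
  have "X \<noteq> {}"
  proof
    assume "X = {}"
    have "card {y0} \<le> card ({} :: 'a set)"
      using y0 moved L_funpow L_integral by (intro bound) (auto simp: \<open>X = {}\<close>)
    then show False by simp
  qed
  then obtain x0 where x0: "x0 \<in> X" by blast
  \<comment> \<open>Integrality of the norm of \<open>lam\<close> comes from a vector of norm 2 in
    its coset.\<close>
  have lam_lam: "lam \<bullet> lam \<in> \<int>"
  proof -
    have x0L: "x0 - lam \<in> L" using x0 by (simp add: X_def)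
    have "lam \<bullet> lam = x0 \<bullet> x0 - lam \<bullet> (x0 - lam) - x0 \<bullet> (x0 - lam)"
      by (simp add: inner_diff inner_commute)
    moreover have "x0 \<bullet> x0 \<in> \<int>" using x0 by (simp add: X_def)
    ultimately show ?thesis using lam_inner[OF x0L] X_inner_L[OF x0 x0L] by simp
  qed
  have integral: "x \<bullet> y \<in> \<int>" if "x \<in> N" "y \<in> N" for x y
  proof -
    obtain n a m b where xy: "x = of_int n *\<^sub>R lam + a" "a \<in> L" "y = of_int m *\<^sub>R lam + b" "b \<in> L"
      using \<open>x \<in> N\<close> \<open>y \<in> N\<close> unfolding N_eq by blast
    have "x \<bullet> y = of_int (n * m) * (lam \<bullet> lam) + of_int n * (lam \<bullet> b) + of_int m * (lam \<bullet> a) + a \<bullet> b"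
      by (simp add: xy(1,3) inner_add inner_commute[of a lam] algebra_simps)
    then show ?thesis
      using lam_lam lam_inner[OF xy(2)] lam_inner[OF xy(4)] L_integral[OF xy(2,4)] by (auto intro!: Ints_add Ints_mult)
  qed
  have g_diff: "x - g x \<in> L" if "x \<in> N" for x
  proof -
    obtain n a where x: "x = of_int n *\<^sub>R lam + a" "a \<in> L" using \<open>x \<in> N\<close> unfolding N_eq by blast
    have "x - g x = of_int n *\<^sub>R (lam - g lam) + (a - g a)"
      by (simp add: x(1) linear_add[OF lin] linear_cmul[OF lin] scaleR_diff_right)
    then show ?thesis using L.add[OF L.scale_int[OF lam_g] L.diff[OF x(2) g_L[OF x(2)]]] by simp
  qed
  have g_N: "g x \<in> N" if "x \<in> N" for x
    using N.diff[OF that L_N[OF g_diff[OF that]]] by simp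
  have funpow_N: "(g ^^ i) x \<in> N" if "x \<in> N" for x i
    by (induction i) (use that g_N in auto)
  have X_N: "x \<in> N" if "x \<in> X" for x
    using N.add[OF lam_N L_N[of "x - lam"]] that by (simp add: X_def)
  obtain S where S: "finite S" "S \<subseteq> X" "\<And>x. x \<in> X \<Longrightarrow> \<exists>s\<in>S. \<exists>i. x = (g ^^ i) s"
    "\<And>s s' i. s \<in> S \<Longrightarrow> s' \<in> S \<Longrightarrow> (g ^^ i) s = s' \<Longrightarrow> s = s'"
    by (rule orbit_representatives) blast
  define t where "t = card S"
  obtain x where x: "bij_betw x {..<t} S"
    using ex_bij_betw_nat_finite[OF S(1)] unfolding t_def atLeast0LessThan by blast
  have xS: "x i \<in> S" if "i < t" for i using x that by (auto simp: bij_betw_def)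
  have xX: "x i \<in> X" if "i < t" for i using xS[OF that] S(2) by blast
  have "\<exists>k. 0 < k \<and> k < p \<and> (\<forall>j<p. (g ^^ j) (x i) \<bullet> x i = 2 * of_bool (j = 0) - of_bool (j = k) - of_bool (j = p - k))"
    if "i < t" for i using orbit_cycle[OF xX[OF that]] .
  then obtain k where k: "\<And>i. i < t \<Longrightarrow> 0 < k i" "\<And>i. i < t \<Longrightarrow> k i < p"
    "\<And>i j. i < t \<Longrightarrow> j < p \<Longrightarrow> (g ^^ j) (x i) \<bullet> x i = 2 * of_bool (j = 0) - of_bool (j = k i) - of_bool (j = p - k i)"
    by metis
  define \<beta> where "\<beta> i l = (g ^^ (k i * l)) (x i)" for i l
  have \<beta>X: "\<beta> i l \<in> X" if "i < t" for i l unfolding \<beta>_def using xX[OF that] by (rule X_funpow)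
  have np: "\<not> p dvd k i" if "i < t" for i using nat_dvd_not_less k(1,2) that by blast
  interpret B: affine_blocks p t \<beta>
  proof
    show "3 \<le> p" by (rule p3)
    show "\<beta> i (l + p) = \<beta> i l" for i l
      unfolding \<beta>_def by (rule funpow_cong) (simp add: cong_def distrib_left)
    show "\<beta> i l \<bullet> \<beta> i m = 2 * of_bool ([l = m] (mod p)) - of_bool ([Suc l = m] (mod p)) - of_bool ([l = Suc m] (mod p))"
      if "i < t" for i l m
      unfolding \<beta>_def using k(1)[OF that] k(2)[OF that] k(3)[OF that] by (rule orbit_inner)
    show "\<beta> i l \<bullet> \<beta> i' m = 0" if "i < t" "i' < t" "i \<noteq> i'" for i i' l m
    proof -
      have "x i \<noteq> x i'" using that x by (auto simp: bij_betw_def inj_on_def)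
      then have "(g ^^ j) (x i) \<noteq> x i'" for j using S(4)[OF xS[OF that(1)] xS[OF that(2)]] by blast
      then have "(g ^^ j) (x i) \<bullet> x i' = 0" for j
        using distinct_orbits_orthogonal[OF xX[OF that(1)] xX[OF that(2)]] by blast
      then show ?thesis unfolding \<beta>_def inner_shift by blast
    qed
    show "(\<Sum>l<p. \<beta> i l) = 0" if "i < t" for i
    proof (rule fixed_imp_zero[OF _ np[OF that]])
      have "(g ^^ k i) (\<Sum>l<p. \<beta> i l) = (\<Sum>l<p. \<beta> i (Suc l))"
        by (simp only: linear_sum[OF funpow_linear] \<beta>_def funpow_add_apply[symmetric] mult_Suc_right)
      also have "\<dots> = (\<Sum>l<p. \<beta> i l)"
        by (rule sum_periodic_Suc) (simp add: \<beta>_def funpow_cong[of "k i * p" 0] cong_def)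
      finally show "(g ^^ k i) (\<Sum>l<p. \<beta> i l) = (\<Sum>l<p. \<beta> i l)" .
    qed
  qed
  have perp: "y = 0" if y: "y \<in> N" "\<And>i l. i < t \<Longrightarrow> y \<bullet> \<beta> i l = 0" for y
  proof (rule ccontr)
    assume "y \<noteq> 0"
    have yX: "y \<bullet> z = 0" if z: "z \<in> X" for z
    proof -
      obtain s m where s: "s \<in> S" "z = (g ^^ m) s" using S(3)[OF z] by blast
      obtain i where i: "i < t" "s = x i" using s(1) x by (auto simp: bij_betw_def)
      \<comment> \<open>An inverse of \<open>k i\<close> modulo \<open>p\<close> shows that the
        numbering by multiples of \<open>k i\<close> reaches the whole orbit.\<close>
      have "coprime (k i) p" using prime_imp_coprime[OF prime np[OF i(1)]] by (simp add: coprime_commute)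
      then obtain a where "[k i * a = 1] (mod p)" using cong_solve_coprime_nat[of "k i" p] by auto
      then have "[k i * a * m = 1 * m] (mod p)" by (rule cong_scalar_right)
      then have "z = \<beta> i (a * m)" using funpow_cong[of "k i * a * m" m] s(2) i(2) by (simp add: \<beta>_def mult.assoc)
      then show ?thesis using y(2)[OF i(1)] by simp
    qed
    have yS: "y \<notin> S" using yX[of y] \<open>y \<noteq> 0\<close> S(2) by auto
    have "card (insert y S) \<le> card S"
    proof (rule bound[OF S(1,3)])
      show "finite (insert y S)" using S(1) by simp
      show "g z \<noteq> z" if "z \<in> insert y S" for z
      proof -
        have "0 \<notin> X" by (simp add: X_def)
        then have "z \<noteq> 0" using that \<open>y \<noteq> 0\<close> S(2) by blast
        then show ?thesis by (rule moved)
      qed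
      show "(g ^^ i) z \<bullet> z \<in> \<int>" if "z \<in> insert y S" for z i
      proof -
        have "z \<in> N" using that y(1) S(2) X_N by blast
        then show ?thesis using integral funpow_N by blast
      qed
      show "(g ^^ i) z \<bullet> w = 0" if zw: "z \<in> insert y S" "w \<in> insert y S" "z \<noteq> w" for z w i
      proof -
        consider "z = y" "w \<in> S" | "z \<in> S" "w = y" | "z \<in> S" "w \<in> S" using zw by blast
        then show ?thesis
        proof cases
          case 1
          have "(g ^^ i) y \<bullet> w = w \<bullet> (g ^^ i) y" by (rule inner_commute)
          also have "\<dots> = (g ^^ (0 + (p - 1) * i)) w \<bullet> y" using inner_shift[of 0 w i y] by simp
          also have "\<dots> = 0" using yX[OF X_funpow, of w "0 + (p - 1) * i"] 1 S(2) by (auto simp: inner_commute)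
          finally show ?thesis using 1 by simp
        next
          case 2
          then show ?thesis using yX[OF X_funpow, of z i] S(2) by (auto simp: inner_commute)
        next
          case 3
          then show ?thesis using distinct_orbits_orthogonal[of z w i] S(2,4) zw(3) by blast
        qed
      qed
    qed
    then show False using yS S(1) by simp
  qed
  have expand_N: "B.expand y = y" if y: "y \<in> N" for y
  proof -
    have \<beta>N: "\<beta> i l \<in> N" if "i < t" for i l using \<beta>X[OF that] X_N by blast
    have vN: "real p *\<^sub>R dual_vec p \<beta> i l \<in> N" if "i < t" for i l
      unfolding B.v_scaled using \<beta>N[OF that] by (intro N.minus N.sum N.scale_nat)
    \<comment> \<open>One factor \<open>p\<close> clears the denominators of the coordinates, the
      other those of the dual vectors. This puts the component orthogonal to the blocks into
      \<open>N\<close>, where \<open>perp\<close> applies.\<close>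
    define z where "z = (real p * real p) *\<^sub>R (y - B.expand y)"
    have "(real p * real p) *\<^sub>R B.expand y =
        (\<Sum>i<t. \<Sum>l<p. (real p * (y \<bullet> dual_vec p \<beta> i l)) *\<^sub>R (real p *\<^sub>R dual_vec p \<beta> i l))"
      by (simp add: B.expand_def scaleR_sum_right mult_ac)
    also have "\<dots> \<in> N"
      by (intro N.sum N.scale_Ints[OF vN] B.inner_v_scaled_Ints integral[OF y \<beta>N]) auto
    finally have "(real p * real p) *\<^sub>R B.expand y \<in> N" .
    moreover have "(real p * real p) *\<^sub>R y \<in> N" using N.scale_nat[OF y, of "p * p"] by simp
    ultimately have "z \<in> N" unfolding z_def scaleR_diff_right by (rule N.diff[rotated])
    moreover have "z \<bullet> \<beta> i l = 0" if "i < t" for i l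
      using B.expand_orthogonal[OF that, of y l] by (simp add: z_def)
    ultimately have "z = 0" by (rule perp)
    then show ?thesis using p0 by (simp add: z_def)
  qed
  have lin_expand: "linear B.expand"
    by (rule linearI) (simp_all add: B.expand_def inner_add_left scaleR_add_left sum.distrib scaleR_sum_right)
  have expand: "B.expand y = y" for y
    using linear_eq_on_span[OF lin_expand linear_id, of L y] expand_N L_N span_L by (simp add: id_def)
  interpret B: full_blocks p t \<beta>
    by unfold_locales (rule expand)
  have "S \<noteq> {}" using S(3)[OF x0] by blast
  then have t0: "t > 0" using S(1) by (simp add: t_def card_gt_0_iff)
  interpret B: lattice_blocks p t \<beta> L N lam
    by unfold_locales (use prime t0 N_eq \<beta>X order integral no_root in \<open>auto simp: X_def\<close>)
  obtain c where c: "\<And>y. y \<in> L \<Longrightarrow> height p t (\<lambda>i l. \<beta> i (l + c i)) y \<in> \<int>"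
    using B.exists_shift[OF odd] by blast
  define \<gamma> where "\<gamma> = (\<lambda>i l. \<beta> i (l + c i))"
  interpret C: affine_blocks p t \<gamma> unfolding \<gamma>_def by (rule B.shift)
  have C_expand: "C.expand y = y" for y
  proof -
    have "(\<Sum>l<p. (y \<bullet> dual_vec p \<beta> i (l + c i)) *\<^sub>R dual_vec p \<beta> i (l + c i)) =
        (\<Sum>l<p. (y \<bullet> dual_vec p \<beta> i l) *\<^sub>R dual_vec p \<beta> i l)" for i
      using sum_periodic_shift[of "\<lambda>l. (y \<bullet> dual_vec p \<beta> i l) *\<^sub>R dual_vec p \<beta> i l" p "c i"] B.v_periodic by simp
    moreover have "dual_vec p \<gamma> i l = dual_vec p \<beta> i (l + c i)" for i l
      unfolding \<gamma>_def by (rule B.dual_vec_shift)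
    ultimately have "C.expand y = B.expand y" by (simp add: C.expand_def B.expand_def)
    then show ?thesis by (simp add: expand)
  qed
  \<comment> \<open>One application of \<open>g\<close> advances by the inverse of
    \<open>k i\<close> places. It is nonzero modulo \<open>p\<close>, which gives \<open>e\<close>
    full Hamming weight.\<close>
  have "\<exists>e. 0 < e \<and> e < p \<and> [k i * e = 1] (mod p)" if i: "i < t" for i
  proof -
    have "coprime (k i) p" using prime_imp_coprime[OF prime np[OF i]] by (simp add: coprime_commute)
    then obtain a where a: "[k i * a = 1] (mod p)" using cong_solve_coprime_nat[of "k i" p] by auto
    then have 1: "[k i * (a mod p) = 1] (mod p)" by (simp add: cong_def mod_mult_right_eq)
    have "a mod p \<noteq> 0"
    proof
      assume "a mod p = 0"
      then show False using 1 p3 by (simp add: cong_def)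
    qed
    then show ?thesis using 1 p0 by (intro exI[of _ "a mod p"]) auto
  qed
  then obtain e where e: "\<And>i. i < t \<Longrightarrow> 0 < e i" "\<And>i. i < t \<Longrightarrow> e i < p" "\<And>i. i < t \<Longrightarrow> [k i * e i = 1] (mod p)"
    by metis
  have g\<gamma>: "g (\<gamma> i l) = \<gamma> i (l + e i)" if i: "i < t" for i l
  proof -
    have "[k i * (l + c i) + k i * e i = k i * (l + c i) + 1] (mod p)"
      using e(3)[OF i] by (rule cong_add[OF cong_refl])
    then have "[k i * (l + e i + c i) = Suc (k i * (l + c i))] (mod p)" by (simp add: distrib_left add_ac)
    from funpow_cong[OF this] show ?thesis by (simp add: \<gamma>_def \<beta>_def)
  qed
  interpret C: cyclic_blocks p t \<gamma> L N lam g e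
  proof unfold_locales
    show "height p t \<gamma> y \<in> \<int>" if "y \<in> L" for y using c[OF that] by (simp add: \<gamma>_def)
    show "\<gamma> i l - lam \<in> L" if "i < t" for i l using \<beta>X[OF that] by (simp add: \<gamma>_def X_def)
    show "g y \<bullet> g z = y \<bullet> z" for y z using g by (simp add: orthogonal_transformation_def)
  qed (use C_expand prime t0 N_eq order integral no_root linear_add[OF lin] linear_cmul[OF lin] g\<gamma> e g_N g_diff in auto)
  show ?thesis by (rule C.construction_AB)
qed

end

theorem proposition6p1:
  fixes L :: "'a::euclidean_space set" and g :: "'a \<Rightarrow> 'a" and p :: nat
    and \<epsilon> :: "'a \<Rightarrow> 'a \<Rightarrow> int" and ghat :: "int \<times> 'a \<Rightarrow> int \<times> 'a"
    and \<tau> G :: "'a fock \<Rightarrow> 'a fock" and j r :: nat and lam :: 'a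
  defines "N \<equiv> int_span (insert lam L)"
  assumes "even_lattice L" and "rootless L"
    and "prime p" and "odd p"
    and "g \<in> lattice_isometries L" and "has_order_on L g p" and "fixed_point_free_on L g"
    and "lattice_cocycle L \<epsilon>" and "ghat \<in> lifts L \<epsilon> g"
    and "\<tau> \<in> voa_Aut (fixed_subVOA (lattice_VOA L \<epsilon>) (lift_action g ghat))"
    and "1 \<le> j" and "j \<le> p - 1" and "r \<le> p - 1"
    and "lam \<in> dual_lattice L" and "lam \<notin> L" and "lam - g lam \<in> L"
    and "module_lift L \<epsilon> p (lift_action g ghat) lam G"
    and "module_isomorphic (fixed_subVOA (lattice_VOA L \<epsilon>) (lift_action g ghat))
           (module_twist (eigen_module (lattice_module L \<epsilon> 0) p (lift_action g ghat) j) \<tau>)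
           (eigen_module (lattice_module L \<epsilon> lam) p G r)"
  shows "\<exists>t C. t * (p - 1) = DIM('a) \<and> is_code p t C \<and> self_orthogonal p t C \<and>
    (\<exists>\<psi>. lattice_isom L (\<bullet>) (L_B p t C) (block_inner p t) \<psi>) \<and>
    (\<exists>\<phi> \<Delta> e. lattice_isom N (\<bullet>) (L_A p t C) (block_inner p t) \<phi> \<and> \<phi> ` L = L_B p t C \<and>
       root_base (norm2_vectors N) \<Delta> \<and> \<phi> ` \<Delta> = R_base p t \<and>
       e \<in> dual_code p t C \<and> hamming_weight t e = t \<and>
       (\<forall>x\<in>N. \<phi> (g x) = g_Delta p t e (\<phi> x))) \<and>
    (\<exists>c\<in>dual_code p t C. hamming_weight t c = t)"
proof -
  obtain B where B: "independent B" "span B = UNIV" "L = int_span B"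
    using \<open>even_lattice L\<close> by (auto simp: even_lattice_def full_lattice_def)
  interpret L: int_module L unfolding B(3) by (rule int_module_int_span)
  have "B \<subseteq> L" unfolding B(3) using int_span_base by blast
  then have span_L: "span L = UNIV" using span_mono[of B L] B(2) by blast
  have g: "orthogonal_transformation g" "g ` L = L"
    using \<open>g \<in> lattice_isometries L\<close> by (auto simp: lattice_isometries_def)
  have lin: "linear g" using g(1) by (simp add: orthogonal_transformation_def)
  \<comment> \<open>The order is only known on \<open>L\<close>, but \<open>L\<close> spans the
    space.\<close>
  have gp: "(g ^^ p) x = x" for x
    using linear_eq_on_span[OF linear_funpow[OF lin] linear_id, of L p x] span_L \<open>has_order_on L g p\<close>
    by (simp add: has_order_on_def)
  interpret rootless_orbits L g p lam
  proof unfold_locales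
    show "x \<bullet> x \<noteq> 2" if "x \<in> L" for x
      using \<open>rootless L\<close> that by (auto simp: rootless_def norm2_vectors_def)
  qed (use assms span_L g gp in \<open>auto simp: even_lattice_def fixed_point_free_on_def\<close>)
  interpret twisted_lattice L g p \<epsilon> ghat
    by unfold_locales (use assms g gp L.zero L.minus in auto)
  show ?thesis
  proof (rule construction_AB_from_orbits)
    show "N = int_span (insert lam L)" by (simp add: N_def)
    fix S Z :: "'a set"
    assume S: "finite S" "\<And>x. x \<in> X \<Longrightarrow> \<exists>s\<in>S. \<exists>i. x = (g ^^ i) s"
      and Z: "finite Z" "\<And>y. y \<in> Z \<Longrightarrow> g y \<noteq> y" "\<And>y i. y \<in> Z \<Longrightarrow> (g ^^ i) y \<bullet> y \<in> \<int>"
        "\<And>y z i. y \<in> Z \<Longrightarrow> z \<in> Z \<Longrightarrow> y \<noteq> z \<Longrightarrow> (g ^^ i) y \<bullet> z = 0"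
    have reps: "\<exists>s\<in>S. \<exists>i. x = (g ^^ i) s" if "x - lam \<in> L" "x \<bullet> x = 2" for x
      using S(2) that by (simp add: X_def)
    show "card Z \<le> card S"
      using \<open>prime p\<close> \<open>1 \<le> j\<close> \<open>j \<le> p - 1\<close> \<open>lam \<notin> L\<close>
        \<open>\<tau> \<in> voa_Aut (fixed_subVOA (lattice_VOA L \<epsilon>) (lift_action g ghat))\<close>
        \<open>module_lift L \<epsilon> p (lift_action g ghat) lam G\<close>
        \<open>module_isomorphic (fixed_subVOA (lattice_VOA L \<epsilon>) (lift_action g ghat))
           (module_twist (eigen_module (lattice_module L \<epsilon> 0) p (lift_action g ghat) j) \<tau>)
           (eigen_module (lattice_module L \<epsilon> lam) p G r)\<close> S(1) reps Z
      by (rule orthogonal_orbits_le)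
  qed
qed

end
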